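(* Let $G$ be a countably infinite amenable group and let $(\mathcal{X},G)$ be a $G$-system with metric $d$. Suppose that $(\mathcal{X},d)$ has tame growth of covering numbers. Then for any real $p\ge 1$ and any F\o lner sequence $\{F_n\}$ in $G$, $$\overline{\mathrm{mdim}}_M(\mathcal{X},G,d)=\limsup_{\varepsilon\to 0}\frac{\sup_{\mu\in M(\mathcal{X},G)}\overline{R}_{\mu,p}(\{F_n\},\varepsilon)}{|\log \varepsilon|}=\limsup_{\varepsilon\to 0}\frac{\sup_{\mu\in M(\mathcal{X},G)}\underline{R}_{\mu,p}(\{F_n\},\varepsilon)}{|\log \varepsilon|}$$ and $$\underline{\mathrm{mdim}}_M(\mathcal{X},G,d)=\liminf_{\varepsilon\to 0}\frac{\sup_{\mu\in M(\mathcal{X},G)}\overline{R}_{\mu,p}(\{F_n\},\varepsilon)}{|\log \varepsilon|}=\liminf_{\varepsilon\to 0}\frac{\sup_{\mu\in M(\mathcal{X},G)}\underline{R}_{\mu,p}(\{F_n\},\varepsilon)}{|\log \varepsilon|}.$$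
   Context: $G$ is a countably infinite (discrete) amenable group; $F(G)$ is the collection of nonempty finite subsets of $G$. A F\o lner sequence is a sequence $\{F_n\}$ in $F(G)$ with $\lim_{n\to\infty}|F_n\triangle gF_n|/|F_n|=0$ for every $g\in G$. A $G$-system $(\mathcal{X},G)$ with metric $d$ is a compact metric space $(\mathcal{X},d)$ on which $G$ acts (on the left) by homeomorphisms. $M(\mathcal{X},G)$ is the set of $G$-invariant Borel probability measures on $\mathcal{X}$. Covering numbers: for a metric $\rho$ on $\mathcal{X}$ (compatible with the topology) and $\varepsilon>0$, $\#(\mathcal{X},\rho,\varepsilon)$ is the minimal cardinality of an open cover of $\mathcal{X}$ by sets of $\rho$-diameter $<\varepsilon$. $(\mathcal{X},d)$ has tame growth of covering numbers if for every $\delta>0$, $\lim_{\varepsilon\to0}\varepsilon^{\delta}\log\#(\mathcal{X},d,\varepsilon)=0$. Metric mean dimension: for $F\in F(G)$ let $d_F(x,y)=\max_{g\in F}d(gx,gy)$. Put $S(\mathcal{X},G,d,\varepsilon)=\lim_{n\to\infty}\frac{1}{|F_n|}\log\#(\mathcal{X},d_{F_n},\varepsilon)$; this limit exists and does not depend on the F\o lner sequence $\{F_n\}$. Then $\overline{\mathrm{mdim}}_M(\mathcal{X},G,d)=\limsup_{\varepsilon\to0}\frac{S(\mathcal{X},G,d,\varepsilon)}{|\log\varepsilon|}$ and $\underline{\mathrm{mdim}}_M(\mathcal{X},G,d)=\liminf_{\varepsilon\to0}\frac{S(\mathcal{X},G,d,\varepsilon)}{|\log\varepsilon|}$. Mutual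 information: for measurable maps $X:\Omega\to\mathcal{A}$, $Y:\Omega\to\mathcal{B}$ from a probability space $(\Omega,\mathbb{P})$ to measurable spaces, $$I(X;Y)=\sup_{\mathcal{P},\mathcal{Q}}\sum_{P\in\mathcal{P},Q\in\mathcal{Q}}\mathbb{P}((X,Y)\in P\times Q)\log\frac{\mathbb{P}((X,Y)\in P\times Q)}{\mathbb{P}(X\in P)\mathbb{P}(Y\in Q)},$$ where $\mathcal{P},\mathcal{Q}$ run over finite measurable partitions of $\mathcal{A}$ and $\mathcal{B}$, with the convention $0\log\frac{0}{a}=0$ for $a\ge0$. $L^p$ rate distortion functions ($1\le p<\infty$): let $\varepsilon>0$, $\mu\in M(\mathcal{X},G)$, $F\in F(G)$. Let $X:\Omega\to\mathcal{X}$ and $Y_g:\Omega\to\mathcal{X}$ ($g\in F$) be random variables on some probability space $(\Omega,\mathbb{P})$ such that $X$ has law $\mu$; $X$ and $Y=(Y_g)_{g\in F}$ are $(F,\varepsilon)_{L^p}$-close if $\mathbb{E}\big(\frac{1}{|F|}\sum_{g\in F}d(gX,Y_g)^p\big)<\varepsilon^p$. Let $R_{\mu,p}(\varepsilon,F)$ be the infimum of $I(X;Y)$ over all such $(F,\varepsilon)_{L^p}$-close $X,Y$ (over all probability spaces). For a F\o lner sequence $\{F_n\}$, $\overline{R}_{\mu,p}(\{F_n\},\varepsilon)=\limsup_{n\to\infty}\frac{R_{\mu,p}(\varepsilon,F_n)}{|F_n|}$ and $\underline{R}_{\mu,p}(\{F_n\},\varepsilon)=\liminf_{n\to\infty}\frac{R_{\mu,p}(\varepsilon,F_n)}{|F_n|}$.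 *)

theory Defs
  imports "HOL-Probability.Probability" "HOL-Algebra.Group_Action"
begin

section \<open>Groups and systems\<close>

definition folner_sequence :: "('g, 'b) monoid_scheme \<Rightarrow> (nat \<Rightarrow> 'g set) \<Rightarrow> bool" where
  "folner_sequence G F \<longleftrightarrow>
     (\<forall>n. F n \<subseteq> carrier G \<and> finite (F n) \<and> F n \<noteq> {}) \<and>
     (\<forall>g\<in>carrier G.
        (\<lambda>n. real (card (sym_diff (F n) (g <#\<^bsub>G\<^esub> F n))) / real (card (F n))) \<longlonglongrightarrow> 0)"

definition amenable :: "('g, 'b) monoid_scheme \<Rightarrow> bool" where
  "amenable G \<longleftrightarrow> (\<exists>F. folner_sequence G F)"

text \<open>
  The phase space is the whole type, its metric \<^term>\<open>dist\<close>. Compactness of the type is part of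
  the definition of a system.
\<close>

definition G_system :: "('g, 'b) monoid_scheme \<Rightarrow> ('g \<Rightarrow> 'x::metric_space \<Rightarrow> 'x) \<Rightarrow> bool" where
  "G_system G \<phi> \<longleftrightarrow>
     compact (UNIV :: 'x set) \<and>
     group_action G UNIV \<phi> \<and>
     (\<forall>g\<in>carrier G. homeomorphism UNIV UNIV (\<phi> g) (\<phi> (inv\<^bsub>G\<^esub> g)))"

definition invariant_measures ::
    "('g, 'b) monoid_scheme \<Rightarrow> ('g \<Rightarrow> 'x::metric_space \<Rightarrow> 'x) \<Rightarrow> 'x measure set" where
  "invariant_measures G \<phi> =
     {\<mu>. prob_space \<mu> \<and> sets \<mu> = sets borel \<and> (\<forall>g\<in>carrier G. distr \<mu> borel (\<phi> g) = \<mu>)}"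


section \<open>Covering numbers and metric mean dimension\<close>

text \<open>The library's \<^const>\<open>diameter\<close>, for an arbitrary (bounded) metric in place of \<^const>\<open>dist\<close>.\<close>

definition diam :: "('x \<Rightarrow> 'x \<Rightarrow> real) \<Rightarrow> 'x set \<Rightarrow> real" where
  "diam \<rho> U = (if U = {} then 0 else SUP (x, y)\<in>U \<times> U. \<rho> x y)"

text \<open>
  Openness refers to the topology of the type, so \<open>\<rho>\<close> is meant to be compatible with it. The
  requirement that covers be finite excludes the value \<open>card \<U> = 0\<close> for infinite \<open>\<U>\<close>.
\<close>

definition cover_num :: "('x::topological_space \<Rightarrow> 'x \<Rightarrow> real) \<Rightarrow> real \<Rightarrow> nat" where
  "cover_num \<rho> \<epsilon> =
     Inf {card \<U> | \<U>. finite \<U> \<and> (\<forall>U\<in>\<U>. open U \<and> diam \<rho> U < \<epsilon>) \<and> \<Union>\<U> = UNIV}"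

definition tame_growth :: "'x::metric_space itself \<Rightarrow> bool" where
  "tame_growth _ \<longleftrightarrow>
     (\<forall>\<delta>>0. ((\<lambda>\<epsilon>. \<epsilon> powr \<delta> * ln (real (cover_num (dist :: 'x \<Rightarrow> 'x \<Rightarrow> real) \<epsilon>))) \<longlongrightarrow> 0) (at_right 0))"

definition dist_on :: "('g \<Rightarrow> 'x::metric_space \<Rightarrow> 'x) \<Rightarrow> 'g set \<Rightarrow> 'x \<Rightarrow> 'x \<Rightarrow> real" where
  "dist_on \<phi> F x y = Max ((\<lambda>g. dist (\<phi> g x) (\<phi> g y)) ` F)"

text \<open>
  The common value, for all Folner sequences, of the limit of
  \<open>ln (cover_num (dist_on \<phi> (F n)) \<epsilon>) / card (F n)\<close>.
\<close>

definition cover_entropy ::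
    "('g, 'b) monoid_scheme \<Rightarrow> ('g \<Rightarrow> 'x::metric_space \<Rightarrow> 'x) \<Rightarrow> real \<Rightarrow> real" where
  "cover_entropy G \<phi> \<epsilon> =
     (THE L. \<forall>F. folner_sequence G F \<longrightarrow>
        (\<lambda>n. ln (real (cover_num (dist_on \<phi> (F n)) \<epsilon>)) / real (card (F n))) \<longlonglongrightarrow> L)"

definition mdim_upper :: "('g, 'b) monoid_scheme \<Rightarrow> ('g \<Rightarrow> 'x::metric_space \<Rightarrow> 'x) \<Rightarrow> ereal" where
  "mdim_upper G \<phi> = Limsup (at_right 0) (\<lambda>\<epsilon>. ereal (cover_entropy G \<phi> \<epsilon> / \<bar>ln \<epsilon>\<bar>))"

definition mdim_lower :: "('g, 'b) monoid_scheme \<Rightarrow> ('g \<Rightarrow> 'x::metric_space \<Rightarrow> 'x) \<Rightarrow> ereal" where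
  "mdim_lower G \<phi> = Liminf (at_right 0) (\<lambda>\<epsilon>. ereal (cover_entropy G \<phi> \<epsilon> / \<bar>ln \<epsilon>\<bar>))"


section \<open>Mutual information\<close>

definition finite_partitions :: "'a measure \<Rightarrow> 'a set set set" where
  "finite_partitions A = {P. finite P \<and> P \<subseteq> sets A \<and> partition_on (space A) P}"

text \<open>
  The library's \<open>mutual_information\<close> is built from a Radon-Nikodym derivative and a Bochner
  integral, which default to arbitrary values when the mutual information is infinite. Here it is
  the supremum over finite measurable partitions. The convention \<open>0 * log (0 / a) = 0\<close> is
  automatic, and a vanishing denominator forces a vanishing factor in front of the logarithm.
\<close>

definition partition_info ::
    "'w measure \<Rightarrow> ('w \<Rightarrow> 'a) \<Rightarrow> ('w \<Rightarrow> 'b) \<Rightarrow> 'a set set \<Rightarrow> 'b set set \<Rightarrow> real" where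
  "partition_info M X Y \<P> \<Q> =
     (\<Sum>P\<in>\<P>. \<Sum>Q\<in>\<Q>.
        measure M {\<omega>\<in>space M. X \<omega> \<in> P \<and> Y \<omega> \<in> Q} *
        ln (measure M {\<omega>\<in>space M. X \<omega> \<in> P \<and> Y \<omega> \<in> Q} /
            (measure M {\<omega>\<in>space M. X \<omega> \<in> P} * measure M {\<omega>\<in>space M. Y \<omega> \<in> Q})))"

definition mutual_info ::
    "'w measure \<Rightarrow> 'a measure \<Rightarrow> 'b measure \<Rightarrow> ('w \<Rightarrow> 'a) \<Rightarrow> ('w \<Rightarrow> 'b) \<Rightarrow> ereal" where
  "mutual_info M A B X Y =
     (SUP (\<P>, \<Q>) \<in> finite_partitions A \<times> finite_partitions B. ereal (partition_info M X Y \<P> \<Q>))"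


section \<open>Rate distortion functions\<close>

definition lp_close ::
    "('g \<Rightarrow> 'x::metric_space \<Rightarrow> 'x) \<Rightarrow> real \<Rightarrow> 'g set \<Rightarrow> real \<Rightarrow>
     'w measure \<Rightarrow> ('w \<Rightarrow> 'x) \<Rightarrow> ('g \<Rightarrow> 'w \<Rightarrow> 'x) \<Rightarrow> bool" where
  "lp_close \<phi> p F \<epsilon> M X Y \<longleftrightarrow>
     (\<integral>\<omega>. 1 / real (card F) * (\<Sum>g\<in>F. dist (\<phi> g (X \<omega>)) (Y g \<omega>) powr p) \<partial>M) < \<epsilon> powr p"

definition admissible ::
    "('g \<Rightarrow> 'x::metric_space \<Rightarrow> 'x) \<Rightarrow> 'x measure \<Rightarrow> real \<Rightarrow> real \<Rightarrow> 'g set \<Rightarrow>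
     'w measure \<Rightarrow> ('w \<Rightarrow> 'x) \<Rightarrow> ('g \<Rightarrow> 'w \<Rightarrow> 'x) \<Rightarrow> bool" where
  "admissible \<phi> \<mu> p \<epsilon> F M X Y \<longleftrightarrow>
     prob_space M \<and>
     X \<in> measurable M borel \<and> (\<forall>g\<in>F. Y g \<in> measurable M borel) \<and>
     distr M borel X = \<mu> \<and>
     lp_close \<phi> p F \<epsilon> M X Y"

definition family_info ::
    "'g set \<Rightarrow> 'w measure \<Rightarrow> ('w \<Rightarrow> 'x::metric_space) \<Rightarrow> ('g \<Rightarrow> 'w \<Rightarrow> 'x) \<Rightarrow> ereal" where
  "family_info F M X Y =
     mutual_info M borel (Pi\<^sub>M F (\<lambda>_. borel)) X (\<lambda>\<omega>. \<lambda>g\<in>F. Y g \<omega>)"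

text \<open>
  The infimum is over all probability spaces whose points are of type \<open>'x \<times> ('g \<Rightarrow> 'x)\<close>. This is no
  restriction: any admissible \<open>X, Y\<close> on any probability space can be replaced by the coordinate
  maps under their joint law; see \<open>rate_distortion_le\<close> below.
\<close>

definition rate_distortion ::
    "('g \<Rightarrow> 'x::metric_space \<Rightarrow> 'x) \<Rightarrow> 'x measure \<Rightarrow> real \<Rightarrow> real \<Rightarrow> 'g set \<Rightarrow> ereal" where
  "rate_distortion \<phi> \<mu> p \<epsilon> F =
     Inf {family_info F M X Y | (M :: ('x \<times> ('g \<Rightarrow> 'x)) measure) X Y. admissible \<phi> \<mu> p \<epsilon> F M X Y}"

definition rate_upper ::
    "('g \<Rightarrow> 'x::metric_space \<Rightarrow> 'x) \<Rightarrow> 'x measure \<Rightarrow> real \<Rightarrow> (nat \<Rightarrow> 'g set) \<Rightarrow> real \<Rightarrow> ereal" where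
  "rate_upper \<phi> \<mu> p F \<epsilon> =
     limsup (\<lambda>n. rate_distortion \<phi> \<mu> p \<epsilon> (F n) / ereal (real (card (F n))))"

definition rate_lower ::
    "('g \<Rightarrow> 'x::metric_space \<Rightarrow> 'x) \<Rightarrow> 'x measure \<Rightarrow> real \<Rightarrow> (nat \<Rightarrow> 'g set) \<Rightarrow> real \<Rightarrow> ereal" where
  "rate_lower \<phi> \<mu> p F \<epsilon> =
     liminf (\<lambda>n. rate_distortion \<phi> \<mu> p \<epsilon> (F n) / ereal (real (card (F n))))"


section \<open>The infimum does not depend on the choice of underlying type\<close>

lemma compact_countable_dense:
  assumes "compact (UNIV :: 'x::metric_space set)"
  obtains D :: "'x::metric_space set" where "countable D" "\<And>x e. e > 0 \<Longrightarrow> \<exists>q\<in>D. dist x q < e"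
proof -
  have "\<exists>k. finite k \<and> (UNIV :: 'x set) \<subseteq> (\<Union>x\<in>k. ball x (1 / real (Suc n)))" for n
    using assms unfolding compact_eq_totally_bounded by simp
  then obtain k where k: "\<And>n. finite (k n)"
    "\<And>n. (UNIV :: 'x set) \<subseteq> (\<Union>x\<in>k n. ball x (1 / real (Suc n)))"
    by metis
  have "\<exists>q\<in>(\<Union>n. k n). dist x q < e" if e: "e > 0" for x e
  proof -
    obtain n where n: "1 / real (Suc n) < e"
      using nat_approx_posE[OF e] by blast
    from k(2)[of n] obtain q where "q \<in> k n" "x \<in> ball q (1 / real (Suc n))"
      by blast
    with n show ?thesis by (force simp: dist_commute)
  qed
  moreover have "countable (\<Union>n. k n)"
    using k(1) by (simp add: countable_finite)
  ultimately show thesis using that by blast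
qed

text \<open>
  The library's measurability rule for \<^const>\<open>dist\<close> needs the sort \<open>second_countable_topology\<close>.
\<close>

lemma borel_measurable_dist_compact:
  fixes f g :: "'w \<Rightarrow> 'x::metric_space"
  assumes "compact (UNIV :: 'x set)" "f \<in> measurable M borel" "g \<in> measurable M borel"
  shows "(\<lambda>w. dist (f w) (g w)) \<in> borel_measurable M"
proof -
  obtain D :: "'x set" where D: "countable D" "\<And>x e. e > 0 \<Longrightarrow> \<exists>q\<in>D. dist x q < e"
    using compact_countable_dense[OF assms(1)] by metis
  have d: "(\<lambda>w. dist (h w) q) \<in> borel_measurable M" if "h \<in> measurable M borel" for q :: 'x and h
    by (rule measurable_compose[OF that borel_measurable_continuous_onI]) (intro continuous_intros)
  have "{w \<in> space M. dist (f w) (g w) < r} \<in> sets M" for r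
  proof -
    have "dist a b < r \<longleftrightarrow> (\<exists>q\<in>D. dist a q + dist b q < r)" for a b
    proof
      assume "dist a b < r"
      then obtain q where "q \<in> D" "dist a q < (r - dist a b) / 2"
        using D(2)[of "(r - dist a b) / 2" a] by auto
      moreover have "dist b q \<le> dist a b + dist a q"
        by (metis dist_commute dist_triangle)
      ultimately show "\<exists>q\<in>D. dist a q + dist b q < r"
        by (intro bexI[of _ q]) (auto simp: field_simps)
    next
      assume "\<exists>q\<in>D. dist a q + dist b q < r"
      then show "dist a b < r" by (meson dist_triangle2 le_less_trans)
    qed
    then have "{w \<in> space M. dist (f w) (g w) < r} =
        (\<Union>q\<in>D. {w \<in> space M. dist (f w) q + dist (g w) q < r})"
      by auto
    also have "\<dots> \<in> sets M"
    proof (intro sets.countable_UN'' D(1))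
      fix q
      show "{w \<in> space M. dist (f w) q + dist (g w) q < r} \<in> sets M"
        using borel_measurable_add[OF d[OF assms(2), of q] d[OF assms(3), of q]]
        by (simp add: borel_measurable_iff_less)
    qed
    finally show ?thesis .
  qed
  then show ?thesis by (simp add: borel_measurable_iff_less)
qed

theorem rate_distortion_le:
  fixes M :: "'w measure" and \<phi> :: "'g \<Rightarrow> 'x::metric_space \<Rightarrow> 'x"
  assumes sys: "G_system G \<phi>" and F: "F \<subseteq> carrier G"
    and adm: "admissible \<phi> \<mu> p \<epsilon> F M X Y"
  shows "rate_distortion \<phi> \<mu> p \<epsilon> F \<le> family_info F M X Y"
proof -
  let ?B = "borel \<Otimes>\<^sub>M Pi\<^sub>M F (\<lambda>_. borel) :: ('x \<times> ('g \<Rightarrow> 'x)) measure"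
  let ?Y = "\<lambda>\<omega>. \<lambda>g\<in>F. Y g \<omega>"
  let ?T = "\<lambda>\<omega>. (X \<omega>, ?Y \<omega>)"
  define N where "N = distr M ?B ?T"
  define Z where "Z = (\<lambda>(g :: 'g) (z :: 'x \<times> ('g \<Rightarrow> 'x)). snd z g)"
  from adm have M: "prob_space M" and X: "X \<in> measurable M borel"
    and Y: "\<And>g. g \<in> F \<Longrightarrow> Y g \<in> measurable M borel" and \<mu>: "distr M borel X = \<mu>"
    and cl: "lp_close \<phi> p F \<epsilon> M X Y"
    by (auto simp: admissible_def)
  have Y': "?Y \<in> measurable M (Pi\<^sub>M F (\<lambda>_. borel))"
    by (rule measurable_restrict) (rule Y)
  have T: "?T \<in> measurable M ?B"
    using X Y' by simp
  have Z: "Z g \<in> measurable ?B borel" if "g \<in> F" for g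
    unfolding Z_def using that by simp
  have snd_eq: "(\<lambda>g\<in>F. Z g z) = snd z" if "z \<in> space ?B" for z
    using that by (auto simp: Z_def space_pair_measure space_PiM PiE_restrict)
  have meas: "(\<lambda>z. 1 / real (card F) * (\<Sum>g\<in>F. dist (\<phi> g (fst z)) (Z g z) powr p))
      \<in> borel_measurable ?B"
  proof (intro borel_measurable_times borel_measurable_const borel_measurable_sum)
    fix g assume g: "g \<in> F"
    have "continuous_on UNIV (\<phi> g)"
      using sys F g by (auto simp: G_system_def homeomorphism_def)
    then have "(\<lambda>z. \<phi> g (fst z)) \<in> measurable ?B borel"
      by (intro measurable_compose[OF measurable_fst borel_measurable_continuous_onI])
    then have "(\<lambda>z. dist (\<phi> g (fst z)) (Z g z)) \<in> borel_measurable ?B"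
      using sys Z[OF g] by (intro borel_measurable_dist_compact) (auto simp: G_system_def)
    then show "(\<lambda>z. dist (\<phi> g (fst z)) (Z g z) powr p) \<in> borel_measurable ?B"
      by simp
  qed
  have adm_N: "admissible \<phi> \<mu> p \<epsilon> F N fst Z"
    unfolding admissible_def lp_close_def
  proof (intro conjI ballI)
    show "prob_space N"
      unfolding N_def by (rule prob_space.prob_space_distr[OF M T])
    show "distr N borel fst = \<mu>"
      unfolding N_def \<mu>[symmetric] by (subst distr_distr[OF _ T]) (simp_all add: comp_def)
    have "(\<integral>z. 1 / real (card F) * (\<Sum>g\<in>F. dist (\<phi> g (fst z)) (Z g z) powr p) \<partial>N) =
        (\<integral>\<omega>. 1 / real (card F) * (\<Sum>g\<in>F. dist (\<phi> g (X \<omega>)) (Y g \<omega>) powr p) \<partial>M)"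
      unfolding N_def by (subst integral_distr[OF T meas]) (simp add: Z_def)
    then show "(\<integral>z. 1 / real (card F) * (\<Sum>g\<in>F. dist (\<phi> g (fst z)) (Z g z) powr p) \<partial>N) < \<epsilon> powr p"
      using cl unfolding lp_close_def by (rule ord_eq_less_trans)
  qed (use Z in \<open>auto simp: N_def\<close>)
  have "partition_info N fst (\<lambda>z. \<lambda>g\<in>F. Z g z) \<P> \<Q> = partition_info M X ?Y \<P> \<Q>"
    if "\<P> \<in> finite_partitions borel" "\<Q> \<in> finite_partitions (Pi\<^sub>M F (\<lambda>_. borel))" for \<P> \<Q>
  proof -
    have sp: "space N = space ?B" by (simp add: N_def)
    have m: "measure N {z \<in> space N. fst z \<in> P \<and> (\<lambda>g\<in>F. Z g z) \<in> Q} =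
        measure M {\<omega> \<in> space M. X \<omega> \<in> P \<and> ?Y \<omega> \<in> Q}"
      if "P \<in> sets borel" "Q \<in> sets (Pi\<^sub>M F (\<lambda>_. borel))" for P Q
    proof -
      have "{z \<in> space N. fst z \<in> P \<and> (\<lambda>g\<in>F. Z g z) \<in> Q} = P \<times> Q"
        using sets.sets_into_space[OF that(2)] snd_eq
        by (auto simp: sp space_pair_measure)
      moreover have "P \<times> Q \<in> sets ?B" using that by simp
      ultimately show ?thesis
        unfolding N_def by (simp add: measure_distr[OF T]) (rule arg_cong[of _ _ "measure M"], auto)
    qed
    have top: "UNIV \<in> sets (borel :: 'x measure)"
      "space (Pi\<^sub>M F (\<lambda>_. borel)) \<in> sets (Pi\<^sub>M F (\<lambda>_. borel :: 'x measure))" by auto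
    have inS: "(\<lambda>g\<in>F. y g) \<in> space (Pi\<^sub>M F (\<lambda>_. borel :: 'x measure))" for y
      by (simp add: space_PiM)
    have mX: "measure N {z \<in> space N. fst z \<in> P} = measure M {\<omega> \<in> space M. X \<omega> \<in> P}"
      if "P \<in> sets borel" for P
      using m[OF that top(2)] inS by simp
    have mY: "measure N {z \<in> space N. (\<lambda>g\<in>F. Z g z) \<in> Q} = measure M {\<omega> \<in> space M. ?Y \<omega> \<in> Q}"
      if "Q \<in> sets (Pi\<^sub>M F (\<lambda>_. borel))" for Q
      using m[OF top(1) that] by simp
    show ?thesis
      unfolding partition_info_def
    proof (intro sum.cong refl)
      fix P Q assume "P \<in> \<P>" "Q \<in> \<Q>"
      then have "P \<in> sets borel" "Q \<in> sets (Pi\<^sub>M F (\<lambda>_. borel))"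
        using that by (auto simp: finite_partitions_def)
      then show "measure N {z \<in> space N. fst z \<in> P \<and> (\<lambda>g\<in>F. Z g z) \<in> Q} *
          ln (measure N {z \<in> space N. fst z \<in> P \<and> (\<lambda>g\<in>F. Z g z) \<in> Q} /
            (measure N {z \<in> space N. fst z \<in> P} * measure N {z \<in> space N. (\<lambda>g\<in>F. Z g z) \<in> Q})) =
          measure M {\<omega> \<in> space M. X \<omega> \<in> P \<and> ?Y \<omega> \<in> Q} *
          ln (measure M {\<omega> \<in> space M. X \<omega> \<in> P \<and> ?Y \<omega> \<in> Q} /
            (measure M {\<omega> \<in> space M. X \<omega> \<in> P} * measure M {\<omega> \<in> space M. ?Y \<omega> \<in> Q}))"
        by (simp only: m mX mY)
    qed
  qed
  then have "family_info F N fst Z = family_info F M X Y"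
    unfolding family_info_def mutual_info_def by (intro SUP_cong) auto
  with adm_N show ?thesis
    unfolding rate_distortion_def by (metis (mono_tags, lifting) Inf_lower mem_Collect_eq)
qed

end

theory Submission
  imports Defs
begin

text \<open>
  By the Ornstein-Weiss lemma the limit defining \<^const>\<open>cover_entropy\<close> exists, and quantizing a point
  by a cover with small \<open>d\<^sub>F\<close>-diameters bounds the rate distortion function by the logarithm of the
  covering number.

  For the converse take maximal \<open>(F\<^sub>n, \<epsilon>)\<close>-separated sets \<open>E\<^sub>n\<close> and average the translates of the
  uniform distribution on \<open>E\<^sub>n\<close> over \<open>F\<^sub>n\<close>. A Shearer inequality in place of tilings shows that a
  limit measure \<open>\<mu>\<close> satisfies \<open>H\<^sub>\<mu>(P\<^sup>T) \<ge> |T| S(4\<epsilon>)\<close> for every finite \<open>T\<close> and every partition \<open>P\<close> with cells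
  of diameter below \<open>\<epsilon>\<close> and null boundaries. Region growing produces such a \<open>P\<close> with \<open>N\<close> cells for
  which a point has its \<open>r\<close>-neighbourhood cut with probability only \<open>O(r log N / \<epsilon>)\<close>. Then \<open>P(Y\<^sub>g)\<close> guesses
  \<open>P(g X)\<close> with few errors, and by Gibbs' inequality \<open>I(X; Y)\<close> is at least \<open>H\<^sub>\<mu>(P\<^sup>T)\<close> up to \<open>O(|T|)\<close>.
  Tame growth makes \<open>log N\<close> subpolynomial in \<open>1/\<epsilon>\<close>, so that the distortion may be taken to be a power of
  \<open>\<epsilon>\<close> with exponent arbitrarily close to \<open>1\<close>.
\<close>

section \<open>The Ornstein-Weiss lemma\<close>

text \<open>The padded partition is built for the limit measure, so the entropy inequality has to
  hold for partitions chosen after the limit is taken. The averages therefore converge on all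
  subsets at once, by Tychonoff along a filter finer than \<open>sequentially\<close>. Their limit
  \<nu> is only finitely additive, and the Borel measure \<mu> is its regularization. The two agree
  on sets squeezed between an open and a closed set that differ by a \<mu>-null set; this is what
  null spheres as cell boundaries are for.

  A wrong guess in one coordinate costs ln N, so errors may occur only with frequency of order 1 /
  ln N. Let V = u powr (- \<delta>) dominate ln N at scale u, and let e be the distortion. Padding
  radius r = e V makes the Markov term at most 1 / V, and region growing in a collar of width u
  gives \<kappa> of order r V / u. Multiplied by ln N, both stay bounded when e V ^ 3 is at most a
  constant times u, that is, e is about u powr (1 + 3 \<delta>). Comparing scale e with scale e powr
  \<theta> changes the denominator by the factor \<theta> only, and \<theta> tends to 1.\<close>

context group begin

lemma card_r_coset:
  assumes "T \<subseteq> carrier G" "c \<in> carrier G"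
  shows "card (T #> c) = card T"
proof -
  have "T #> c = (\<lambda>t. t \<otimes> c) ` T" by (auto simp: r_coset_def)
  moreover have "inj_on (\<lambda>t. t \<otimes> c) T" using assms by (auto intro!: inj_onI simp: subset_iff)
  ultimately show ?thesis by (simp add: card_image)
qed

lemma finite_r_coset: "finite T \<Longrightarrow> finite (T #> c)"
  by (auto simp: r_coset_def)

lemma set_mult_eq_UN_r_coset: "T <#> C = (\<Union>c\<in>C. T #> c)"
  by (auto simp: set_mult_def r_coset_def)

lemma finite_set_mult: "finite T \<Longrightarrow> finite C \<Longrightarrow> finite (T <#> C)"
  by (auto simp: set_mult_def)

definition inner_centers :: "'a set \<Rightarrow> 'a set \<Rightarrow> 'a set" where
  "inner_centers T R = {c \<in> carrier G. T #> c \<subseteq> R}"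

text \<open>Right translates W c fit the Folner condition: the c in R with w c outside R correspond
  to the points of w R - R.\<close>

definition boundary :: "'a set \<Rightarrow> 'a set \<Rightarrow> 'a set" where
  "boundary W R = {c \<in> R. \<not> W #> c \<subseteq> R}"

lemma finite_inner_centers:
  assumes "T \<subseteq> carrier G" "T \<noteq> {}" "finite R"
  shows "finite (inner_centers T R)"
proof -
  obtain t where t: "t \<in> T" "t \<in> carrier G" using assms by auto
  have "(\<lambda>c. t \<otimes> c) ` inner_centers T R \<subseteq> R"
    using t by (auto simp: inner_centers_def r_coset_def)
  moreover have "inj_on (\<lambda>c. t \<otimes> c) (inner_centers T R)"
    using t by (auto simp: inner_centers_def intro!: inj_onI)
  ultimately show ?thesis using assms(3) by (metis finite_imageD finite_subset)
qed

text \<open>Greedy choice: if no further translate of \<^term>\<open>T\<close> can be added, then every translate inside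
  \<^term>\<open>R\<close> meets the chosen ones in a fraction \<open>\<alpha>\<close>, and double counting bounds their union from below.\<close>

lemma quasi_disjoint_centers:
  fixes \<alpha> :: real
  assumes T: "T \<subseteq> carrier G" "finite T" "T \<noteq> {}" and R: "finite R"
    and \<alpha>: "0 < \<alpha>" "\<alpha> < 1"
  obtains C where "C \<subseteq> inner_centers T R" "finite C"
    "(1 - \<alpha>) * (real (card T) * real (card C)) \<le> card (T <#> C)"
    "\<alpha> * card (inner_centers T R) \<le> card (T <#> C)"
proof -
  let ?I = "inner_centers T R"
  let ?P = "\<lambda>C. C \<subseteq> ?I \<and> (1 - \<alpha>) * (real (card T) * real (card C)) \<le> card (T <#> C)"
  have fI: "finite ?I" using finite_inner_centers T R by simp
  have Icar: "?I \<subseteq> carrier G" by (auto simp: inner_centers_def)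
  have "\<forall>C. ?P C \<longrightarrow> card C < Suc (card ?I)"
    using fI by (auto simp: card_mono less_Suc_eq_le)
  moreover have "?P {}" by (simp)
  ultimately obtain C where C: "?P C" and max: "\<And>D. ?P D \<Longrightarrow> card D \<le> card C"
    using ex_has_greatest_nat[of ?P "{}" card "Suc (card ?I)"] by blast
  have fC: "finite C" using C fI finite_subset by blast
  let ?U = "T <#> C"
  have fU: "finite ?U" using T fC finite_set_mult by auto
  have overlap: "\<alpha> * card T \<le> card ((T #> c) \<inter> ?U)" if c: "c \<in> ?I" for c
  proof (rule ccontr)
    assume neg: "\<not> ?thesis"
    have cT: "card (T #> c) = card T" using card_r_coset T Icar c by blast
    have cC: "c \<notin> C"
    proof
      assume "c \<in> C"
      then have "(T #> c) \<inter> ?U = T #> c" by (auto simp: set_mult_eq_UN_r_coset)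
      with neg cT \<alpha> show False using mult_right_mono[of \<alpha> 1 "real (card T)"] by simp
    qed
    have un: "T <#> insert c C = ?U \<union> ((T #> c) - ?U)" by (auto simp: set_mult_eq_UN_r_coset)
    have "card (T <#> insert c C) = card ?U + card ((T #> c) - ?U)"
      unfolding un by (rule card_Un_disjoint) (use fU T finite_r_coset in auto)
    moreover have "card ((T #> c) - ?U) + card ((T #> c) \<inter> ?U) = card T"
      using card_Int_Diff[of "T #> c" ?U] T finite_r_coset cT by simp
    ultimately have "real (card (T <#> insert c C)) = card ?U + (card T - real (card ((T #> c) \<inter> ?U)))"
      by linarith
    then have "real (card (T <#> insert c C)) \<ge> card ?U + (1 - \<alpha>) * card T"
      using neg by (simp add: algebra_simps)
    then have "?P (insert c C)" using C c cC fC by (simp add: algebra_simps)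
    then have "card (insert c C) \<le> card C" by (rule max)
    with cC fC show False by simp
  qed
  have "\<alpha> * card T * card ?I = (\<Sum>c\<in>?I. \<alpha> * card T)" by simp
  also have "\<dots> \<le> (\<Sum>c\<in>?I. real (card ((T #> c) \<inter> ?U)))" by (intro sum_mono overlap)
  also have "\<dots> \<le> (\<Sum>c\<in>?I. \<Sum>t\<in>T. if t \<otimes> c \<in> ?U then 1 else 0)"
  proof (rule sum_mono)
    fix c assume "c \<in> ?I"
    have "(T #> c) \<inter> ?U = (\<lambda>t. t \<otimes> c) ` {t\<in>T. t \<otimes> c \<in> ?U}" by (auto simp: r_coset_def)
    then have "card ((T #> c) \<inter> ?U) \<le> card {t\<in>T. t \<otimes> c \<in> ?U}"
      using T by (simp add: card_image_le)
    also have "real \<dots> = (\<Sum>t\<in>T. if t \<otimes> c \<in> ?U then 1 else 0)"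
      using T by (simp add: sum.If_cases Int_def)
    finally show "real (card ((T #> c) \<inter> ?U)) \<le> (\<Sum>t\<in>T. if t \<otimes> c \<in> ?U then 1 else 0)" by simp
  qed
  \<comment> \<open>For fixed t the map c -> t c is injective, so at most |U| centers c have t c in
    U.\<close>
  also have "\<dots> = (\<Sum>t\<in>T. \<Sum>c\<in>?I. if t \<otimes> c \<in> ?U then 1 else 0)" by (rule sum.swap)
  also have "\<dots> \<le> (\<Sum>t\<in>T. real (card ?U))"
  proof (rule sum_mono)
    fix t assume t: "t \<in> T"
    have "card {c\<in>?I. t \<otimes> c \<in> ?U} \<le> card ?U"
      by (rule card_inj_on_le[of "\<lambda>c. t \<otimes> c"]) (use fU t T Icar in \<open>auto intro!: inj_onI simp: subset_iff\<close>)
    then show "(\<Sum>c\<in>?I. if t \<otimes> c \<in> ?U then 1 else 0) \<le> real (card ?U)"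
      using fI by (simp add: sum.If_cases Int_def)
  qed
  finally have "card T * (\<alpha> * card ?I) \<le> card T * real (card ?U)" by (simp add: algebra_simps)
  moreover have "card T > 0" using T by (simp add: card_gt_0_iff)
  ultimately have "\<alpha> * card ?I \<le> card ?U" by simp
  with C fC that show thesis by blast
qed

lemma card_Diff_l_coset:
  assumes "R \<subseteq> carrier G" "w \<in> carrier G"
  shows "card {c\<in>R. w \<otimes> c \<notin> R} = card (l_coset G w R - R)"
proof -
  have "(l_coset G w R) - R = (\<lambda>c. w \<otimes> c) ` {c\<in>R. w \<otimes> c \<notin> R}" by (auto simp: l_coset_def)
  moreover have "inj_on (\<lambda>c. w \<otimes> c) {c\<in>R. w \<otimes> c \<notin> R}" using assms by (auto intro!: inj_onI simp: subset_iff)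
  ultimately show ?thesis by (simp add: card_image)
qed

lemma folner_Diff_tendsto:
  assumes "folner_sequence G F" "g \<in> carrier G"
  shows "(\<lambda>n. real (card (l_coset G g (F n) - F n)) / card (F n)) \<longlonglongrightarrow> 0"
    and "(\<lambda>n. real (card (F n - l_coset G g (F n))) / card (F n)) \<longlonglongrightarrow> 0"
proof -
  let ?s = "\<lambda>n. real (card (sym_diff (F n) (l_coset G g (F n)))) / real (card (F n))"
  have s: "?s \<longlonglongrightarrow> 0" and fin: "\<And>n. finite (F n)" using assms by (auto simp: folner_sequence_def)
  have fl: "finite (l_coset G g (F n))" for n using fin by (auto simp: l_coset_def)
  have 1: "card (l_coset G g (F n) - F n) \<le> card (sym_diff (F n) (l_coset G g (F n)))"
    and 2: "card (F n - l_coset G g (F n)) \<le> card (sym_diff (F n) (l_coset G g (F n)))" for n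
    using fin[of n] fl[of n] by (auto intro!: card_mono)
  show "(\<lambda>n. real (card (l_coset G g (F n) - F n)) / card (F n)) \<longlonglongrightarrow> 0"
    by (rule tendsto_sandwich[OF _ _ tendsto_const s]) (use 1 in \<open>auto intro!: divide_right_mono always_eventually\<close>)
  show "(\<lambda>n. real (card (F n - l_coset G g (F n))) / card (F n)) \<longlonglongrightarrow> 0"
    by (rule tendsto_sandwich[OF _ _ tendsto_const s]) (use 2 in \<open>auto intro!: divide_right_mono always_eventually\<close>)
qed

lemma folner_boundary_tendsto:
  assumes F: "folner_sequence G F" and W: "W \<subseteq> carrier G" "finite W"
  shows "(\<lambda>n. real (card (boundary W (F n))) / card (F n)) \<longlonglongrightarrow> 0"
proof -
  have fin: "\<And>n. finite (F n)" and car: "\<And>n. F n \<subseteq> carrier G"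
    using F by (auto simp: folner_sequence_def)
  have "(\<lambda>n. \<Sum>w\<in>W. real (card (l_coset G w (F n) - F n)) / card (F n)) \<longlonglongrightarrow> 0"
    by (rule tendsto_null_sum) (use folner_Diff_tendsto[OF F] W in auto)
  moreover have "real (card (boundary W (F n))) / card (F n)
      \<le> (\<Sum>w\<in>W. real (card (l_coset G w (F n) - F n)) / card (F n))" for n
  proof -
    have "boundary W (F n) \<subseteq> (\<Union>w\<in>W. {c\<in>F n. w \<otimes> c \<notin> F n})"
      by (auto simp: boundary_def r_coset_def)
    then have "card (boundary W (F n)) \<le> card (\<Union>w\<in>W. {c\<in>F n. w \<otimes> c \<notin> F n})"
      using fin W by (intro card_mono) auto
    also have "\<dots> \<le> (\<Sum>w\<in>W. card {c\<in>F n. w \<otimes> c \<notin> F n})"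
      by (rule card_UN_le[OF W(2)])
    also have "\<dots> = (\<Sum>w\<in>W. card (l_coset G w (F n) - F n))"
      using car W by (intro sum.cong refl card_Diff_l_coset) auto
    finally show ?thesis by (simp flip: sum_divide_distrib of_nat_sum add: divide_right_mono)
  qed
  ultimately show ?thesis
    using tendsto_sandwich[OF always_eventually always_eventually tendsto_const,
        of 0 "\<lambda>n. real (card (boundary W (F n))) / card (F n)"
           "\<lambda>n. \<Sum>w\<in>W. real (card (l_coset G w (F n) - F n)) / card (F n)"]
    by simp
qed

end

section \<open>Subadditive functions and quasi-tilings\<close>

text \<open>Modelled on A -> ln #(X, \<open>dist_on \<phi> A\<close>, \<epsilon>). Invariance
  concerns right translates because the orbit of x along A c is the orbit of c x along A.\<close>

locale invariant_subadditive = group +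
  fixes f :: "'a set \<Rightarrow> real"
  assumes f_empty: "f {} = 0"
    and f_nonneg: "\<And>A. A \<subseteq> carrier G \<Longrightarrow> finite A \<Longrightarrow> 0 \<le> f A"
    and f_Un: "\<And>A B. A \<subseteq> carrier G \<Longrightarrow> finite A \<Longrightarrow> B \<subseteq> carrier G \<Longrightarrow> finite B \<Longrightarrow>
      f (A \<union> B) \<le> f A + f B"
    and f_r_coset: "\<And>A c. A \<subseteq> carrier G \<Longrightarrow> finite A \<Longrightarrow> c \<in> carrier G \<Longrightarrow> f (A #> c) = f A"
begin

lemma f_set_mult_le:
  assumes "T \<subseteq> carrier G" "finite T" "finite C" "C \<subseteq> carrier G"
  shows "f (T <#> C) \<le> card C * f T"
  using assms(3,4)
proof (induction C rule: finite_induct)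
  case empty
  then show ?case by (simp add: set_mult_def f_empty)
next
  case (insert c C)
  have "T <#> insert c C = (T #> c) \<union> (T <#> C)" by (auto simp: set_mult_eq_UN_r_coset)
  then have "f (T <#> insert c C) \<le> f (T #> c) + f (T <#> C)"
    using insert assms by (simp add: f_Un finite_r_coset finite_set_mult r_coset_subset_G set_mult_closed)
  also have "\<dots> \<le> f T + card C * f T" using insert assms by (simp add: f_r_coset)
  finally show ?case using insert by (simp add: algebra_simps)
qed

lemma f_le_card:
  assumes "R \<subseteq> carrier G" "finite R"
  shows "f R \<le> f {\<one>} * card R"
proof -
  have "{\<one>} <#> R = R" using assms by (auto simp: set_mult_def subset_iff)
  then show ?thesis using f_set_mult_le[of "{\<one>}" R] assms by (simp add: mult.commute)
qed

text \<open>Each round covers, up to a boundary term, a fraction \<alpha> of what is still uncovered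
  by translates of one set T with f T \<le> l |T|. Small overlaps cost the factor 1 / (1 -
  \<alpha>). After k rounds the fraction (1 - \<alpha>) ^ k is left, where f is bounded through
  singletons. The tile added in the induction step is chosen after the W of the hypothesis, so that
  it is nearly invariant under W; it is laid first, and the hypothesis is applied to the
  remainder.\<close>

lemma quasi_tiling_bound:
  fixes \<alpha> l :: real
  assumes F: "folner_sequence G F" and \<alpha>: "0 < \<alpha>" "\<alpha> < 1"
    and l: "\<exists>\<^sub>F n in sequentially. f (F n) \<le> l * card (F n)"
  shows "0 < \<tau> \<Longrightarrow> \<exists>W (A::real). W \<subseteq> carrier G \<and> finite W \<and> \<one> \<in> W \<and> 0 \<le> A \<and>
    (\<forall>R. R \<subseteq> carrier G \<longrightarrow> finite R \<longrightarrow>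
       f R \<le> (l / (1 - \<alpha>) + f {\<one>} * (1 - \<alpha>) ^ k + \<tau>) * card R + A * card (boundary W R))"
proof (induction k arbitrary: \<tau>)
  have Fin: "\<And>n. finite (F n)" and Fcar: "\<And>n. F n \<subseteq> carrier G" and Fne: "\<And>n. F n \<noteq> {}"
    using F by (auto simp: folner_sequence_def)
  have Fpos: "card (F n) > 0" for n using Fin Fne by (simp add: card_gt_0_iff)
  have l0: "0 \<le> l"
  proof -
    obtain n where "f (F n) \<le> l * card (F n)" using l by (auto dest: frequently_ex)
    then have "0 \<le> l * card (F n)" using f_nonneg[OF Fcar Fin, of n] by linarith
    then show ?thesis using Fpos[of n] by (simp add: zero_le_mult_iff)
  qed
  {
    case 0
    have "f R \<le> (l / (1 - \<alpha>) + f {\<one>} + \<tau>) * card R" if "R \<subseteq> carrier G" "finite R" for R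
    proof -
      have "0 \<le> (l / (1 - \<alpha>) + \<tau>) * card R" using l0 \<alpha> 0 by simp
      then show ?thesis using f_le_card[OF that] by (simp add: algebra_simps)
    qed
    then show ?case by (intro exI[of _ "{\<one>}"] exI[of _ 0]) auto
  next
    case (Suc k)
    obtain W and A :: real where W: "W \<subseteq> carrier G" "finite W" "\<one> \<in> W" and A: "0 \<le> A"
      and IH: "\<And>R. R \<subseteq> carrier G \<Longrightarrow> finite R \<Longrightarrow>
       f R \<le> (l / (1 - \<alpha>) + f {\<one>} * (1 - \<alpha>) ^ k + \<tau> / 2) * card R + A * card (boundary W R)"
      using Suc.IH[of "\<tau>/2"] Suc.prems by auto
    \<comment> \<open>At most |R| / ((1 - \<alpha>) |T|) tiles are laid, so their edges contribute
      at most A \<zeta> |R| / (1 - \<alpha>) \<le> \<tau> / 2 |R|. The summand 1 in A + 1 covers A =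
      0.\<close>
    define \<zeta> where "\<zeta> = \<tau> * (1 - \<alpha>) / (2 * (A + 1))"
    have \<zeta>: "\<zeta> > 0" using Suc.prems A \<alpha> by (simp add: \<zeta>_def)
    let ?W' = "m_inv G ` W"
    have W': "?W' \<subseteq> carrier G" "finite ?W'" using W by auto
    have "(\<lambda>n. \<Sum>w\<in>?W'. real (card (l_coset G w (F n) - F n)) / card (F n)) \<longlonglongrightarrow> 0"
      by (rule tendsto_null_sum) (use folner_Diff_tendsto[OF F] W' in auto)
    then have "\<forall>\<^sub>F n in sequentially. (\<Sum>w\<in>?W'. real (card (l_coset G w (F n) - F n)) / card (F n)) < \<zeta>"
      using \<zeta> by (simp add: order_tendstoD)
    \<comment> \<open>Small values of f occur only frequently, near-invariance holds eventually; so
      some n has both.\<close>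
    with l obtain n where n: "f (F n) \<le> l * card (F n)"
      and inv: "(\<Sum>w\<in>?W'. real (card (l_coset G w (F n) - F n)) / card (F n)) < \<zeta>"
      using frequently_ex[OF frequently_eventually_conj[OF l]] by blast
    obtain t0 where t0: "t0 \<in> F n" "t0 \<in> carrier G" using Fne Fcar by blast
    \<comment> \<open>After this translation \<one> lies in T, so T c inside R forces c into R;
      hence \<open>inner_centers T R = R - boundary T R\<close>.\<close>
    define T where "T = F n #> inv t0"
    have T: "T \<subseteq> carrier G" "finite T" "\<one> \<in> T" and cT: "card T = card (F n)"
      using t0 Fcar[of n] Fin[of n]
      by (auto simp: T_def r_coset_subset_G finite_r_coset card_r_coset) (auto simp: r_coset_def intro!: bexI[of _ t0])
    have fT: "f T \<le> l * card T"
      using n cT f_r_coset[OF Fcar Fin, of "inv t0"] t0 by (simp add: T_def)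
    \<comment> \<open>The set estimated here consists of the points outside T that some element of W
      moves into T.\<close>
    have invT: "card ((?W' <#> T) - T) \<le> \<zeta> * card T"
    proof -
      have eq: "(?W' <#> T) - T = ((?W' <#> F n) - F n) #> inv t0"
      proof -
        have "?W' <#> T = (?W' <#> F n) #> inv t0"
          unfolding T_def by (rule setmult_rcos_assoc) (use W' Fcar t0 in auto)
        moreover have "(B #> inv t0) - (B' #> inv t0) = (B - B') #> inv t0"
          if B: "B \<subseteq> carrier G" "B' \<subseteq> carrier G" for B B'
        proof -
          have inj: "inj_on (\<lambda>b. b \<otimes> inv t0) (carrier G)" using t0 by (auto intro!: inj_onI)
          have im: "D #> inv t0 = (\<lambda>b. b \<otimes> inv t0) ` D" for D by (auto simp: r_coset_def)
          show ?thesis unfolding im using inj_on_image_set_diff[OF inj, of B B'] B by auto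
        qed
        ultimately show ?thesis unfolding T_def using W' Fcar by (simp add: set_mult_closed)
      qed
      have "(?W' <#> F n) - F n = (\<Union>w\<in>?W'. (l_coset G w (F n)) - F n)"
        by (auto simp: set_mult_def l_coset_def)
      then have "card ((?W' <#> F n) - F n) \<le> (\<Sum>w\<in>?W'. card (l_coset G w (F n) - F n))"
        using card_UN_le[OF W'(2)] by metis
      moreover have "(\<Sum>w\<in>?W'. real (card (l_coset G w (F n) - F n))) < \<zeta> * card (F n)"
        using inv Fpos[of n] by (simp flip: sum_divide_distrib add: divide_less_eq)
      ultimately have "card ((?W' <#> F n) - F n) \<le> \<zeta> * card (F n)"
        by (simp flip: of_nat_sum)
      then show ?thesis
        unfolding eq cT using card_r_coset[of "(?W' <#> F n) - F n" "inv t0"]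
          set_mult_closed[OF W'(1) Fcar] t0 by (simp add: Diff_subset[THEN order_trans])
    qed
    have main: "f R \<le> (l / (1 - \<alpha>) + f {\<one>} * (1 - \<alpha>) ^ Suc k + \<tau>) * card R
        + (f {\<one>} * \<alpha> + A) * card (boundary (W \<union> T) R)"
      if R: "R \<subseteq> carrier G" "finite R" for R
    proof -
      obtain C where C: "C \<subseteq> inner_centers T R" "finite C"
        and C1: "(1 - \<alpha>) * (real (card T) * real (card C)) \<le> card (T <#> C)"
        and C2: "\<alpha> * card (inner_centers T R) \<le> card (T <#> C)"
        using quasi_disjoint_centers[OF T(1,2) _ R(2) \<alpha>] T(3) by blast
      have Ccar: "C \<subseteq> carrier G" using C by (auto simp: inner_centers_def)
      let ?U = "T <#> C" let ?R = "R - ?U"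
      have UR: "?U \<subseteq> R" using C by (auto simp: inner_centers_def set_mult_eq_UN_r_coset)
      have fU: "finite ?U" using UR R finite_subset by blast
      have U_le: "real (card T) * card C \<le> card ?U / (1 - \<alpha>)"
        using C1 \<alpha> by (simp add: field_simps)
      have cR: "real (card R) = real (card ?R) + real (card ?U)"
        using UR R by (simp add: card_Diff_subset fU card_mono of_nat_diff)
      have "inner_centers T R = R - boundary T R"
        using T R by (force simp: inner_centers_def boundary_def r_coset_def)
      then have "real (card (inner_centers T R)) = card R - real (card (boundary T R))"
        using R by (simp add: card_Diff_subset boundary_def card_mono of_nat_diff)
      then have R'_le: "real (card ?R) \<le> (1 - \<alpha>) * card R + \<alpha> * card (boundary T R)"
      proof -
        have "\<alpha> * card (inner_centers T R) = \<alpha> * card R - \<alpha> * card (boundary T R)"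
          using \<open>real (card (inner_centers T R)) = _\<close> by (simp add: right_diff_distrib)
        then show ?thesis using C2 cR unfolding left_diff_distrib by linarith
      qed
      \<comment> \<open>Removing the tiles creates new boundary points only next to a tile T c,
        inside the translate by c of the set from \<open>invT\<close>.\<close>
      have "boundary W ?R \<subseteq> boundary W R \<union> (\<Union>c\<in>C. ((?W' <#> T) - T) #> c)"
      proof
        fix x assume x: "x \<in> boundary W ?R"
        then have xR: "x \<in> R" "x \<notin> ?U" by (auto simp: boundary_def)
        then have xc: "x \<in> carrier G" using R by auto
        from x obtain w where w: "w \<in> W" "w \<otimes> x \<notin> ?R" by (auto simp: boundary_def r_coset_def)
        show "x \<in> boundary W R \<union> (\<Union>c\<in>C. ((?W' <#> T) - T) #> c)"
        proof (cases "w \<otimes> x \<in> R")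
          case False
          then show ?thesis using w xR by (auto simp: boundary_def r_coset_def)
        next
          case True
          with w obtain t c where tc: "t \<in> T" "c \<in> C" "w \<otimes> x = t \<otimes> c" by (auto simp: set_mult_def)
          have car: "w \<in> carrier G" "t \<in> carrier G" "c \<in> carrier G"
            using w tc W T Ccar by auto
          have xeq: "x = (inv w \<otimes> t) \<otimes> c"
            using tc(3) car xc by (metis inv_closed l_inv l_one m_assoc)
          have "inv w \<otimes> t \<notin> T" using xR xeq tc by (auto simp: set_mult_def)
          moreover have "inv w \<otimes> t \<in> ?W' <#> T" using w tc by (auto simp: set_mult_def)
          ultimately show ?thesis using xeq tc by (auto simp: r_coset_def)
        qed
      qed
      then have "card (boundary W ?R) \<le> card (boundary W R \<union> (\<Union>c\<in>C. ((?W' <#> T) - T) #> c))"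
        using R C T W' by (intro card_mono) (auto simp: boundary_def finite_set_mult finite_r_coset)
      also have "\<dots> \<le> card (boundary W R) + (\<Sum>c\<in>C. card (((?W' <#> T) - T) #> c))"
        by (rule order_trans[OF card_Un_le add_left_mono[OF card_UN_le[OF C(2)]]])
      also have "(\<Sum>c\<in>C. card (((?W' <#> T) - T) #> c)) = card C * card ((?W' <#> T) - T)"
      proof -
        have "(?W' <#> T) - T \<subseteq> carrier G" using set_mult_closed[OF W'(1) T(1)] by blast
        then have "card (((?W' <#> T) - T) #> c) = card ((?W' <#> T) - T)" if "c \<in> C" for c
          using card_r_coset that Ccar by blast
        then show ?thesis by simp
      qed
      finally have "real (card (boundary W ?R)) \<le> card (boundary W R) + card C * card ((?W' <#> T) - T)"
        by (metis of_nat_add of_nat_mono of_nat_mult)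
      also have "\<dots> \<le> card (boundary W R) + card C * (\<zeta> * card T)"
        using invT by (simp add: mult_left_mono)
      also have "\<dots> \<le> card (boundary W R) + \<zeta> * (card R / (1 - \<alpha>))"
      proof -
        have "real (card T) * card C \<le> card R / (1 - \<alpha>)"
          using U_le card_mono[OF R(2) UR] \<alpha>
          by (smt (verit) divide_right_mono of_nat_mono)
        from mult_left_mono[OF this, of \<zeta>] show ?thesis using \<zeta> by (simp add: mult_ac)
      qed
      finally have bW: "real (card (boundary W ?R)) \<le> card (boundary W R) + \<zeta> * (card R / (1 - \<alpha>))" .
      have AZ: "A * (\<zeta> * (card R / (1 - \<alpha>))) \<le> \<tau> / 2 * card R"
      proof -
        have "\<zeta> / (1 - \<alpha>) = \<tau> / (2 * (A + 1))" using \<alpha> by (simp add: \<zeta>_def)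
        then have "A * (\<zeta> / (1 - \<alpha>)) = A * (\<tau> / (2 * (A + 1)))" by simp
        then have "A * \<zeta> / (1 - \<alpha>) = \<tau> / 2 * (A / (A + 1))" by simp
        also have "\<dots> \<le> \<tau> / 2 * 1" using A Suc.prems by (intro mult_left_mono) auto
        finally have "A * \<zeta> / (1 - \<alpha>) \<le> \<tau> / 2" by simp
        from mult_right_mono[OF this, of "card R"] show ?thesis by (simp add: mult_ac)
      qed
      have mono1: "card (boundary W R) \<le> card (boundary (W \<union> T) R)"
        and mono2: "card (boundary T R) \<le> card (boundary (W \<union> T) R)"
        using R by (auto intro!: card_mono simp: boundary_def r_coset_def)
      have b0: "0 \<le> f {\<one>}" by (rule f_nonneg) auto
      have "f R \<le> f ?R + f ?U"
      proof -
        have "?R \<union> ?U = R" using UR by blast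
        moreover have "f (?R \<union> ?U) \<le> f ?R + f ?U" using R fU UR by (intro f_Un) auto
        ultimately show ?thesis by simp
      qed
      also have "f ?U \<le> card C * (l * card T)"
        using f_set_mult_le[OF T(1,2) C(2) Ccar] fT by (meson mult_left_mono of_nat_0_le_iff order_trans)
      also have "\<dots> \<le> l * (card ?U / (1 - \<alpha>))"
        using mult_left_mono[OF U_le l0] by (simp add: algebra_simps)
      also have "f ?R \<le> (l / (1 - \<alpha>) + f {\<one>} * (1 - \<alpha>) ^ k + \<tau> / 2) * card ?R + A * card (boundary W ?R)"
        using R by (intro IH) auto
      finally have "f R \<le> l / (1 - \<alpha>) * (real (card ?R) + card ?U) + f {\<one>} * ((1 - \<alpha>) ^ k * card ?R)
          + \<tau> / 2 * card ?R + A * card (boundary W ?R)"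
        by (simp add: algebra_simps)
      moreover have "(1 - \<alpha>) ^ k * card ?R \<le> (1 - \<alpha>) ^ Suc k * card R + \<alpha> * card (boundary (W \<union> T) R)"
      proof -
        have "(1 - \<alpha>) ^ k * card ?R \<le> (1 - \<alpha>) ^ k * ((1 - \<alpha>) * card R + \<alpha> * card (boundary T R))"
          using R'_le \<alpha> by (intro mult_left_mono) auto
        also have "\<dots> \<le> (1 - \<alpha>) ^ Suc k * card R + 1 * (\<alpha> * card (boundary T R))"
          using \<alpha> by (simp add: distrib_left mult_left_le_one_le power_le_one)
        also have "1 * (\<alpha> * card (boundary T R)) \<le> \<alpha> * card (boundary (W \<union> T) R)"
          using mono2 \<alpha> by simp
        finally show ?thesis by simp
      qed
      then have "f {\<one>} * ((1 - \<alpha>) ^ k * card ?R)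
          \<le> f {\<one>} * ((1 - \<alpha>) ^ Suc k * card R + \<alpha> * card (boundary (W \<union> T) R))"
        using b0 by (rule mult_left_mono)
      moreover have "\<tau> / 2 * card ?R \<le> \<tau> / 2 * card R"
        using cR Suc.prems by (intro mult_left_mono) auto
      moreover have "A * card (boundary W ?R) \<le> A * card (boundary (W \<union> T) R) + \<tau> / 2 * card R"
      proof -
        have "A * card (boundary W ?R) \<le> A * (card (boundary W R) + \<zeta> * (card R / (1 - \<alpha>)))"
          using bW A by (rule mult_left_mono)
        also have "\<dots> \<le> A * card (boundary (W \<union> T) R) + \<tau> / 2 * card R"
          unfolding distrib_left using AZ mono1 A by (intro add_mono mult_left_mono) auto
        finally show ?thesis .
      qed
      ultimately have "f R \<le> l / (1 - \<alpha>) * card R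
          + f {\<one>} * ((1 - \<alpha>) ^ Suc k * card R + \<alpha> * card (boundary (W \<union> T) R))
          + \<tau> / 2 * card R + (A * card (boundary (W \<union> T) R) + \<tau> / 2 * card R)"
        unfolding cR[symmetric] by linarith
      also have "\<dots> = (l / (1 - \<alpha>) + f {\<one>} * (1 - \<alpha>) ^ Suc k + \<tau>) * card R
          + (f {\<one>} * \<alpha> + A) * card (boundary (W \<union> T) R)"
        by (simp add: algebra_simps)
      finally show ?thesis .
    qed
    have "0 \<le> f {\<one>} * \<alpha> + A" using A \<alpha> f_nonneg[of "{\<one>}"] by simp
    with main show ?case
      using W T by (intro exI[of _ "W \<union> T"] exI[of _ "f {\<one>} * \<alpha> + A"]) auto
  }
qed

text \<open>The tiles come from F and the sets to be tiled from F', so one Folner sequence controls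
  another. The gap l' - l is divided equally among four errors: overlap of tiles, uncovered
  remainder, \<tau>, and the boundary of F' n.\<close>

lemma eventually_le_of_frequently_le:
  fixes l e :: real
  assumes F: "folner_sequence G F" and F': "folner_sequence G F'"
    and l: "\<exists>\<^sub>F n in sequentially. f (F n) / card (F n) \<le> l" and "l < l'"
  shows "\<forall>\<^sub>F n in sequentially. f (F' n) / card (F' n) < l'"
proof -
  let ?e = "(l' - l) / 4"
  have e: "?e > 0" using assms by simp
  have pos: "card (F n) > 0" "card (F' n) > 0" for n
    using F F' by (auto simp: folner_sequence_def card_gt_0_iff)
  have l': "\<exists>\<^sub>F n in sequentially. f (F n) \<le> l * card (F n)"
    using l by (rule frequently_elim1) (use pos(1) in \<open>simp add: divide_le_eq\<close>)
  have "((\<lambda>\<alpha>. l / (1 - \<alpha>)) \<longlongrightarrow> l / (1 - 0)) (at_right 0)" by (intro tendsto_intros) auto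
  then have "\<forall>\<^sub>F \<alpha> in at_right 0. l / (1 - \<alpha>) < l + ?e"
    using e by (intro order_tendstoD(2)) auto
  moreover have "\<forall>\<^sub>F \<alpha> in at_right (0::real). 0 < \<alpha> \<and> \<alpha> < 1"
    by (auto simp: eventually_at_right_field intro!: exI[of _ 1])
  ultimately obtain \<alpha> where \<alpha>: "0 < \<alpha>" "\<alpha> < 1" and la: "l / (1 - \<alpha>) < l + ?e"
    using eventually_happens[OF eventually_conj, of _ "at_right (0::real)"] trivial_limit_at_right_real by blast
  have "(\<lambda>k. f {\<one>} * (1 - \<alpha>) ^ k) \<longlonglongrightarrow> f {\<one>} * 0"
    using \<alpha> by (intro tendsto_intros LIMSEQ_power_zero) auto
  then have "\<forall>\<^sub>F k in sequentially. f {\<one>} * (1 - \<alpha>) ^ k < ?e"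
    using e by (intro order_tendstoD(2)) auto
  then obtain k where k: "f {\<one>} * (1 - \<alpha>) ^ k < ?e" by (auto dest: eventually_happens)
  obtain W and A :: real where W: "W \<subseteq> carrier G" "finite W" and A: "0 \<le> A"
    and b: "\<And>R. R \<subseteq> carrier G \<Longrightarrow> finite R \<Longrightarrow>
       f R \<le> (l / (1 - \<alpha>) + f {\<one>} * (1 - \<alpha>) ^ k + ?e) * card R + A * card (boundary W R)"
    using quasi_tiling_bound[OF F \<alpha> l' e, of k] by auto
  have "(\<lambda>n. A * (real (card (boundary W (F' n))) / card (F' n))) \<longlonglongrightarrow> A * 0"
    by (intro tendsto_intros folner_boundary_tendsto[OF F' W])
  then have "\<forall>\<^sub>F n in sequentially. A * (real (card (boundary W (F' n))) / card (F' n)) < ?e"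
    using e by (intro order_tendstoD(2)) auto
  then show ?thesis
  proof eventually_elim
    case (elim n)
    have "f (F' n) / card (F' n)
        \<le> ((l / (1 - \<alpha>) + f {\<one>} * (1 - \<alpha>) ^ k + ?e) * card (F' n) + A * card (boundary W (F' n))) / card (F' n)"
      using F' b[of "F' n"] by (intro divide_right_mono) (auto simp: folner_sequence_def)
    also have "\<dots> = (l / (1 - \<alpha>) + f {\<one>} * (1 - \<alpha>) ^ k + ?e) + A * (real (card (boundary W (F' n))) / card (F' n))"
      using pos(2)[of n] by (simp add: add_divide_distrib)
    also have "\<dots> < l'"
    proof -
      have "x + y + ?e + z < l'" if "x < l + ?e" "y < ?e" "z < ?e" for x y z
        using that by (simp add: field_simps)
      then show ?thesis using la k elim by blast
    qed
    finally show ?case .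
  qed
qed

text \<open>A bound that holds frequently along one Folner sequence holds eventually along any
  other, up to an arbitrarily small loss. With L a limit along a subsequence of F, this gives the
  upper bound from F to F' and the lower bound from F' back to F.\<close>

theorem ornstein_weiss:
  assumes F: "folner_sequence G F"
  obtains L where "\<And>F'. folner_sequence G F' \<Longrightarrow> (\<lambda>n. f (F' n) / card (F' n)) \<longlonglongrightarrow> L"
proof -
  let ?x = "\<lambda>n. f (F n) / card (F n)"
  have pos: "card (F n) > 0" for n
    using F by (auto simp: folner_sequence_def card_gt_0_iff)
  have x: "0 \<le> ?x n" "?x n \<le> f {\<one>}" for n
    using F f_nonneg[of "F n"] f_le_card[of "F n"] pos[of n]
    by (auto simp: folner_sequence_def divide_le_eq)
  then have "bounded (range ?x)" by (intro boundedI[of _ "f {\<one>}"]) (auto simp: abs_of_nonneg simp del: abs_divide)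
  then obtain L r where r: "strict_mono (r :: nat \<Rightarrow> nat)" "(?x \<circ> r) \<longlonglongrightarrow> L"
    using bounded_imp_convergent_subsequence by blast
  have freq: "\<exists>\<^sub>F n in sequentially. P (?x n)" if "\<forall>\<^sub>F n in sequentially. P ((?x \<circ> r) n)" for P
  proof -
    have "\<exists>\<^sub>F n in filtermap r sequentially. P (?x n)"
      using that by (simp add: frequently_filtermap eventually_frequently)
    moreover have "filtermap r sequentially \<le> sequentially"
      using filterlim_subseq[OF r(1)] by (simp add: filterlim_def)
    ultimately show ?thesis by (auto simp: frequently_def dest: filter_leD)
  qed
  have up: "\<forall>\<^sub>F n in sequentially. f (F' n) / card (F' n) < l'" if "folner_sequence G F'" "L < l'" for F' l'
  proof -
    have "\<forall>\<^sub>F n in sequentially. (?x \<circ> r) n < (L + l') / 2"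
      by (rule order_tendstoD(2)[OF r(2)]) (use that in simp)
    then have "\<exists>\<^sub>F n in sequentially. ?x n < (L + l') / 2" by (rule freq)
    then have "\<exists>\<^sub>F n in sequentially. ?x n \<le> (L + l') / 2" by (rule frequently_elim1) simp
    then show ?thesis by (rule eventually_le_of_frequently_le[OF F that(1)]) (use that(2) in simp)
  qed
  have lo: "\<forall>\<^sub>F n in sequentially. l' < f (F' n) / card (F' n)" if F': "folner_sequence G F'" "l' < L" for F' l'
  proof (rule ccontr)
    assume "\<not> ?thesis"
    then have "\<exists>\<^sub>F n in sequentially. f (F' n) / card (F' n) \<le> l'"
      by (simp add: frequently_def not_le)
    then have "\<forall>\<^sub>F n in sequentially. ?x n < (l' + L) / 2"
      by (rule eventually_le_of_frequently_le[OF F'(1) F]) (use F'(2) in simp)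
    then have "\<forall>\<^sub>F n in sequentially. (?x \<circ> r) n < (l' + L) / 2"
      using eventually_subseq[OF r(1)] by (simp add: comp_def)
    moreover have "\<forall>\<^sub>F n in sequentially. (l' + L) / 2 < (?x \<circ> r) n"
      by (rule order_tendstoD(1)[OF r(2)]) (use F'(2) in simp)
    ultimately have "\<forall>\<^sub>F n in sequentially. False" by eventually_elim simp
    then show False by simp
  qed
  have "(\<lambda>n. f (F' n) / card (F' n)) \<longlonglongrightarrow> L" if "folner_sequence G F'" for F'
    using up[OF that] lo[OF that] by (intro order_tendstoI) auto
  then show thesis by (rule that)
qed

end

section \<open>Covering numbers\<close>

text \<open>A strict bound on a supremum turns into a uniform bound s strictly below \<epsilon>, the
  form used from here on. The global bound B ensures that the real supremum is that of a bounded
  set.\<close>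

lemma diam_less_iff:
  assumes "\<epsilon> > 0" and B: "\<And>x y. \<rho> x y \<le> B"
  shows "diam \<rho> U < \<epsilon> \<longleftrightarrow> (\<exists>s<\<epsilon>. \<forall>x\<in>U. \<forall>y\<in>U. \<rho> x y \<le> s)"
proof (cases "U = {}")
  case True
  then show ?thesis using assms by (auto simp: diam_def)
next
  case False
  have bdd: "bdd_above ((\<lambda>(x, y). \<rho> x y) ` (U \<times> U))" by (rule bdd_aboveI2[of _ _ B]) (auto simp: B)
  show ?thesis
  proof
    assume *: "diam \<rho> U < \<epsilon>"
    have "\<rho> x y \<le> diam \<rho> U" if "x \<in> U" "y \<in> U" for x y
      using cSUP_upper[OF _ bdd, of "(x, y)"] that False by (simp add: diam_def)
    with * show "\<exists>s<\<epsilon>. \<forall>x\<in>U. \<forall>y\<in>U. \<rho> x y \<le> s" by blast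
  next
    assume "\<exists>s<\<epsilon>. \<forall>x\<in>U. \<forall>y\<in>U. \<rho> x y \<le> s"
    then obtain s where s: "s < \<epsilon>" "\<And>x y. x \<in> U \<Longrightarrow> y \<in> U \<Longrightarrow> \<rho> x y \<le> s" by blast
    have "diam \<rho> U \<le> s" using False s(2) by (auto simp: diam_def intro!: cSUP_least)
    with s(1) show "diam \<rho> U < \<epsilon>" by simp
  qed
qed

lemma cover_num_le:
  assumes "finite \<U>" "\<And>U. U \<in> \<U> \<Longrightarrow> open U" "\<And>U. U \<in> \<U> \<Longrightarrow> diam \<rho> U < \<epsilon>" "\<Union>\<U> = UNIV"
  shows "cover_num \<rho> \<epsilon> \<le> card \<U>"
  unfolding cover_num_def using assms by (intro wellorder_Inf_le1) blast

text \<open>The given cover makes the set of cardinalities nonempty, and a nonempty set of naturals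
  contains its \<open>Inf\<close>.\<close>

lemma cover_num_attained:
  assumes "finite \<U>" "\<And>U. U \<in> \<U> \<Longrightarrow> open U" "\<And>U. U \<in> \<U> \<Longrightarrow> diam \<rho> U < \<epsilon>" "\<Union>\<U> = UNIV"
  obtains \<V> where "finite \<V>" "\<And>U. U \<in> \<V> \<Longrightarrow> open U" "\<And>U. U \<in> \<V> \<Longrightarrow> diam \<rho> U < \<epsilon>"
    "\<Union>\<V> = UNIV" "card \<V> = cover_num \<rho> \<epsilon>"
proof -
  let ?S = "{card \<U> | \<U>. finite \<U> \<and> (\<forall>U\<in>\<U>. open U \<and> diam \<rho> U < \<epsilon>) \<and> \<Union>\<U> = UNIV}"
  have "?S \<noteq> {}" using assms by blast
  then have "cover_num \<rho> \<epsilon> \<in> ?S" unfolding cover_num_def by (rule Inf_nat_def1)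
  then obtain \<V> where "finite \<V>" "\<forall>U\<in>\<V>. open U \<and> diam \<rho> U < \<epsilon>" "\<Union>\<V> = UNIV" "card \<V> = cover_num \<rho> \<epsilon>"
    by (smt (verit) mem_Collect_eq)
  then show thesis by (intro that) auto
qed

locale compact_system = group G for G (structure) +
  fixes \<phi> :: "'a \<Rightarrow> 'x::metric_space \<Rightarrow> 'x"
  assumes sys: "G_system G \<phi>"
begin

lemma compact_UNIV: "compact (UNIV :: 'x set)"
  using sys by (simp add: G_system_def)

lemma act_one: "\<phi> \<one> x = x"
proof -
  interpret group_action G UNIV \<phi> using sys by (simp add: G_system_def)
  show ?thesis using id_eq_one by (simp add: restrict_def fun_eq_iff)
qed

lemma act_mult: "g \<in> carrier G \<Longrightarrow> h \<in> carrier G \<Longrightarrow> \<phi> (g \<otimes> h) x = \<phi> g (\<phi> h x)"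
proof -
  interpret group_action G UNIV \<phi> using sys by (simp add: G_system_def)
  show "g \<in> carrier G \<Longrightarrow> h \<in> carrier G \<Longrightarrow> \<phi> (g \<otimes> h) x = \<phi> g (\<phi> h x)" by (rule composition_rule) auto
qed

lemma act_continuous: "g \<in> carrier G \<Longrightarrow> continuous_on UNIV (\<phi> g)"
  using sys by (auto simp: G_system_def homeomorphism_def)

lemma act_measurable: "g \<in> carrier G \<Longrightarrow> \<phi> g \<in> borel_measurable borel"
  by (intro borel_measurable_continuous_onI act_continuous)

lemma act_open_vimage: "g \<in> carrier G \<Longrightarrow> open U \<Longrightarrow> open (\<phi> g -` U)"
  using act_continuous continuous_on_open_vimage[of UNIV "\<phi> g"] by auto

lemma act_closed_vimage: "g \<in> carrier G \<Longrightarrow> closed C \<Longrightarrow> closed (\<phi> g -` C)"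
  using act_continuous continuous_on_closed_vimage[of UNIV "\<phi> g"] by auto

lemma dist_bounded: obtains B where "B > 0" "\<And>x y :: 'x. dist x y \<le> B"
proof -
  have "bounded (UNIV :: 'x set)" using compact_UNIV by (rule compact_imp_bounded)
  then obtain e where e: "\<And>x y :: 'x. dist x y \<le> e" using bounded_two_points by (metis UNIV_I)
  show thesis using that[of "max e 1"] e by (simp add: le_max_iff_disj)
qed

lemma dist_on_le_iff:
  "finite F \<Longrightarrow> F \<noteq> {} \<Longrightarrow> dist_on \<phi> F x y \<le> s \<longleftrightarrow> (\<forall>g\<in>F. dist (\<phi> g x) (\<phi> g y) \<le> s)"
  by (simp add: dist_on_def)

lemma diam_dist_on_less_iff:
  assumes "finite F" "F \<noteq> {}" "\<epsilon> > 0"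
  shows "diam (dist_on \<phi> F) U < \<epsilon> \<longleftrightarrow>
    (\<exists>s<\<epsilon>. \<forall>x\<in>U. \<forall>y\<in>U. \<forall>g\<in>F. dist (\<phi> g x) (\<phi> g y) \<le> s)"
proof -
  obtain B where "B > 0" "\<And>x y :: 'x. dist x y \<le> B" using dist_bounded by blast
  then have "\<And>x y. dist_on \<phi> F x y \<le> B" using assms by (simp add: dist_on_le_iff)
  from diam_less_iff[OF assms(3) this] show ?thesis using assms by (simp add: dist_on_le_iff)
qed

lemma dist_on_cover:
  assumes F: "F \<subseteq> carrier G" "finite F" "F \<noteq> {}" and \<epsilon>: "\<epsilon> > 0"
  obtains \<U> where "finite \<U>" "\<And>U. U \<in> \<U> \<Longrightarrow> open U" "\<And>U. U \<in> \<U> \<Longrightarrow> diam (dist_on \<phi> F) U < \<epsilon>"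
    "\<Union>\<U> = UNIV" "card \<U> = cover_num (dist_on \<phi> F) \<epsilon>"
proof -
  \<comment> \<open>Radius \<epsilon> / 3 bounds the diameters by 2 \<epsilon> / 3, which is
    strictly below \<epsilon>; radius \<epsilon> / 2 would leave no margin for the supremum.\<close>
  define B where "B x = (\<Inter>g\<in>F. \<phi> g -` ball (\<phi> g x) (\<epsilon> / 3))" for x
  have op: "open (B x)" for x
    unfolding B_def using F by (intro open_INT ballI) (auto intro: act_open_vimage)
  have xB: "x \<in> B x" for x using \<epsilon> by (simp add: B_def)
  obtain X where X: "finite X" "UNIV \<subseteq> (\<Union>x\<in>X. B x)"
  proof (rule compactE_image[OF compact_UNIV, of UNIV B])
    show "UNIV \<subseteq> \<Union> (range B)" using xB by blast
  qed (use op that in auto)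
  have "diam (dist_on \<phi> F) (B x) < \<epsilon>" for x
  proof -
    have "dist (\<phi> g y) (\<phi> g z) \<le> 2 * \<epsilon> / 3" if "y \<in> B x" "z \<in> B x" "g \<in> F" for y z g
    proof -
      have "dist (\<phi> g x) (\<phi> g y) < \<epsilon> / 3" "dist (\<phi> g x) (\<phi> g z) < \<epsilon> / 3"
        using that by (auto simp: B_def)
      then show ?thesis using dist_triangle3[of "\<phi> g y" "\<phi> g z" "\<phi> g x"] by simp
    qed
    then show ?thesis unfolding diam_dist_on_less_iff[OF F(2,3) \<epsilon>] using \<epsilon>
      by (intro exI[of _ "2 * \<epsilon> / 3"]) auto
  qed
  note small = this
  show thesis
  proof (rule cover_num_attained[of "B ` X" "dist_on \<phi> F" \<epsilon>])
    fix \<V> assume "finite \<V>" "\<And>U. U \<in> \<V> \<Longrightarrow> open U" "\<And>U. U \<in> \<V> \<Longrightarrow> diam (dist_on \<phi> F) U < \<epsilon>"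
      "\<Union>\<V> = UNIV" "card \<V> = cover_num (dist_on \<phi> F) \<epsilon>"
    then show thesis by (rule that)
  qed (use X op small in auto)
qed

lemma cover_num_ge_1:
  assumes F: "F \<subseteq> carrier G" "finite F" "F \<noteq> {}" and \<epsilon>: "\<epsilon> > 0"
  shows "cover_num (dist_on \<phi> F) \<epsilon> \<ge> 1"
proof -
  obtain \<U> where "finite \<U>" "\<Union>\<U> = (UNIV :: 'x set)" "card \<U> = cover_num (dist_on \<phi> F) \<epsilon>"
    using dist_on_cover[OF assms] by metis
  then show ?thesis by (cases "\<U> = {}") (auto simp: card_gt_0_iff Suc_le_eq simp flip: \<open>card \<U> = _\<close>)
qed

lemma cover_num_Un_le:
  assumes A: "A \<subseteq> carrier G" "finite A" "A \<noteq> {}" and B: "B \<subseteq> carrier G" "finite B" "B \<noteq> {}"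
    and \<epsilon>: "\<epsilon> > 0"
  shows "cover_num (dist_on \<phi> (A \<union> B)) \<epsilon> \<le> cover_num (dist_on \<phi> A) \<epsilon> * cover_num (dist_on \<phi> B) \<epsilon>"
proof -
  obtain \<U> where U: "finite \<U>" "\<And>U. U \<in> \<U> \<Longrightarrow> open U" "\<And>U. U \<in> \<U> \<Longrightarrow> diam (dist_on \<phi> A) U < \<epsilon>"
    "\<Union>\<U> = UNIV" "card \<U> = cover_num (dist_on \<phi> A) \<epsilon>" using dist_on_cover[OF A \<epsilon>] by blast
  obtain \<V> where V: "finite \<V>" "\<And>U. U \<in> \<V> \<Longrightarrow> open U" "\<And>U. U \<in> \<V> \<Longrightarrow> diam (dist_on \<phi> B) U < \<epsilon>"
    "\<Union>\<V> = UNIV" "card \<V> = cover_num (dist_on \<phi> B) \<epsilon>" using dist_on_cover[OF B \<epsilon>] by blast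
  let ?W = "(\<lambda>(U, V). U \<inter> V) ` (\<U> \<times> \<V>)"
  have "cover_num (dist_on \<phi> (A \<union> B)) \<epsilon> \<le> card ?W"
  proof (rule cover_num_le)
    fix W assume "W \<in> ?W"
    then obtain U V where UV: "U \<in> \<U>" "V \<in> \<V>" "W = U \<inter> V" by auto
    then show "open W" using U V by auto
    obtain s where s: "s < \<epsilon>" "\<And>x y g. x \<in> U \<Longrightarrow> y \<in> U \<Longrightarrow> g \<in> A \<Longrightarrow> dist (\<phi> g x) (\<phi> g y) \<le> s"
      using U(3)[OF UV(1)] unfolding diam_dist_on_less_iff[OF A(2,3) \<epsilon>] by blast
    obtain t where t: "t < \<epsilon>" "\<And>x y g. x \<in> V \<Longrightarrow> y \<in> V \<Longrightarrow> g \<in> B \<Longrightarrow> dist (\<phi> g x) (\<phi> g y) \<le> t"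
      using V(3)[OF UV(2)] unfolding diam_dist_on_less_iff[OF B(2,3) \<epsilon>] by blast
    have "dist (\<phi> g x) (\<phi> g y) \<le> max s t" if "x \<in> W" "y \<in> W" "g \<in> A \<union> B" for x y g
      using that s(2)[of x y g] t(2)[of x y g] UV(3) by auto
    then show "diam (dist_on \<phi> (A \<union> B)) W < \<epsilon>"
      using A B \<epsilon> s(1) t(1) by (subst diam_dist_on_less_iff) (auto intro!: exI[of _ "max s t"])
  next
    have "x \<in> \<Union>?W" for x
    proof -
      have "x \<in> \<Union>\<U>" "x \<in> \<Union>\<V>" using U(4) V(4) by auto
      then show ?thesis by auto
    qed
    then show "\<Union>?W = UNIV" by blast
  qed (use U V in auto)
  also have "\<dots> \<le> card (\<U> \<times> \<V>)" using U V by (intro card_image_le) auto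
  finally show ?thesis using U V by (simp add: card_cartesian_product)
qed

text \<open>Since the action is on the left, the distance of x and y along A c is that of c x and c
  y along A, so preimages under c turn a cover for A into one for A c.\<close>

lemma cover_num_r_coset_le:
  assumes A: "A \<subseteq> carrier G" "finite A" "A \<noteq> {}" and c: "c \<in> carrier G" and \<epsilon>: "\<epsilon> > 0"
  shows "cover_num (dist_on \<phi> (A #> c)) \<epsilon> \<le> cover_num (dist_on \<phi> A) \<epsilon>"
proof -
  obtain \<U> where U: "finite \<U>" "\<And>U. U \<in> \<U> \<Longrightarrow> open U" "\<And>U. U \<in> \<U> \<Longrightarrow> diam (dist_on \<phi> A) U < \<epsilon>"
    "\<Union>\<U> = UNIV" "card \<U> = cover_num (dist_on \<phi> A) \<epsilon>" using dist_on_cover[OF A \<epsilon>] by blast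
  have Ac: "A #> c \<subseteq> carrier G" "finite (A #> c)" "A #> c \<noteq> {}"
    using A c by (auto simp: r_coset_def subset_iff)
  have "cover_num (dist_on \<phi> (A #> c)) \<epsilon> \<le> card ((\<lambda>U. \<phi> c -` U) ` \<U>)"
  proof (rule cover_num_le)
    fix W assume "W \<in> (\<lambda>U. \<phi> c -` U) ` \<U>"
    then obtain V where V: "V \<in> \<U>" "W = \<phi> c -` V" by auto
    then show "open W" using U(2) act_open_vimage[OF c] by auto
    obtain s where s: "s < \<epsilon>" "\<And>x y g. x \<in> V \<Longrightarrow> y \<in> V \<Longrightarrow> g \<in> A \<Longrightarrow> dist (\<phi> g x) (\<phi> g y) \<le> s"
      using U(3)[OF V(1)] unfolding diam_dist_on_less_iff[OF A(2,3) \<epsilon>] by blast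
    have "dist (\<phi> g x) (\<phi> g y) \<le> s" if "x \<in> W" "y \<in> W" "g \<in> A #> c" for x y g
      using that V(2) s(2) A c act_mult by (force simp: r_coset_def subset_iff)
    then show "diam (dist_on \<phi> (A #> c)) W < \<epsilon>"
      using Ac \<epsilon> s(1) by (subst diam_dist_on_less_iff) auto
  next
    show "\<Union>((\<lambda>U. \<phi> c -` U) ` \<U>) = UNIV" using U(4) by auto
  qed (use U in auto)
  also have "\<dots> \<le> card \<U>" using U by (intro card_image_le)
  finally show ?thesis using U by simp
qed

lemma cover_num_r_coset:
  assumes A: "A \<subseteq> carrier G" "finite A" "A \<noteq> {}" and c: "c \<in> carrier G" and \<epsilon>: "\<epsilon> > 0"
  shows "cover_num (dist_on \<phi> (A #> c)) \<epsilon> = cover_num (dist_on \<phi> A) \<epsilon>"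
proof (rule antisym)
  have Ac: "A #> c \<subseteq> carrier G" "finite (A #> c)" "A #> c \<noteq> {}"
    using A c by (auto simp: r_coset_def subset_iff)
  have "(A #> c) #> inv c = A" using A c by (simp add: coset_mult_assoc)
  then show "cover_num (dist_on \<phi> A) \<epsilon> \<le> cover_num (dist_on \<phi> (A #> c)) \<epsilon>"
    using cover_num_r_coset_le[OF Ac inv_closed[OF c] \<epsilon>] by simp
qed (rule cover_num_r_coset_le[OF assms])

theorem cover_entropy_tendsto:
  assumes F: "folner_sequence G F" and \<epsilon>: "\<epsilon> > 0"
  shows "(\<lambda>n. ln (real (cover_num (dist_on \<phi> (F n)) \<epsilon>)) / card (F n)) \<longlonglongrightarrow> cover_entropy G \<phi> \<epsilon>"
proof -
  \<comment> \<open>The empty set is treated separately: \<open>dist_on \<phi> {}\<close> is a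
    maximum over no elements, whereas subadditive functions start at 0.\<close>
  define f where "f A = (if A = {} then 0 else ln (real (cover_num (dist_on \<phi> A) \<epsilon>)))" for A
  interpret invariant_subadditive G f
  proof unfold_locales
    show "f {} = 0" by (simp add: f_def)
    show "0 \<le> f A" if "A \<subseteq> carrier G" "finite A" for A
      using cover_num_ge_1[OF that _ \<epsilon>] by (auto simp: f_def)
    show "f (A \<union> B) \<le> f A + f B" if A: "A \<subseteq> carrier G" "finite A" and B: "B \<subseteq> carrier G" "finite B" for A B
    proof (cases "A = {} \<or> B = {}")
      case True
      then show ?thesis by (auto simp: f_def)
    next
      case False
      then have ge: "cover_num (dist_on \<phi> A) \<epsilon> \<ge> 1" "cover_num (dist_on \<phi> B) \<epsilon> \<ge> 1" "cover_num (dist_on \<phi> (A \<union> B)) \<epsilon> \<ge> 1"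
        using cover_num_ge_1 A B \<epsilon> by auto
      have "real (cover_num (dist_on \<phi> (A \<union> B)) \<epsilon>) \<le> real (cover_num (dist_on \<phi> A) \<epsilon>) * real (cover_num (dist_on \<phi> B) \<epsilon>)"
        using cover_num_Un_le A B False \<epsilon> by (simp flip: of_nat_mult)
      then have "ln (real (cover_num (dist_on \<phi> (A \<union> B)) \<epsilon>)) \<le> ln (real (cover_num (dist_on \<phi> A) \<epsilon>) * real (cover_num (dist_on \<phi> B) \<epsilon>))"
        using ge by (intro ln_mono) auto
      also have "\<dots> = ln (real (cover_num (dist_on \<phi> A) \<epsilon>)) + ln (real (cover_num (dist_on \<phi> B) \<epsilon>))"
        using ge by (intro ln_mult_pos) auto
      finally show ?thesis using False by (simp add: f_def)
    qed
    show "f (A #> c) = f A" if "A \<subseteq> carrier G" "finite A" "c \<in> carrier G" for A c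
    proof (cases "A = {}")
      case False
      then have "A #> c \<noteq> {}" by (auto simp: r_coset_def)
      then show ?thesis using False cover_num_r_coset[OF that(1,2) False that(3) \<epsilon>] by (simp add: f_def)
    qed (simp add: r_coset_def)
  qed
  let ?P = "\<lambda>L. \<forall>F. folner_sequence G F \<longrightarrow>
    (\<lambda>n. ln (real (cover_num (dist_on \<phi> (F n)) \<epsilon>)) / real (card (F n))) \<longlonglongrightarrow> L"
  have ne: "F' n \<noteq> {}" if "folner_sequence G F'" for F' n using that by (auto simp: folner_sequence_def)
  obtain L where L: "?P L"
  proof -
    obtain L where "\<And>F'. folner_sequence G F' \<Longrightarrow> (\<lambda>n. f (F' n) / card (F' n)) \<longlonglongrightarrow> L"
      using ornstein_weiss[OF F] by blast
    then have "?P L" using ne by (simp add: f_def)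
    then show thesis by (rule that)
  qed
  \<comment> \<open>Uniqueness of the limit relies on the existence of at least one Folner sequence,
    here F.\<close>
  moreover have "L' = L" if "?P L'" for L' using that L F LIMSEQ_unique by blast
  ultimately have "?P (cover_entropy G \<phi> \<epsilon>)" unfolding cover_entropy_def by (rule theI)
  with F show ?thesis by blast
qed

end

section \<open>The upper bound\<close>

definition entropy_term :: "real \<Rightarrow> real" where
  "entropy_term x = - x * ln x"

lemma entropy_term_nonneg: "0 \<le> x \<Longrightarrow> x \<le> 1 \<Longrightarrow> 0 \<le> entropy_term x"
  by (cases "x = 0") (auto simp: entropy_term_def mult_nonneg_nonpos)

lemma entropy_term_0 [simp]: "entropy_term 0 = 0"
  by (simp add: entropy_term_def)

text \<open>Gibbs' inequality against the mass 1 / N in each point. Only indices of positive mass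
  are counted, because a partition may have many cells that a finite-valued variable never
  meets.\<close>

lemma sum_entropy_term_le_ln:
  fixes p :: "'a \<Rightarrow> real"
  assumes A: "finite A" and p: "\<And>a. a \<in> A \<Longrightarrow> 0 \<le> p a" "sum p A = 1"
    and N: "card {a\<in>A. p a > 0} \<le> N"
  shows "(\<Sum>a\<in>A. entropy_term (p a)) \<le> ln N"
proof -
  let ?A = "{a\<in>A. p a > 0}"
  have fA: "finite ?A" using A by simp
  have p': "sum p ?A = 1"
    using p A by (subst sum.mono_neutral_left[of A]) (auto simp: not_less intro: antisym)
  have "?A \<noteq> {}" using p' by fastforce
  then have N0: "N > 0" using N fA by (metis card_0_eq gr0I le_zero_eq)
  have "(\<Sum>a\<in>A. entropy_term (p a)) = (\<Sum>a\<in>?A. entropy_term (p a))"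
    using A
  proof (intro sum.mono_neutral_right)
    show "\<forall>a\<in>A - ?A. entropy_term (p a) = 0" 
    proof
      fix a assume "a \<in> A - ?A"
      then have "p a = 0" using p(1)[of a] by auto
      then show "entropy_term (p a) = 0" by simp
    qed
  qed auto
  also have "\<dots> \<le> (\<Sum>a\<in>?A. 1 / N - p a + p a * ln N)"
  proof (rule sum_mono)
    fix a assume a: "a \<in> ?A"
    have "ln (1 / (p a * N)) \<le> 1 / (p a * N) - 1"
      using a N0 by (intro ln_le_minus_one) auto
    then have "p a * ln (1 / (p a * N)) \<le> p a * (1 / (p a * N) - 1)"
      using a by (intro mult_left_mono) auto
    also have "ln (1 / (p a * N)) = - ln (p a) - ln N"
      using a N0 by (simp add: ln_div ln_mult)
    finally show "entropy_term (p a) \<le> 1 / N - p a + p a * ln N"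
      using a N0 by (simp add: entropy_term_def field_simps)
  qed
  also have "\<dots> = card ?A / N - 1 + ln N"
    using p' by (simp add: sum.distrib sum_subtractf flip: sum_distrib_right)
  also have "\<dots> \<le> ln N" using N N0 by (simp add: divide_le_eq)
  finally show ?thesis .
qed

lemma (in prob_space) sum_prob_partition:
  assumes Y: "Y \<in> measurable M B" and Q: "\<Q> \<in> finite_partitions B" and E: "E \<in> events"
  shows "(\<Sum>Q\<in>\<Q>. prob {\<omega>\<in>space M. \<omega> \<in> E \<and> Y \<omega> \<in> Q}) = prob E"
proof -
  have Q': "finite \<Q>" "\<Q> \<subseteq> sets B" "\<Union>\<Q> = space B" "disjoint \<Q>"
    using Q by (auto simp: finite_partitions_def partition_on_def)
  have ev: "{\<omega>\<in>space M. \<omega> \<in> E \<and> Y \<omega> \<in> Q} \<in> events" if "Q \<in> \<Q>" for Q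
  proof -
    have "{\<omega>\<in>space M. \<omega> \<in> E \<and> Y \<omega> \<in> Q} = E \<inter> (Y -` Q \<inter> space M)" using sets.sets_into_space[OF E] by auto
    then show ?thesis using E measurable_sets[OF Y] that Q'(2) by auto
  qed
  have "(\<Sum>Q\<in>\<Q>. prob {\<omega>\<in>space M. \<omega> \<in> E \<and> Y \<omega> \<in> Q}) = prob (\<Union>Q\<in>\<Q>. {\<omega>\<in>space M. \<omega> \<in> E \<and> Y \<omega> \<in> Q})"
  proof (rule finite_measure_finite_Union[symmetric])
    show "disjoint_family_on (\<lambda>Q. {\<omega>\<in>space M. \<omega> \<in> E \<and> Y \<omega> \<in> Q}) \<Q>"
      unfolding disjoint_family_on_def
    proof (intro ballI impI)
      fix Q Q' assume "Q \<in> \<Q>" "Q' \<in> \<Q>" "Q \<noteq> Q'"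
      then have "Q \<inter> Q' = {}" using Q'(4) by (auto simp: disjoint_def)
      then show "{\<omega>\<in>space M. \<omega> \<in> E \<and> Y \<omega> \<in> Q} \<inter> {\<omega>\<in>space M. \<omega> \<in> E \<and> Y \<omega> \<in> Q'} = {}" by auto
    qed
  qed (use Q'(1) ev in auto)
  also have "(\<Union>Q\<in>\<Q>. {\<omega>\<in>space M. \<omega> \<in> E \<and> Y \<omega> \<in> Q}) = E"
  proof -
    have "\<exists>Q\<in>\<Q>. Y \<omega> \<in> Q" if "\<omega> \<in> E" for \<omega>
    proof -
      have "Y \<omega> \<in> \<Union>\<Q>" using measurable_space[OF Y] sets.sets_into_space[OF E] that Q'(3) by auto
      then show ?thesis by blast
    qed
    then show ?thesis using sets.sets_into_space[OF E] by auto
  qed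
  finally show ?thesis .
qed

lemma (in prob_space) joint_probs:
  assumes X: "X \<in> measurable M A" and Y: "Y \<in> measurable M B"
    and P: "\<P> \<in> finite_partitions A" and Q: "\<Q> \<in> finite_partitions B"
    and p_def: "p = (\<lambda>P. prob {\<omega>\<in>space M. X \<omega> \<in> P})"
    and q_def: "q = (\<lambda>Q. prob {\<omega>\<in>space M. Y \<omega> \<in> Q})"
    and r_def: "r = (\<lambda>P Q. prob {\<omega>\<in>space M. X \<omega> \<in> P \<and> Y \<omega> \<in> Q})"
  shows "P \<in> \<P> \<Longrightarrow> (\<Sum>Q\<in>\<Q>. r P Q) = p P"
    and "Q \<in> \<Q> \<Longrightarrow> (\<Sum>P\<in>\<P>. r P Q) = q Q"
    and "(\<Sum>P\<in>\<P>. p P) = 1" and "(\<Sum>Q\<in>\<Q>. q Q) = 1"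
    and "P \<in> \<P> \<Longrightarrow> Q \<in> \<Q> \<Longrightarrow> r P Q \<le> p P"
    and "P \<in> \<P> \<Longrightarrow> Q \<in> \<Q> \<Longrightarrow> r P Q \<le> q Q"
proof -
  have Xe: "{\<omega>\<in>space M. X \<omega> \<in> P} \<in> events" if "P \<in> \<P>" for P
    using P that measurable_sets[OF X, of P] by (auto simp: finite_partitions_def vimage_def Int_def conj_commute)
  have Ye: "{\<omega>\<in>space M. Y \<omega> \<in> Q} \<in> events" if "Q \<in> \<Q>" for Q
    using Q that measurable_sets[OF Y, of Q] by (auto simp: finite_partitions_def vimage_def Int_def conj_commute)
  show "(\<Sum>Q\<in>\<Q>. r P Q) = p P" if "P \<in> \<P>"
    using sum_prob_partition[OF Y Q Xe[OF that]] by (simp add: r_def p_def)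
  show "(\<Sum>P\<in>\<P>. r P Q) = q Q" if "Q \<in> \<Q>"
    using sum_prob_partition[OF X P Ye[OF that]] by (simp add: r_def q_def conj_ac cong: conj_cong)
  have top: "space M \<in> events" by simp
  show "(\<Sum>P\<in>\<P>. p P) = 1" "(\<Sum>Q\<in>\<Q>. q Q) = 1"
    using sum_prob_partition[OF X P top] sum_prob_partition[OF Y Q top] by (simp_all add: p_def q_def prob_space)
  show "P \<in> \<P> \<Longrightarrow> Q \<in> \<Q> \<Longrightarrow> r P Q \<le> p P"
    unfolding r_def p_def by (intro finite_measure_mono Xe) auto
  show "P \<in> \<P> \<Longrightarrow> Q \<in> \<Q> \<Longrightarrow> r P Q \<le> q Q"
    unfolding r_def q_def by (intro finite_measure_mono Ye) auto
qed

text \<open>This is I(X;Y) \<le> H(Y): a joint probability is at most that of the X-cell, which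
  cancels the latter from the logarithm. Then H(Y) is bounded by the logarithm of the number of
  values of Y.\<close>

lemma (in prob_space) mutual_info_le_ln:
  assumes X: "X \<in> measurable M A" and Y: "Y \<in> measurable M B"
    and fin: "finite K" "\<And>\<omega>. \<omega> \<in> space M \<Longrightarrow> Y \<omega> \<in> K"
  shows "mutual_info M A B X Y \<le> ereal (ln (card K))"
  unfolding mutual_info_def
proof (rule SUP_least, clarsimp)
  fix \<P> \<Q> assume P: "\<P> \<in> finite_partitions A" and Q: "\<Q> \<in> finite_partitions B"
  define p where "p = (\<lambda>P. prob {\<omega>\<in>space M. X \<omega> \<in> P})"
  define q where "q = (\<lambda>Q. prob {\<omega>\<in>space M. Y \<omega> \<in> Q})"
  define r where "r = (\<lambda>P Q. prob {\<omega>\<in>space M. X \<omega> \<in> P \<and> Y \<omega> \<in> Q})"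
  note J = joint_probs[OF X Y P Q p_def q_def r_def]
  have disj: "disjoint \<Q>" and fQ: "finite \<Q>" using Q by (auto simp: finite_partitions_def partition_on_def)
  have r0: "r P Q \<ge> 0" for P Q by (simp add: r_def)
  have "partition_info M X Y \<P> \<Q> = (\<Sum>P\<in>\<P>. \<Sum>Q\<in>\<Q>. r P Q * ln (r P Q / (p P * q Q)))"
    by (simp add: partition_info_def p_def q_def r_def)
  also have "\<dots> \<le> (\<Sum>P\<in>\<P>. \<Sum>Q\<in>\<Q>. r P Q * (- ln (q Q)))"
  proof (intro sum_mono)
    fix P Q assume PQ: "P \<in> \<P>" "Q \<in> \<Q>"
    show "r P Q * ln (r P Q / (p P * q Q)) \<le> r P Q * (- ln (q Q))"
    proof (cases "r P Q = 0")
      case False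
      then have pos: "r P Q > 0" "p P > 0" "q Q > 0" using r0[of P Q] J(5)[OF PQ] J(6)[OF PQ] by linarith+
      have "ln (r P Q / (p P * q Q)) \<le> ln (1 / q Q)"
        using pos J(5)[OF PQ] by (intro ln_mono) (auto simp: field_simps)
      also have "ln (1 / q Q) = - ln (q Q)" using pos by (simp add: ln_div)
      finally show ?thesis using pos by (intro mult_left_mono) auto
    qed simp
  qed
  also have "\<dots> = (\<Sum>Q\<in>\<Q>. \<Sum>P\<in>\<P>. r P Q * (- ln (q Q)))" by (rule sum.swap)
  also have "\<dots> = (\<Sum>Q\<in>\<Q>. entropy_term (q Q))"
  proof (intro sum.cong refl)
    fix Q assume "Q \<in> \<Q>"
    then have "(\<Sum>P\<in>\<P>. r P Q) * (- ln (q Q)) = entropy_term (q Q)" by (simp add: J(2) entropy_term_def)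
    then show "(\<Sum>P\<in>\<P>. r P Q * (- ln (q Q))) = entropy_term (q Q)" by (simp only: sum_distrib_right)
  qed
  also have "\<dots> \<le> ln (card K)"
  proof (rule sum_entropy_term_le_ln[OF fQ])
    show "sum q \<Q> = 1" using J(4) .
    \<comment> \<open>A cell of positive mass contains a value of Y, and disjoint cells contain
      different ones.\<close>
    have ex: "\<exists>k\<in>K. k \<in> Q" if "q Q > 0" for Q
    proof -
      have "{\<omega>\<in>space M. Y \<omega> \<in> Q} \<noteq> {}" using that unfolding q_def by (metis measure_empty less_irrefl)
      then show ?thesis using fin(2) by blast
    qed
    then obtain k where k: "\<And>Q. q Q > 0 \<Longrightarrow> k Q \<in> K \<and> k Q \<in> Q" by metis
    have "inj_on k {Q\<in>\<Q>. q Q > 0}"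
      using k disj by (intro inj_onI) (metis (mono_tags, lifting) disjoint_def disjoint_iff mem_Collect_eq)
    then show "card {Q\<in>\<Q>. q Q > 0} \<le> card K"
      using k fin(1) by (intro card_inj_on_le[of k]) auto
  qed (simp add: q_def)
  finally show "partition_info M X Y \<P> \<Q> \<le> ln (card K)" .
qed

context compact_system
begin

text \<open>The probability space is the phase space with \<mu>, and X is the identity. Y is the
  orbit along F of a fixed representative of the first member of an optimal cover that contains the
  point. The change of underlying type is justified by \<open>rate_distortion_le\<close>.\<close>

lemma rate_distortion_le_ln_cover_num:
  assumes \<mu>: "\<mu> \<in> invariant_measures G \<phi>" and F: "F \<subseteq> carrier G" "finite F" "F \<noteq> {}"
    and \<epsilon>: "\<epsilon> > 0" and p: "p > 0"
  shows "rate_distortion \<phi> \<mu> p \<epsilon> F \<le> ereal (ln (real (cover_num (dist_on \<phi> F) \<epsilon>)))"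
proof -
  have ps: "prob_space \<mu>" and sets_mu: "sets \<mu> = sets borel"
    using \<mu> by (auto simp: invariant_measures_def)
  then interpret prob_space \<mu> by simp
  have sp: "space \<mu> = UNIV" using sets_eq_imp_space_eq[OF sets_mu] by simp
  obtain \<U> where U: "finite \<U>" "\<And>U. U \<in> \<U> \<Longrightarrow> open U" "\<And>U. U \<in> \<U> \<Longrightarrow> diam (dist_on \<phi> F) U < \<epsilon>"
    "\<Union>\<U> = UNIV" "card \<U> = cover_num (dist_on \<phi> F) \<epsilon>" using dist_on_cover[OF F \<epsilon>] by blast
  obtain C and N :: nat where C: "\<U> = C ` {i. i < N}" and inj: "inj_on C {i. i < N}"
    using finite_imp_nat_seg_image_inj_on[OF U(1)] by metis
  have N: "N = cover_num (dist_on \<phi> F) \<epsilon>" using U(5) C card_image[OF inj] by simp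
  define l where "l x = (LEAST i. i < N \<and> x \<in> C i)" for x
  have l: "l x < N \<and> x \<in> C (l x)" for x
  proof -
    have "x \<in> \<Union>\<U>" using U(4) by simp
    then have "\<exists>i. i < N \<and> x \<in> C i" using C by auto
    then show ?thesis unfolding l_def by (rule LeastI_ex)
  qed
  define y where "y i = (SOME z. z \<in> C i)" for i
  have y: "y (l x) \<in> C (l x)" for x using l[of x] unfolding y_def by (intro someI) auto
  define Y where "Y g x = \<phi> g (y (l x))" for g x
  have l_meas: "l \<in> measurable \<mu> (count_space UNIV)"
    unfolding l_def
  proof (rule measurable_Least)
    fix i
    have "{x. i < N \<and> x \<in> C i} \<in> sets \<mu>"
      using U(2) C sets_mu by (cases "i < N") auto
    then show "(\<lambda>x. i < N \<and> x \<in> C i) \<in> measurable \<mu> (count_space UNIV)"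
      by (simp add: pred_def sp)
  qed
  have Y_meas: "Y g \<in> borel_measurable \<mu>" for g
    unfolding Y_def by (rule measurable_compose[OF l_meas]) simp
  \<comment> \<open>The inequality in \<open>lp_close\<close> is strict, so one s < \<epsilon> has
    to serve all members of the finite cover. The 0 inserted into the maximum makes s nonnegative,
    as monotonicity of \<open>powr\<close> requires.\<close>
  obtain s where s: "s < \<epsilon>" "0 \<le> s" "\<And>x g. g \<in> F \<Longrightarrow> dist (\<phi> g x) (Y g x) \<le> s"
  proof -
    have "\<exists>s<\<epsilon>. \<forall>x\<in>C i. \<forall>y\<in>C i. \<forall>g\<in>F. dist (\<phi> g x) (\<phi> g y) \<le> s" if "i < N" for i
      using U(3)[of "C i"] C that diam_dist_on_less_iff[OF F(2,3) \<epsilon>] by auto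
    then obtain s where s: "\<And>i. i < N \<Longrightarrow> s i < \<epsilon>"
      "\<And>i x y g. i < N \<Longrightarrow> x \<in> C i \<Longrightarrow> y \<in> C i \<Longrightarrow> g \<in> F \<Longrightarrow> dist (\<phi> g x) (\<phi> g y) \<le> s i"
      by metis
    let ?s = "Max (insert 0 (s ` {..<N}))"
    have "?s < \<epsilon>" using s(1) \<epsilon> by auto
    moreover have "dist (\<phi> g x) (Y g x) \<le> ?s" if "g \<in> F" for g x
    proof -
      have "dist (\<phi> g x) (Y g x) \<le> s (l x)" using s(2) l y that by (simp add: Y_def)
      also have "\<dots> \<le> ?s" using l by (intro Max_ge) auto
      finally show ?thesis .
    qed
    ultimately show thesis by (intro that[of ?s]) auto
  qed
  have adm: "admissible \<phi> \<mu> p \<epsilon> F \<mu> (\<lambda>x. x) Y"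
    unfolding admissible_def lp_close_def
  proof (intro conjI ballI ps Y_meas)
    show "(\<lambda>x. x) \<in> borel_measurable \<mu>" using measurable_ident_sets[OF sets_mu] by simp
    show "distr \<mu> borel (\<lambda>x. x) = \<mu>" using distr_id2[OF sets_mu[symmetric]] by simp
    have "(\<integral>x. 1 / real (card F) * (\<Sum>g\<in>F. dist (\<phi> g x) (Y g x) powr p) \<partial>\<mu>) \<le> (\<integral>x. s powr p \<partial>\<mu>)"
    proof (rule integral_mono')
      fix x
      have "(\<Sum>g\<in>F. dist (\<phi> g x) (Y g x) powr p) \<le> (\<Sum>g\<in>F. s powr p)"
        using s p by (intro sum_mono powr_mono2) auto
      then show "1 / real (card F) * (\<Sum>g\<in>F. dist (\<phi> g x) (Y g x) powr p) \<le> s powr p"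
        using F by (simp add: field_simps card_gt_0_iff)
    qed auto
    also have "\<dots> = s powr p" by (simp add: prob_space)
    also have "\<dots> < \<epsilon> powr p" using s p by (intro powr_less_mono2) auto
    finally show "(\<integral>x. 1 / real (card F) * (\<Sum>g\<in>F. dist (\<phi> g x) (Y g x) powr p) \<partial>\<mu>) < \<epsilon> powr p" .
  qed
  have "rate_distortion \<phi> \<mu> p \<epsilon> F \<le> family_info F \<mu> (\<lambda>x. x) Y"
    by (rule rate_distortion_le[OF sys F(1) adm])
  also have "\<dots> \<le> ereal (ln (card ((\<lambda>i. \<lambda>g\<in>F. \<phi> g (y i)) ` {..<N})))"
    unfolding family_info_def
  proof (rule mutual_info_le_ln)
    show "(\<lambda>x. x) \<in> borel_measurable \<mu>" using measurable_ident_sets[OF sets_mu] by simp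
    show "(\<lambda>\<omega>. \<lambda>g\<in>F. Y g \<omega>) \<in> measurable \<mu> (Pi\<^sub>M F (\<lambda>_. borel))"
      by (intro measurable_restrict Y_meas)
  qed (use l in \<open>auto simp: Y_def\<close>)
  also have "\<dots> \<le> ereal (ln (real N))"
  proof -
    have "card ((\<lambda>i. \<lambda>g\<in>F. \<phi> g (y i)) ` {..<N}) \<le> N" by (metis card_image_le card_lessThan finite_lessThan)
    moreover have "card ((\<lambda>i. \<lambda>g\<in>F. \<phi> g (y i)) ` {..<N}) > 0"
      using l[of undefined] by (auto simp: card_gt_0_iff)
    ultimately show ?thesis by (simp add: ln_mono)
  qed
  finally show ?thesis by (simp add: N)
qed

lemma rate_upper_le_cover_entropy:
  assumes \<mu>: "\<mu> \<in> invariant_measures G \<phi>" and F: "folner_sequence G F"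
    and \<epsilon>: "\<epsilon> > 0" and p: "p > 0"
  shows "rate_upper \<phi> \<mu> p F \<epsilon> \<le> ereal (cover_entropy G \<phi> \<epsilon>)"
proof -
  have Fn: "F n \<subseteq> carrier G" "finite (F n)" "F n \<noteq> {}" for n using F by (auto simp: folner_sequence_def)
  have pos: "real (card (F n)) > 0" for n using Fn[of n] by (simp add: card_gt_0_iff)
  have "rate_upper \<phi> \<mu> p F \<epsilon> \<le> limsup (\<lambda>n. ereal (ln (real (cover_num (dist_on \<phi> (F n)) \<epsilon>)) / card (F n)))"
    unfolding rate_upper_def
  proof (rule Limsup_mono, rule always_eventually, rule allI)
    fix n
    have "rate_distortion \<phi> \<mu> p \<epsilon> (F n) / ereal (card (F n))
        \<le> ereal (ln (real (cover_num (dist_on \<phi> (F n)) \<epsilon>))) / ereal (card (F n))"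
      using pos by (intro ereal_divide_right_mono rate_distortion_le_ln_cover_num \<mu> Fn \<epsilon> p) auto
    then show "rate_distortion \<phi> \<mu> p \<epsilon> (F n) / ereal (card (F n))
        \<le> ereal (ln (real (cover_num (dist_on \<phi> (F n)) \<epsilon>)) / card (F n))"
      using pos[of n] by simp
  qed
  also have "\<dots> = ereal (cover_entropy G \<phi> \<epsilon>)"
    using cover_entropy_tendsto[OF F \<epsilon>] by (intro lim_imp_Limsup) auto
  finally show ?thesis .
qed

end

section \<open>Shearer's inequality\<close>

text \<open>In the telescoping over \<^term>\<open>F\<close>, the increment of \<^term>\<open>f\<close> at \<^term>\<open>g\<close> is dominated by the increment
  along each \<^term>\<open>S i\<close> containing \<^term>\<open>g\<close>; the deficit in multiplicity is paid for with \<^term>\<open>b\<close>.\<close>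

lemma shearer_submodular:
  fixes f :: "'g set \<Rightarrow> real" and b :: real and k :: nat
  assumes F: "finite F" and I: "finite I" and f0: "f {} = 0"
    and sub: "\<And>S T g. S \<subseteq> T \<Longrightarrow> g \<notin> T \<Longrightarrow> f (insert g T) - f T \<le> f (insert g S) - f S"
    and b: "\<And>g. g \<in> F \<Longrightarrow> f {g} \<le> b"
    and k: "\<And>g. g \<in> F \<Longrightarrow> card {i\<in>I. g \<in> S i} \<le> k"
  shows "k * f F \<le> (\<Sum>i\<in>I. f (S i \<inter> F)) + b * (\<Sum>g\<in>F. real k - card {i\<in>I. g \<in> S i})"
  using F b k
proof (induction F rule: finite_induct)
  case empty
  then show ?case by (simp add: f0)
next
  case (insert g F)
  let ?\<Delta> = "f (insert g F) - f F" and ?m = "card {i\<in>I. g \<in> S i}"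
  have "?\<Delta> \<le> f (insert g {}) - f {}" using insert by (intro sub) auto
  also have "\<dots> \<le> b" using insert.prems(1)[of g] f0 by simp
  finally have \<Delta>: "?\<Delta> \<le> b" .
  have "(\<Sum>i\<in>I. f (S i \<inter> F) + (if g \<in> S i then ?\<Delta> else 0)) \<le> (\<Sum>i\<in>I. f (S i \<inter> insert g F))"
  proof (rule sum_mono)
    fix i assume "i \<in> I"
    show "f (S i \<inter> F) + (if g \<in> S i then ?\<Delta> else 0) \<le> f (S i \<inter> insert g F)"
      using sub[of "S i \<inter> F" F g] insert.hyps by (cases "g \<in> S i") (auto simp: Int_insert_right)
  qed
  moreover have "(\<Sum>i\<in>I. f (S i \<inter> F) + (if g \<in> S i then ?\<Delta> else 0)) = (\<Sum>i\<in>I. f (S i \<inter> F)) + ?m * ?\<Delta>"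
    using I by (simp add: sum.distrib sum.If_cases Int_def)
  moreover have "(real k - ?m) * ?\<Delta> \<le> (real k - ?m) * b"
    using \<Delta> insert.prems(2)[of g] by (intro mult_left_mono) auto
  moreover have "k * f F \<le> (\<Sum>i\<in>I. f (S i \<inter> F)) + b * (\<Sum>g\<in>F. real k - card {i\<in>I. g \<in> S i})"
    using insert by auto
  ultimately have "k * f F + k * ?\<Delta> \<le> (\<Sum>i\<in>I. f (S i \<inter> insert g F))
      + (b * (\<Sum>g\<in>F. real k - card {i\<in>I. g \<in> S i}) + (real k - ?m) * b)"
    unfolding left_diff_distrib by linarith
  then show ?case using insert.hyps by (simp add: algebra_simps)
qed

section \<open>Entropy of the labels of a uniformly distributed point\<close>

definition label_class :: "'e set \<Rightarrow> ('g \<Rightarrow> 'e \<Rightarrow> 'c) \<Rightarrow> 'g set \<Rightarrow> 'e \<Rightarrow> 'e set" where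
  "label_class E a S e = {e'\<in>E. \<forall>g\<in>S. a g e' = a g e}"

text \<open>The Shannon entropy of the labels \<open>a g e\<close>, \<open>g \<in> S\<close>, of a uniformly distributed \<open>e \<in> E\<close>.\<close>

definition label_entropy :: "'e set \<Rightarrow> ('g \<Rightarrow> 'e \<Rightarrow> 'c) \<Rightarrow> 'g set \<Rightarrow> real" where
  "label_entropy E a S = (\<Sum>e\<in>E. ln (card E) - ln (card (label_class E a S e))) / card E"

lemma finite_label_class: "finite E \<Longrightarrow> finite (label_class E a S e)"
  by (simp add: label_class_def)

lemma card_label_class_pos: "finite E \<Longrightarrow> e \<in> E \<Longrightarrow> card (label_class E a S e) > 0"
  by (auto simp: card_gt_0_iff label_class_def)

lemma label_entropy_empty: "label_entropy E a {} = 0"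
  by (simp add: label_entropy_def label_class_def)

lemma label_entropy_mono:
  assumes "finite E" "S \<subseteq> T"
  shows "label_entropy E a S \<le> label_entropy E a T"
  unfolding label_entropy_def
proof (intro divide_right_mono sum_mono)
  fix e assume e: "e \<in> E"
  have "card (label_class E a T e) \<le> card (label_class E a S e)"
    using assms by (intro card_mono finite_label_class) (auto simp: label_class_def)
  then show "ln (card E) - ln (card (label_class E a S e)) \<le> ln (card E) - ln (card (label_class E a T e))"
    using card_label_class_pos[OF assms(1) e] by (intro diff_left_mono ln_mono) auto
qed simp

text \<open>Nonnegativity of a conditional mutual information, proved by counting. Write n S e for
  the size of the label class of e along S. By ln x \<le> x - 1 it suffices that the ratios n T e *
  n (insert g S) e / (n (insert g T) e * n S e) have sum at most |E|. The numerator counts pairs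
  (e', e'') with e' in the T-class of e and e'' in its class along \<open>insert g S\<close>. For a
  fixed pair, all such e share one class along \<open>insert g T\<close>, so the factors 1 / n
  (insert g T) e add up to at most 1. What remains is 1 / n S e' with e'' in the S-class of e', and
  this sums to 1 over e''.\<close>

lemma label_entropy_submodular:
  assumes E: "finite E" and ST: "S \<subseteq> T"
  shows "label_entropy E a (insert g T) - label_entropy E a T
    \<le> label_entropy E a (insert g S) - label_entropy E a S"
proof (cases "E = {}")
  case True
  then show ?thesis by (simp add: label_entropy_def)
next
  case False
  let ?c = "label_class E a"
  define n where "n S e = real (card (label_class E a S e))" for S e
  have pos: "n S e > 0" if "e \<in> E" for S e using card_label_class_pos[OF E that] by (simp add: n_def)
  let ?gT = "insert g T" and ?gS = "insert g S"
  have n_eq: "n S e = n S e'" if "e' \<in> ?c S e" for e e'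
    using that by (auto simp: n_def label_class_def intro!: arg_cong[of _ _ card])
  have inner: "(\<Sum>e\<in>E. if e' \<in> ?c T e \<and> e'' \<in> ?c ?gS e then 1 / (n ?gT e * n S e) else 0)
      \<le> (if e'' \<in> ?c S e' then 1 / n S e' else 0)" if e': "e' \<in> E" for e' e''
  proof -
    let ?D = "{e\<in>E. e' \<in> ?c T e \<and> e'' \<in> ?c ?gS e}"
    have fD: "finite ?D" using E by simp
    have "(\<Sum>e\<in>E. if e' \<in> ?c T e \<and> e'' \<in> ?c ?gS e then 1 / (n ?gT e * n S e) else 0)
        = (\<Sum>e\<in>?D. 1 / (n ?gT e * n S e))"
      using E by (simp add: sum.If_cases Int_def)
    also have "\<dots> \<le> (\<Sum>e\<in>?D. 1 / (real (card ?D) * n S e'))"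
    proof (rule sum_mono)
      fix e assume e: "e \<in> ?D"
      \<comment> \<open>Elements of \<open>?D\<close> have the T-labels of e' and the g-label of
        e'', so they agree along \<open>insert g T\<close>.\<close>
      have "?D \<subseteq> ?c ?gT e" using e ST by (auto simp: label_class_def)
      then have "real (card ?D) \<le> n ?gT e" using E finite_label_class unfolding n_def by (intro of_nat_mono card_mono) auto
      moreover have "card ?D > 0" using e fD by (auto simp: card_gt_0_iff)
      moreover have "n S e = n S e'" using n_eq[of e' e] e ST by (auto simp: label_class_def)
      ultimately show "1 / (n ?gT e * n S e) \<le> 1 / (real (card ?D) * n S e')"
        using pos[OF e'] by (intro divide_left_mono mult_right_mono mult_pos_pos) auto
    qed
    also have "\<dots> \<le> (if e'' \<in> ?c S e' then 1 / n S e' else 0)"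
    proof (cases "?D = {}")
      case True
      then show ?thesis using pos[OF e', of S] by (simp only: True) auto
    next
      case False
      then have "e'' \<in> ?c S e'" using ST by (auto simp: label_class_def)
      moreover have "card ?D > 0" using False fD by (simp only: card_gt_0_iff) simp
      ultimately show ?thesis by simp
    qed
    finally show ?thesis .
  qed
  have "(\<Sum>e\<in>E. n T e * n ?gS e / (n ?gT e * n S e))
      = (\<Sum>e\<in>E. \<Sum>e'\<in>E. \<Sum>e''\<in>E. if e' \<in> ?c T e \<and> e'' \<in> ?c ?gS e then 1 / (n ?gT e * n S e) else 0)"
  proof (rule sum.cong[OF refl])
    fix e assume "e \<in> E"
    have ind: "n R e = (\<Sum>e'\<in>E. if e' \<in> ?c R e then 1 else 0)" for R
      using E by (simp add: n_def sum.If_cases Int_def label_class_def)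
    have "n T e * n ?gS e / (n ?gT e * n S e)
        = (\<Sum>e'\<in>E. \<Sum>e''\<in>E. (if e' \<in> ?c T e then 1 else 0) * (if e'' \<in> ?c ?gS e then 1 else 0)) / (n ?gT e * n S e)"
      unfolding ind[of T] ind[of ?gS] by (simp only: sum_product)
    also have "\<dots> = (\<Sum>e'\<in>E. \<Sum>e''\<in>E. if e' \<in> ?c T e \<and> e'' \<in> ?c ?gS e then 1 / (n ?gT e * n S e) else 0)"
      unfolding sum_divide_distrib by (intro sum.cong refl) auto
    finally show "n T e * n ?gS e / (n ?gT e * n S e)
      = (\<Sum>e'\<in>E. \<Sum>e''\<in>E. if e' \<in> ?c T e \<and> e'' \<in> ?c ?gS e then 1 / (n ?gT e * n S e) else 0)" .
  qed
  also have "\<dots> = (\<Sum>e'\<in>E. \<Sum>e\<in>E. \<Sum>e''\<in>E. if e' \<in> ?c T e \<and> e'' \<in> ?c ?gS e then 1 / (n ?gT e * n S e) else 0)"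
    by (rule sum.swap)
  also have "\<dots> = (\<Sum>e'\<in>E. \<Sum>e''\<in>E. \<Sum>e\<in>E. if e' \<in> ?c T e \<and> e'' \<in> ?c ?gS e then 1 / (n ?gT e * n S e) else 0)"
    by (intro sum.cong refl sum.swap)
  also have "\<dots> \<le> (\<Sum>e'\<in>E. \<Sum>e''\<in>E. if e'' \<in> ?c S e' then 1 / n S e' else 0)"
    by (intro sum_mono inner)
  also have "\<dots> = (\<Sum>e'\<in>E. 1)"
  proof (rule sum.cong[OF refl])
    fix e' assume e': "e' \<in> E"
    have "(\<Sum>e''\<in>E. if e'' \<in> ?c S e' then 1 / n S e' else 0) = card (?c S e') * (1 / n S e')"
      using E by (simp add: sum.If_cases Int_def label_class_def)
    then show "(\<Sum>e''\<in>E. if e'' \<in> ?c S e' then 1 / n S e' else 0) = 1"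
      using pos[OF e', of S] by (simp add: n_def)
  qed
  finally have key: "(\<Sum>e\<in>E. n T e * n ?gS e / (n ?gT e * n S e)) \<le> (\<Sum>e\<in>E. 1)" .
  have "(\<Sum>e\<in>E. ln (n T e) + ln (n ?gS e) - ln (n ?gT e) - ln (n S e))
      \<le> (\<Sum>e\<in>E. n T e * n ?gS e / (n ?gT e * n S e) - 1)"
  proof (rule sum_mono)
    fix e assume e: "e \<in> E"
    note p = pos[OF e]
    have "ln (n T e) + ln (n ?gS e) - ln (n ?gT e) - ln (n S e) = ln (n T e * n ?gS e / (n ?gT e * n S e))"
      using p[of T] p[of ?gS] p[of ?gT] p[of S] by (simp add: ln_div ln_mult_pos)
    also have "\<dots> \<le> n T e * n ?gS e / (n ?gT e * n S e) - 1"
      using p by (intro ln_le_minus_one divide_pos_pos mult_pos_pos) auto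
    finally show "ln (n T e) + ln (n ?gS e) - ln (n ?gT e) - ln (n S e) \<le> n T e * n ?gS e / (n ?gT e * n S e) - 1" .
  qed
  also have "\<dots> \<le> 0" using key by (simp add: sum_subtractf)
  finally have "(\<Sum>e\<in>E. ln (n T e)) + (\<Sum>e\<in>E. ln (n ?gS e)) - (\<Sum>e\<in>E. ln (n ?gT e)) - (\<Sum>e\<in>E. ln (n S e)) \<le> 0"
    by (simp add: sum.distrib sum_subtractf)
  then show ?thesis
    unfolding label_entropy_def n_def[symmetric] sum_subtractf diff_divide_distrib[symmetric]
    by (intro divide_right_mono) auto
qed

text \<open>E is grouped by the label function. Members of U that are not realized have empty fibres
  and contribute \<open>entropy_term 0 = 0\<close>; extensionality makes agreement on S the same as
  equality of functions.\<close>

lemma label_entropy_eq_sum: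
  assumes E: "finite E" and U: "finite U" "\<And>e. e \<in> E \<Longrightarrow> (\<lambda>g\<in>S. a g e) \<in> U"
    and ext: "\<And>u. u \<in> U \<Longrightarrow> u \<in> extensional S"
  shows "label_entropy E a S = (\<Sum>u\<in>U. entropy_term (card {e\<in>E. \<forall>g\<in>S. a g e = u g} / card E))"
proof -
  let ?u = "\<lambda>e. \<lambda>g\<in>S. a g e" and ?F = "\<lambda>u. {e\<in>E. \<forall>g\<in>S. a g e = u g}"
  have fib: "{e\<in>E. ?u e = u} = ?F u" if "u \<in> U" for u
    using ext[OF that] by (auto simp: fun_eq_iff extensional_def)
  have "label_entropy E a S = (\<Sum>e\<in>E. (ln (card E) - ln (card (label_class E a S e))) / card E)"
    by (simp add: label_entropy_def sum_divide_distrib)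
  also have "\<dots> = (\<Sum>u\<in>U. \<Sum>e\<in>{e\<in>E. ?u e = u}. (ln (card E) - ln (card (label_class E a S e))) / card E)"
    using E U by (intro sum.group[symmetric]) auto
  also have "\<dots> = (\<Sum>u\<in>U. entropy_term (card (?F u) / card E))"
  proof (rule sum.cong[OF refl])
    fix u assume u: "u \<in> U"
    have "(\<Sum>e\<in>{e\<in>E. ?u e = u}. (ln (card E) - ln (card (label_class E a S e))) / card E)
        = (\<Sum>e\<in>?F u. (ln (card E) - ln (card (?F u))) / card E)"
      unfolding fib[OF u]
    proof (rule sum.cong[OF refl])
      fix e assume "e \<in> ?F u"
      then have "label_class E a S e = ?F u" by (auto simp: label_class_def)
      then show "(ln (card E) - ln (card (label_class E a S e))) / card E = (ln (card E) - ln (card (?F u))) / card E" by simp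
    qed
    also have "\<dots> = card (?F u) / card E * (ln (card E) - ln (card (?F u)))" by simp
    also have "\<dots> = entropy_term (card (?F u) / card E)"
    proof (cases "card (?F u) = 0")
      case False
      then have "card E > 0" using E by (metis (no_types, lifting) card_gt_0_iff card_eq_0_iff empty_Collect_eq equals0D)
      with False show ?thesis by (simp add: entropy_term_def ln_div algebra_simps)
    qed simp
    finally show "(\<Sum>e\<in>{e\<in>E. ?u e = u}. (ln (card E) - ln (card (label_class E a S e))) / card E)
        = entropy_term (card (?F u) / card E)" .
  qed
  finally show ?thesis .
qed

lemma label_entropy_singleton_le:
  assumes E: "finite E" "E \<noteq> {}" and k: "\<And>e. e \<in> E \<Longrightarrow> a g e < k"
  shows "label_entropy E a {g} \<le> ln (real k)"
proof -
  let ?U = "{g} \<rightarrow>\<^sub>E {..<k}"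
  let ?F = "\<lambda>u. {e\<in>E. \<forall>g\<in>{g}. a g e = u g}"
  have fU: "finite ?U" by (intro finite_PiE) auto
  have "label_entropy E a {g} = (\<Sum>u\<in>?U. entropy_term (card (?F u) / card E))"
    using E k fU by (intro label_entropy_eq_sum) (auto simp: PiE_def)
  also have "\<dots> \<le> ln (real k)"
  proof (rule sum_entropy_term_le_ln[OF fU])
    have "(\<Sum>u\<in>?U. card (?F u)) = card (\<Union>u\<in>?U. ?F u)"
    proof (rule card_UN_disjoint[symmetric])
      show "\<forall>u\<in>?U. \<forall>v\<in>?U. u \<noteq> v \<longrightarrow> ?F u \<inter> ?F v = {}"
        by (auto simp: PiE_def extensional_def fun_eq_iff) metis+
    qed (use E fU in auto)
    also have "(\<Union>u\<in>?U. ?F u) = E"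
    proof -
      have "e \<in> (\<Union>u\<in>?U. ?F u)" if "e \<in> E" for e
        using that k by (intro UN_I[of "\<lambda>h\<in>{g}. a h e"]) auto
      then show ?thesis by blast
    qed
    finally show "(\<Sum>u\<in>?U. card (?F u) / card E) = 1"
      using E by (simp flip: sum_divide_distrib of_nat_sum)
    have "card {u\<in>?U. card (?F u) / card E > 0} \<le> card ?U" using fU by (intro card_mono) auto
    also have "card ?U = k" by (simp add: card_PiE)
    finally show "card {u\<in>?U. card (?F u) / card E > 0} \<le> k" .
  qed simp
  finally show ?thesis .
qed

lemma entropy_term_tangent:
  assumes "0 \<le> x" "0 < y"
  shows "entropy_term x \<le> entropy_term y + (x - y) * (- ln y - 1)"
proof (cases "x = 0")
  case True
  then show ?thesis using assms by (simp add: entropy_term_def algebra_simps)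
next
  case False
  then have x: "x > 0" using assms by simp
  have "x * ln (y / x) \<le> x * (y / x - 1)"
    using x assms by (intro mult_left_mono ln_le_minus_one) auto
  then show ?thesis using x assms by (simp add: entropy_term_def ln_div algebra_simps)
qed

text \<open>Jensen's inequality by the tangent at the mean. Mean 0, where the tangent is vertical,
  forces all x i to vanish.\<close>

lemma sum_entropy_term_le_mean:
  assumes I: "finite I" "I \<noteq> {}" and x: "\<And>i. i \<in> I \<Longrightarrow> 0 \<le> x i"
  shows "(\<Sum>i\<in>I. entropy_term (x i)) \<le> card I * entropy_term ((\<Sum>i\<in>I. x i) / card I)"
proof -
  let ?y = "(\<Sum>i\<in>I. x i) / card I"
  have cI: "card I > 0" using I by (simp add: card_gt_0_iff)
  show ?thesis
  proof (cases "?y = 0")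
    case True
    then have "\<forall>i\<in>I. x i = 0" using cI x I by (simp add: sum_nonneg_eq_0_iff)
    then show ?thesis by simp
  next
    case False
    then have y: "?y > 0" using x cI by (metis divide_nonneg_nonneg less_eq_real_def of_nat_0_le_iff sum_nonneg)
    have "(\<Sum>i\<in>I. entropy_term (x i)) \<le> (\<Sum>i\<in>I. entropy_term ?y + (x i - ?y) * (- ln ?y - 1))"
      using x y by (intro sum_mono entropy_term_tangent) auto
    also have "\<dots> = card I * entropy_term ?y + ((\<Sum>i\<in>I. x i) - card I * ?y) * (- ln ?y - 1)"
      by (simp only: sum.distrib sum_constant sum_distrib_right[symmetric] sum_subtractf of_nat_id)
    also have "\<dots> = card I * entropy_term ?y" using cI by simp
    finally show ?thesis .
  qed
qed

section \<open>Cylinder entropies of averaged separated sets\<close>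

context compact_system
begin

text \<open>The mean over c in F of the push-forwards under c of the uniform distribution on E,
  evaluated on arbitrary subsets.\<close>

definition empirical :: "'a set \<Rightarrow> 'x set \<Rightarrow> 'x set \<Rightarrow> real" where
  "empirical F E A = (\<Sum>c\<in>F. real (card {e\<in>E. \<phi> c e \<in> A}) / card E) / card F"

text \<open>The cell with name u of the partition P^T, where P consists of the level sets of
  l.\<close>

definition cylinder :: "('x \<Rightarrow> nat) \<Rightarrow> 'a set \<Rightarrow> ('a \<Rightarrow> nat) \<Rightarrow> 'x set" where
  "cylinder l T u = {x. \<forall>t\<in>T. l (\<phi> t x) = u t}"

text \<open>Shearer's inequality for the sets T c, c in F. The labels of e along T c are the labels
  of c e along T, which turns translation in the group into averaging over the orbit. Labels along F
  determine e, so their entropy is ln |E|. The last term pays for the g near the edge of F, which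
  lie in fewer than |T| of the sets T c.\<close>

lemma ln_card_separated_le:
  assumes F: "F \<subseteq> carrier G" "finite F" "F \<noteq> {}" and E: "finite E" "E \<noteq> {}"
    and T: "T \<subseteq> carrier G" "finite T" and l: "\<And>x. l x < k"
    and sep: "\<And>e e'. e \<in> E \<Longrightarrow> e' \<in> E \<Longrightarrow> (\<And>g. g \<in> F \<Longrightarrow> l (\<phi> g e) = l (\<phi> g e')) \<Longrightarrow> e = e'"
  shows "card T * ln (card E) \<le>
    card F * (\<Sum>u\<in>T \<rightarrow>\<^sub>E {..<k}. entropy_term (empirical F E (cylinder l T u)))
      + ln (real k) * (\<Sum>t\<in>T. real (card (F - l_coset G t F)))"
proof -
  let ?a = "\<lambda>g e. l (\<phi> g e)"
  let ?h = "label_entropy E ?a"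
  let ?U = "T \<rightarrow>\<^sub>E {..<k}"
  have fU: "finite ?U" using T by (intro finite_PiE) auto
  have "?h F = ln (card E)"
  proof -
    have "label_class E ?a F e = {e}" if "e \<in> E" for e
      using sep that by (auto simp: label_class_def)
    then show ?thesis using E by (simp add: label_entropy_def)
  qed
  have mult: "card {c\<in>F. g \<in> T #> c} = card {t\<in>T. inv t \<otimes> g \<in> F}" if g: "g \<in> F" for g
  proof (rule bij_betw_same_card[of "\<lambda>c. g \<otimes> inv c"])
    have gc: "g \<in> carrier G" using g F by auto
    show "bij_betw (\<lambda>c. g \<otimes> inv c) {c\<in>F. g \<in> T #> c} {t\<in>T. inv t \<otimes> g \<in> F}"
    proof (rule bij_betw_byWitness[where f' = "\<lambda>t. inv t \<otimes> g"])
      show "\<forall>c\<in>{c\<in>F. g \<in> T #> c}. inv (g \<otimes> inv c) \<otimes> g = c"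
        using F gc by (auto simp: inv_mult_group m_assoc subset_iff)
      show "\<forall>t\<in>{t\<in>T. inv t \<otimes> g \<in> F}. g \<otimes> inv (inv t \<otimes> g) = t"
        using T gc by (auto simp: inv_mult_group subset_iff) (simp add: m_assoc[symmetric])
      show "(\<lambda>c. g \<otimes> inv c) ` {c\<in>F. g \<in> T #> c} \<subseteq> {t\<in>T. inv t \<otimes> g \<in> F}"
      proof (rule image_subsetI)
        fix c assume "c \<in> {c\<in>F. g \<in> T #> c}"
        then have c: "c \<in> F" "g \<in> T #> c" by auto
        then obtain t where t: "t \<in> T" "g = t \<otimes> c" by (auto simp: r_coset_def)
        have car: "t \<in> carrier G" "c \<in> carrier G" using t c T F by auto
        have "g \<otimes> inv c = t" using t(2) car by (simp add: m_assoc)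
        moreover have "inv t \<otimes> g = c" using t(2) car by (simp add: m_assoc[symmetric])
        ultimately show "g \<otimes> inv c \<in> {t\<in>T. inv t \<otimes> g \<in> F}" using t(1) c(1) by simp
      qed
      show "(\<lambda>t. inv t \<otimes> g) ` {t\<in>T. inv t \<otimes> g \<in> F} \<subseteq> {c\<in>F. g \<in> T #> c}"
      proof (rule image_subsetI)
        fix t assume "t \<in> {t\<in>T. inv t \<otimes> g \<in> F}"
        then have t: "t \<in> T" "inv t \<otimes> g \<in> F" by auto
        then have tc: "t \<in> carrier G" using T by auto
        have "g = t \<otimes> (inv t \<otimes> g)" using tc gc by (simp add: m_assoc[symmetric])
        then show "inv t \<otimes> g \<in> {c\<in>F. g \<in> T #> c}" using t unfolding r_coset_def by blast
      qed
    qed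
  qed
  \<comment> \<open>The multiplicity missing at g counts the t for which inv t g is outside F.
    Summing over g first leaves F - t F for each t, which the Folner condition controls.\<close>
  have deficit: "(\<Sum>g\<in>F. real (card T) - card {c\<in>F. g \<in> T #> c}) = (\<Sum>t\<in>T. real (card (F - l_coset G t F)))"
  proof -
    have "(\<Sum>g\<in>F. real (card T) - card {c\<in>F. g \<in> T #> c}) = (\<Sum>g\<in>F. \<Sum>t\<in>T. if inv t \<otimes> g \<in> F then 0 else 1)"
    proof (rule sum.cong[OF refl])
      fix g assume g: "g \<in> F"
      have "card T = card {t\<in>T. inv t \<otimes> g \<in> F} + card {t\<in>T. inv t \<otimes> g \<notin> F}"
        using T by (subst card_Un_disjoint[symmetric]) (auto intro: arg_cong[of _ _ card])
      then show "real (card T) - card {c\<in>F. g \<in> T #> c} = (\<Sum>t\<in>T. if inv t \<otimes> g \<in> F then 0 else 1)"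
        using mult[OF g] T by (simp add: sum.If_cases Int_def)
    qed
    also have "\<dots> = (\<Sum>t\<in>T. \<Sum>g\<in>F. if inv t \<otimes> g \<in> F then 0 else 1)" by (rule sum.swap)
    also have "\<dots> = (\<Sum>t\<in>T. real (card (F - l_coset G t F)))"
    proof (rule sum.cong[OF refl])
      fix t assume t: "t \<in> T"
      then have tc: "t \<in> carrier G" using T by auto
      have "inv t \<otimes> g \<in> F \<longleftrightarrow> g \<in> l_coset G t F" if "g \<in> F" for g
      proof -
        have gc: "g \<in> carrier G" using that F by auto
        have "g = t \<otimes> (inv t \<otimes> g)" using tc gc by (simp add: m_assoc[symmetric])
        moreover have "inv t \<otimes> (t \<otimes> c) = c" if "c \<in> F" for c
          using that F tc by (auto simp: m_assoc[symmetric] subset_iff)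
        ultimately show ?thesis unfolding l_coset_def by force
      qed
      then have "F - l_coset G t F = {g\<in>F. inv t \<otimes> g \<notin> F}" by blast
      then show "(\<Sum>g\<in>F. if inv t \<otimes> g \<in> F then 0 else 1) = real (card (F - l_coset G t F))"
        using F by (simp add: sum.If_cases Int_def)
    qed
    finally show ?thesis .
  qed
  have "card T * ?h F \<le> (\<Sum>c\<in>F. ?h ((T #> c) \<inter> F)) + ln (real k) * (\<Sum>g\<in>F. real (card T) - card {c\<in>F. g \<in> T #> c})"
  proof (rule shearer_submodular)
    show "?h {g} \<le> ln (real k)" for g using E l by (intro label_entropy_singleton_le) auto
    show "card {c\<in>F. g \<in> T #> c} \<le> card T" if "g \<in> F" for g
      unfolding mult[OF that] using T by (intro card_mono) auto
    show "?h (insert g T) - ?h T \<le> ?h (insert g S) - ?h S" if "S \<subseteq> T" "g \<notin> T" for S T g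
      by (rule label_entropy_submodular[OF E(1) that(1)])
  qed (use F in \<open>auto simp: label_entropy_empty\<close>)
  also have "(\<Sum>c\<in>F. ?h ((T #> c) \<inter> F)) \<le> (\<Sum>c\<in>F. ?h (T #> c))"
    using E by (intro sum_mono label_entropy_mono) auto
  also have "(\<Sum>c\<in>F. ?h (T #> c)) = (\<Sum>c\<in>F. \<Sum>u\<in>?U. entropy_term (card {e\<in>E. \<phi> c e \<in> cylinder l T u} / card E))"
  proof (rule sum.cong[OF refl])
    fix c assume c: "c \<in> F"
    let ?b = "\<lambda>t e. l (\<phi> t (\<phi> c e))"
    have "label_class E ?a (T #> c) e = label_class E ?b T e" for e
      using act_mult c F T by (auto simp: label_class_def r_coset_def subset_iff)
    then have "?h (T #> c) = label_entropy E ?b T" by (simp add: label_entropy_def)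
    also have "\<dots> = (\<Sum>u\<in>?U. entropy_term (card {e\<in>E. \<forall>t\<in>T. ?b t e = u t} / card E))"
      using E fU l by (intro label_entropy_eq_sum) (auto simp: PiE_def)
    finally show "?h (T #> c) = (\<Sum>u\<in>?U. entropy_term (card {e\<in>E. \<phi> c e \<in> cylinder l T u} / card E))"
      by (simp add: cylinder_def)
  qed
  also have "\<dots> = (\<Sum>u\<in>?U. \<Sum>c\<in>F. entropy_term (card {e\<in>E. \<phi> c e \<in> cylinder l T u} / card E))"
    by (rule sum.swap)
  \<comment> \<open>Concavity moves the average over c inside \<open>entropy_term\<close>, where it
    becomes \<open>empirical\<close>.\<close>
  also have "\<dots> \<le> (\<Sum>u\<in>?U. card F * entropy_term (empirical F E (cylinder l T u)))"
    unfolding empirical_def using F by (intro sum_mono sum_entropy_term_le_mean) auto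
  also have "\<dots> = card F * (\<Sum>u\<in>?U. entropy_term (empirical F E (cylinder l T u)))"
    by (simp add: sum_distrib_left)
  finally show ?thesis using \<open>?h F = ln (card E)\<close> deficit by simp
qed

end

section \<open>Regularization of finitely additive probabilities\<close>

text \<open>K - V and K - U are disjoint closed sets, and every point of K is assigned to the nearer
  one. Empty sets are treated separately because \<open>infdist x {} = 0\<close>.\<close>

lemma closed_subset_Un_split:
  fixes K :: "'x::metric_space set"
  assumes K: "closed K" and U: "open U" and V: "open V" and sub: "K \<subseteq> U \<union> V"
  obtains K1 K2 where "closed K1" "closed K2" "K1 \<subseteq> U" "K2 \<subseteq> V" "K = K1 \<union> K2"
proof -
  let ?S = "K - V" and ?T = "K - U"
  have S: "closed ?S" and T: "closed ?T" using K U V by auto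
  consider "?S = {}" | "?T = {}" | "?S \<noteq> {}" "?T \<noteq> {}" by blast
  then show thesis
  proof cases
    case 1
    then show thesis using that[of "{}" K] K by auto
  next
    case 2
    then show thesis using that[of K "{}"] K by auto
  next
    case 3
    let ?K1 = "K \<inter> {x. infdist x ?S \<le> infdist x ?T}" and ?K2 = "K \<inter> {x. infdist x ?T \<le> infdist x ?S}"
    have c: "closed {x. infdist x A \<le> infdist x B}" for A B :: "'x set"
      by (intro closed_Collect_le continuous_intros)
    show thesis
    proof (rule that)
      show "closed ?K1" "closed ?K2" using K c by (auto intro: closed_Int)
      show "?K1 \<subseteq> U"
      proof
        fix x assume x: "x \<in> ?K1"
        show "x \<in> U"
        proof (rule ccontr)
          assume "x \<notin> U"
          then have "infdist x ?T = 0" using x by (intro infdist_zero) auto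
          then have "infdist x ?S = 0" using x infdist_nonneg[of x ?S] by auto
          then have "x \<in> ?S" using in_closed_iff_infdist_zero[OF S 3(1)] by simp
          then show False using x sub \<open>x \<notin> U\<close> by auto
        qed
      qed
      show "?K2 \<subseteq> V"
      proof
        fix x assume x: "x \<in> ?K2"
        show "x \<in> V"
        proof (rule ccontr)
          assume "x \<notin> V"
          then have "infdist x ?S = 0" using x by (intro infdist_zero) auto
          then have "infdist x ?T = 0" using x infdist_nonneg[of x ?T] by auto
          then have "x \<in> ?T" using in_closed_iff_infdist_zero[OF T 3(2)] by simp
          then show False using x sub \<open>x \<notin> V\<close> by auto
        qed
      qed
    qed (use linear in auto)
  qed
qed

text \<open>The properties that survive when probabilities converge on every subset; countable
  additivity may be lost.\<close>

locale finitely_additive_prob =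
  fixes \<nu> :: "'x::metric_space set \<Rightarrow> real"
  assumes compact_space: "compact (UNIV :: 'x set)"
    and nonneg: "0 \<le> \<nu> A"
    and total: "\<nu> UNIV = 1"
    and additive: "A \<inter> B = {} \<Longrightarrow> \<nu> (A \<union> B) = \<nu> A + \<nu> B"
begin

lemma mono: "A \<subseteq> B \<Longrightarrow> \<nu> A \<le> \<nu> B"
  using additive[of A "B - A"] nonneg[of "B - A"] by (simp add: Un_absorb1)

lemma empty: "\<nu> {} = 0"
  using additive[of "{}" "{}"] by simp

lemma compl: "\<nu> (- A) = 1 - \<nu> A"
  using additive[of A "- A"] total by (simp add: Compl_partition)

lemma Un_le: "\<nu> (A \<union> B) \<le> \<nu> A + \<nu> B"
  using additive[of A "B - A"] mono[of "B - A" B] by simp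

text \<open>Inner regularization by closed sets. It can be strictly smaller than \<nu> U, since
  \<nu> may carry mass that escapes to the boundary of U.\<close>

definition inner_content :: "'x set \<Rightarrow> ennreal" where
  "inner_content U = (SUP K\<in>{K. closed K \<and> K \<subseteq> U}. ennreal (\<nu> K))"

definition outer_content :: "'x set \<Rightarrow> ennreal" where
  "outer_content A = (INF U\<in>{U. open U \<and> A \<subseteq> U}. inner_content U)"

lemma inner_mono: "U \<subseteq> V \<Longrightarrow> inner_content U \<le> inner_content V"
  unfolding inner_content_def by (rule SUP_subset_mono) auto

lemma inner_le: "inner_content U \<le> ennreal (\<nu> U)"
  unfolding inner_content_def by (rule SUP_least) (auto intro!: ennreal_leI mono)

lemma le_inner: "closed K \<Longrightarrow> K \<subseteq> U \<Longrightarrow> ennreal (\<nu> K) \<le> inner_content U"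
  unfolding inner_content_def by (rule SUP_upper) auto

lemma outer_open: "open U \<Longrightarrow> outer_content U = inner_content U"
  unfolding outer_content_def by (intro antisym INF_lower INF_greatest) (auto intro: inner_mono)

lemma outer_mono: "A \<subseteq> B \<Longrightarrow> outer_content A \<le> outer_content B"
  unfolding outer_content_def by (rule INF_superset_mono) auto

lemma outer_le_inner: "open U \<Longrightarrow> A \<subseteq> U \<Longrightarrow> outer_content A \<le> inner_content U"
  unfolding outer_content_def by (rule INF_lower) auto

lemma closed_subset_finite_UN_le:
  fixes m :: nat
  assumes "closed K" "K \<subseteq> (\<Union>n<m. U n)" "\<And>n. open (U n)"
  shows "ennreal (\<nu> K) \<le> (\<Sum>n<m. inner_content (U n))"
  using assms(1,2)
proof (induction m arbitrary: K)
  case 0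
  then show ?case by (simp add: empty)
next
  case (Suc m)
  have "K \<subseteq> (\<Union>n<m. U n) \<union> U m" using Suc.prems(2) by (simp add: lessThan_Suc Un_commute)
  then obtain K1 K2 where K: "closed K1" "closed K2" "K1 \<subseteq> (\<Union>n<m. U n)" "K2 \<subseteq> U m" "K = K1 \<union> K2"
    using closed_subset_Un_split[OF Suc.prems(1) _ assms(3)] assms(3) by (metis open_UN)
  have "ennreal (\<nu> K) \<le> ennreal (\<nu> K1 + \<nu> K2)" using K(5) Un_le by (auto intro: ennreal_leI)
  also have "\<dots> = ennreal (\<nu> K1) + ennreal (\<nu> K2)" by (simp add: nonneg)
  also have "\<dots> \<le> (\<Sum>n<m. inner_content (U n)) + inner_content (U m)"
    using K by (intro add_mono Suc.IH le_inner) auto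
  finally show ?case by simp
qed

text \<open>Countable subadditivity is regained from compactness: a closed set inside the union is
  covered by finitely many of the U n.\<close>

lemma inner_UN_le:
  assumes U: "\<And>n::nat. open (U n)"
  shows "inner_content (\<Union>n. U n) \<le> (\<Sum>n. inner_content (U n))"
  unfolding inner_content_def[of "\<Union>n. U n"]
proof (rule SUP_least, clarify)
  fix K assume K: "closed K" "K \<subseteq> (\<Union>n. U n)"
  have "compact K" using compact_Int_closed[OF compact_space K(1)] by simp
  then obtain N where N: "finite N" "K \<subseteq> (\<Union>n\<in>N. U n)"
    by (rule compactE_image[of K UNIV U]) (use U K in auto)
  obtain m where m: "N \<subseteq> {..<m}" using finite_nat_bounded[OF N(1)] by blast
  have "ennreal (\<nu> K) \<le> (\<Sum>n<m. inner_content (U n))"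
    using N m U by (intro closed_subset_finite_UN_le K(1)) blast+
  also have "\<dots> \<le> (\<Sum>n. inner_content (U n))" by (intro sum_le_suminf) auto
  finally show "ennreal (\<nu> K) \<le> (\<Sum>n. inner_content (U n))" .
qed

lemma outer_UN_le:
  fixes A :: "nat \<Rightarrow> 'x set"
  shows "outer_content (\<Union>n. A n) \<le> (\<Sum>n. outer_content (A n))"
proof (rule ennreal_le_epsilon)
  fix e :: real assume e: "0 < e" and fin: "(\<Sum>n. outer_content (A n)) < top_class.top"
  have *: "outer_content (A n) < outer_content (A n) + ennreal (e * (1/2) ^ Suc n)" for n
    using fin e by (auto simp add: less_top dest!: ennreal_suminf_lessD)
  have "\<exists>U. open U \<and> A n \<subseteq> U \<and> inner_content U \<le> outer_content (A n) + ennreal (e * (1/2) ^ Suc n)" for n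
    using *[of n] unfolding outer_content_def[of "A n"] INF_less_iff by (auto intro: less_imp_le)
  then obtain U where U: "\<And>n. open (U n)" "\<And>n. A n \<subseteq> U n"
    "\<And>n. inner_content (U n) \<le> outer_content (A n) + ennreal (e * (1/2) ^ Suc n)" by metis
  have "outer_content (\<Union>n. A n) \<le> inner_content (\<Union>n. U n)" using U by (intro outer_le_inner open_UN) auto
  also have "\<dots> \<le> (\<Sum>n. inner_content (U n))" using U by (intro inner_UN_le)
  also have "\<dots> \<le> (\<Sum>n. outer_content (A n) + ennreal (e * (1/2) ^ Suc n))"
    using U by (intro suminf_le) auto
  also have "\<dots> = (\<Sum>n. outer_content (A n)) + (\<Sum>n. ennreal e * ennreal ((1/2) ^ Suc n))"
    using e by (subst suminf_add[symmetric]) (auto simp del: ennreal_suminf_cmult simp add: ennreal_mult[symmetric])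
  also have "\<dots> = (\<Sum>n. outer_content (A n)) + e"
    unfolding ennreal_suminf_cmult
    by (subst suminf_ennreal_eq[OF zero_le_power power_half_series]) auto
  finally show "outer_content (\<Union>n. A n) \<le> (\<Sum>n. outer_content (A n)) + ennreal e" .
qed

lemma outer_measure_space_outer: "outer_measure_space UNIV outer_content"
  unfolding outer_measure_space_def positive_def increasing_def countably_subadditive_def
proof (intro conjI allI ballI impI)
  have "inner_content {} = 0" using inner_le[of "{}"] by (simp add: empty)
  then show "outer_content {} = 0" by (simp add: outer_open)
qed (use outer_mono outer_UN_le in auto)

text \<open>It suffices to split an open W. For closed K inside W \<inter> U, the open set W - K
  contains W - U, and closed sets inside W - K are disjoint from K, so \<nu> adds up on
  them.\<close>

lemma open_in_lambda_system:
  assumes U: "open U"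
  shows "U \<in> lambda_system UNIV UNIV outer_content"
proof -
  interpret algebra UNIV "UNIV :: 'x set set" by (simp add: algebra_iff_Un)
  have split: "inner_content (W \<inter> U) + outer_content (W - U) \<le> inner_content W" if W: "open W" for W
  proof -
    have "ennreal (\<nu> K) + outer_content (W - U) \<le> inner_content W" if K: "closed K" "K \<subseteq> W \<inter> U" for K
    proof -
      have "outer_content (W - U) \<le> inner_content (W - K)" using K W by (intro outer_le_inner) auto
      then have "ennreal (\<nu> K) + outer_content (W - U) \<le> ennreal (\<nu> K) + inner_content (W - K)" by (rule add_left_mono)
      also have "\<dots> = (SUP K'\<in>{K'. closed K' \<and> K' \<subseteq> W - K}. ennreal (\<nu> K) + ennreal (\<nu> K'))"
        unfolding inner_content_def by (intro ennreal_SUP_add_right) auto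
      also have "\<dots> \<le> inner_content W"
      proof (rule SUP_least, clarify)
        fix K' assume K': "closed K'" "K' \<subseteq> W - K"
        have "ennreal (\<nu> K) + ennreal (\<nu> K') = ennreal (\<nu> (K \<union> K'))"
          using K' by (subst additive) (auto simp: nonneg)
        also have "\<dots> \<le> inner_content W" using K K' by (intro le_inner) auto
        finally show "ennreal (\<nu> K) + ennreal (\<nu> K') \<le> inner_content W" .
      qed
      finally show ?thesis .
    qed
    moreover have "inner_content (W \<inter> U) + outer_content (W - U)
        = (SUP K\<in>{K. closed K \<and> K \<subseteq> W \<inter> U}. ennreal (\<nu> K) + outer_content (W - U))"
      unfolding inner_content_def[of "W \<inter> U"] by (intro ennreal_SUP_add_left[symmetric]) auto
    ultimately show ?thesis by (auto intro: SUP_least)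
  qed
  have "outer_content (A \<inter> U) + outer_content (A - U) = outer_content A" for A
  proof (rule antisym)
    show "outer_content (A \<inter> U) + outer_content (A - U) \<le> outer_content A"
      unfolding outer_content_def[of A]
    proof (rule INF_greatest, clarify)
      fix W assume W: "open W" "A \<subseteq> W"
      have "outer_content (A \<inter> U) + outer_content (A - U) \<le> inner_content (W \<inter> U) + outer_content (W - U)"
        using W U by (intro add_mono outer_le_inner outer_mono) auto
      then show "outer_content (A \<inter> U) + outer_content (A - U) \<le> inner_content W" using split[OF W(1)] by (rule order_trans)
    qed
    have "subadditive UNIV outer_content"
      using outer_measure_space_outer countably_subadditive_subadditive by (simp add: outer_measure_space_def)
    then have "outer_content ((A \<inter> U) \<union> (A - U)) \<le> outer_content (A \<inter> U) + outer_content (A - U)"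
      unfolding subadditive_def by (metis Diff_disjoint Int_Diff Int_assoc UNIV_I inf_commute inf_bot_right)
    moreover have "(A \<inter> U) \<union> (A - U) = A" by blast
    ultimately show "outer_content A \<le> outer_content (A \<inter> U) + outer_content (A - U)" by simp
  qed
  then show ?thesis unfolding lambda_system_eq by simp
qed

text \<open>The values on open sets determine \<mu>. They yield \<mu> U \<le> \<nu> U for open U
  and, by complements, \<nu> C \<le> \<mu> C for closed C.\<close>

theorem regularization:
  obtains \<mu> where "sets \<mu> = sets borel" "prob_space \<mu>" "\<And>U. open U \<Longrightarrow> emeasure \<mu> U = inner_content U"
proof -
  interpret S: sigma_algebra UNIV "UNIV :: 'x set set" using sigma_algebra_Pow[of UNIV] by simp
  let ?L = "lambda_system UNIV UNIV outer_content"
  have ms: "measure_space UNIV ?L outer_content"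
    by (rule S.caratheodory_lemma[OF outer_measure_space_outer])
  then have sL: "sigma_algebra UNIV ?L" by (simp add: measure_space_def)
  interpret L: sigma_algebra UNIV ?L by (rule sL)
  have "sigma_sets UNIV {S. open S} \<subseteq> ?L"
    using open_in_lambda_system by (intro L.sigma_sets_subset) auto
  moreover have B: "sets (borel :: 'x measure) = sigma_sets UNIV {S. open S}"
    by (simp add: borel_def)
  ultimately have BL: "sets (borel :: 'x measure) \<subseteq> ?L" by simp
  have ms': "measure_space UNIV (sets (borel :: 'x measure)) outer_content"
    by (rule measure_down[OF ms _ BL]) (use sets.sigma_algebra_axioms[of "borel :: 'x measure"] in simp)
  define \<mu> where "\<mu> = measure_of UNIV (sets (borel :: 'x measure)) outer_content"
  have sets_mu: "sets \<mu> = sets borel"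
    unfolding \<mu>_def using sets.sigma_sets_eq[of "borel :: 'x measure"] by (simp add: sets_measure_of_conv)
  have em: "emeasure \<mu> A = outer_content A" if "A \<in> sets borel" for A
    using ms' that unfolding \<mu>_def measure_space_def by (intro emeasure_measure_of_sigma) auto
  have emo: "emeasure \<mu> U = inner_content U" if "open U" for U
    using em[of U] that by (simp add: outer_open)
  have "inner_content UNIV = 1"
    using inner_le[of UNIV] le_inner[of UNIV UNIV] by (intro antisym) (auto simp: total)
  then have "prob_space \<mu>"
    using emo[of UNIV] sets_eq_imp_space_eq[OF sets_mu] by (intro prob_spaceI) simp
  with sets_mu emo that show thesis by blast
qed

end

lemma measure_eqI_open:
  fixes M N :: "'x::topological_space measure"
  assumes M: "sets M = sets borel" and N: "sets N = sets borel" and fin: "finite_measure M"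
    and eq: "\<And>U. open U \<Longrightarrow> emeasure M U = emeasure N U"
  shows "M = N"
proof (rule measure_eqI_generator_eq[of "{U. open U}" UNIV M N "\<lambda>_. UNIV"])
  show "emeasure M UNIV \<noteq> \<infinity>"
    using finite_measure.emeasure_finite[OF fin, of UNIV] by simp
qed (use M N eq in \<open>auto simp: Int_stable_def borel_def\<close>)

section \<open>Limits of empirical measures\<close>

text \<open>The index set will be the collection of all subsets of the space, too large for a
  diagonal subsequence. Tychonoff gives a cluster point v of the sequence in a power of [0,1], and K
  is generated by the tails together with the preimages of neighbourhoods of v.\<close>

lemma convergent_subfilter:
  fixes u :: "nat \<Rightarrow> 'i \<Rightarrow> real"
  assumes u: "\<And>n i. 0 \<le> u n i" "\<And>n i. u n i \<le> 1"
  obtains K v where "K \<noteq> bot" "K \<le> sequentially" "\<And>i. ((\<lambda>n. u n i) \<longlongrightarrow> v i) K"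
proof -
  let ?S = "PiE UNIV (\<lambda>_. {0..1}) :: ('i \<Rightarrow> real) set"
  have "compactin (product_topology (\<lambda>i. euclidean) UNIV) ?S"
    by (simp add: compactin_PiE)
  then have "compact ?S" by (simp add: euclidean_product_topology)
  moreover have "eventually (\<lambda>x. x \<in> ?S) (filtermap u sequentially)"
    using u by (simp add: eventually_filtermap PiE_UNIV_domain Pi_iff)
  moreover have "filtermap u sequentially \<noteq> bot" by (simp add: filtermap_bot_iff)
  ultimately obtain v where v: "inf (nhds v) (filtermap u sequentially) \<noteq> bot"
    unfolding compact_filter by blast
  define K where "K = inf sequentially (filtercomap u (nhds v))"
  have "K \<noteq> bot"
  proof
    assume "K = bot"
    then have "eventually (\<lambda>_. False) K" by simp
    then obtain Q R where Q: "eventually Q sequentially" and R: "eventually R (filtercomap u (nhds v))"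
      and QR: "\<And>n. Q n \<and> R n \<Longrightarrow> False" unfolding K_def eventually_inf by blast
    obtain R' where R': "eventually R' (nhds v)" "\<And>n. R' (u n) \<Longrightarrow> R n"
      using R unfolding eventually_filtercomap by blast
    have "eventually (\<lambda>x. \<not> R' x) (filtermap u sequentially)"
      unfolding eventually_filtermap using Q by eventually_elim (use QR R' in blast)
    with R'(1) have "eventually (\<lambda>_. False) (inf (nhds v) (filtermap u sequentially))"
      unfolding eventually_inf by blast
    with v show False by (simp add: trivial_limit_def)
  qed
  moreover have "K \<le> sequentially" by (simp add: K_def)
  moreover have "((\<lambda>n. u n i) \<longlongrightarrow> v i) K" for i
  proof -
    have "filterlim u (nhds v) K"
      unfolding filterlim_def K_def filtermap_le_iff_le_filtercomap by simp
    moreover have "filterlim (\<lambda>x :: 'i \<Rightarrow> real. x i) (nhds (v i)) (nhds v)"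
    proof (rule topological_tendstoI)
      fix S :: "real set" assume S: "open S" "v i \<in> S"
      have "open ((\<lambda>x :: 'i \<Rightarrow> real. x i) -` S)"
        using continuous_on_open_vimage[of UNIV "\<lambda>x :: 'i \<Rightarrow> real. x i"] S by auto
      then show "\<forall>\<^sub>F x in nhds v. x i \<in> S" using S(2) by (auto simp: eventually_nhds)
    qed
    ultimately show ?thesis by (rule filterlim_compose[rotated])
  qed
  ultimately show thesis by (rule that)
qed

text \<open>From ln y \<le> y at y = 1 / sqrt x; it yields continuity of \<open>entropy_term\<close>
  at 0.\<close>

lemma entropy_term_le_sqrt:
  assumes "0 \<le> x" "x \<le> 1"
  shows "entropy_term x \<le> 2 * sqrt x"
proof (cases "x = 0")
  case False
  then have x: "x > 0" using assms by simp
  have "ln (1 / sqrt x) \<le> 1 / sqrt x" using x ln_bound[of "1 / sqrt x"] by simp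
  moreover have "ln (1 / sqrt x) = - ln x / 2" using x by (simp add: ln_div ln_sqrt)
  ultimately have "x * (- ln x) \<le> x * (2 / sqrt x)" using x by (intro mult_left_mono) auto
  also have "x * (2 / sqrt x) = 2 * sqrt x" using x by (simp add: field_simps)
  finally show ?thesis by (simp add: entropy_term_def)
qed simp

lemma tendsto_entropy_term:
  assumes f: "(f \<longlongrightarrow> l) K" and r: "\<And>x. 0 \<le> f x" "\<And>x. f x \<le> 1"
  shows "((\<lambda>x. entropy_term (f x)) \<longlongrightarrow> entropy_term l) K"
proof (cases "l = 0")
  case False
  then show ?thesis unfolding entropy_term_def using f by (intro tendsto_intros) auto
next
  case True
  have "((\<lambda>x. 2 * sqrt (f x)) \<longlongrightarrow> 2 * sqrt 0) K" using f True by (intro tendsto_intros) auto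
  then have s: "((\<lambda>x. 2 * sqrt (f x)) \<longlongrightarrow> 0) K" by simp
  have "((\<lambda>x. entropy_term (f x)) \<longlongrightarrow> 0) K"
    by (rule tendsto_sandwich[OF _ _ tendsto_const s])
      (use r in \<open>auto intro!: always_eventually entropy_term_nonneg entropy_term_le_sqrt\<close>)
  then show ?thesis using True by simp
qed

section \<open>Separated sets and limits of their orbit averages\<close>

context compact_system
begin

definition separated :: "'a set \<Rightarrow> real \<Rightarrow> 'x set \<Rightarrow> bool" where
  "separated F \<epsilon> E \<longleftrightarrow> finite E \<and> (\<forall>e\<in>E. \<forall>e'\<in>E. e \<noteq> e' \<longrightarrow> (\<exists>g\<in>F. \<epsilon> \<le> dist (\<phi> g e) (\<phi> g e')))"

text \<open>Two points of a separated set never share a member of the cover. The resulting bound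
  guarantees that a separated set of maximal cardinality exists.\<close>

lemma card_separated_le_cover_num:
  assumes F: "F \<subseteq> carrier G" "finite F" "F \<noteq> {}" and \<epsilon>: "\<epsilon> > 0" and E: "separated F \<epsilon> E"
  shows "card E \<le> cover_num (dist_on \<phi> F) \<epsilon>"
proof -
  obtain \<U> where U': "finite \<U>" "\<And>U. U \<in> \<U> \<Longrightarrow> open U" "\<And>U. U \<in> \<U> \<Longrightarrow> diam (dist_on \<phi> F) U < \<epsilon>"
    "\<Union>\<U> = UNIV" "card \<U> = cover_num (dist_on \<phi> F) \<epsilon>" using dist_on_cover[OF F \<epsilon>] by blast
  note U = U'(1,3,4,5)
  have "\<exists>U\<in>\<U>. e \<in> U" for e using U(3) by blast
  then obtain U where UE: "\<And>e. U e \<in> \<U>" "\<And>e. e \<in> U e" by metis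
  have "inj_on U E"
  proof (rule inj_onI, rule ccontr)
    fix e e' assume e: "e \<in> E" "e' \<in> E" "U e = U e'" "e \<noteq> e'"
    obtain g where g: "g \<in> F" "\<epsilon> \<le> dist (\<phi> g e) (\<phi> g e')"
      using E e unfolding separated_def by blast
    obtain s where "s < \<epsilon>" "\<And>x y g. x \<in> U e \<Longrightarrow> y \<in> U e \<Longrightarrow> g \<in> F \<Longrightarrow> dist (\<phi> g x) (\<phi> g y) \<le> s"
      using U(2)[OF UE(1)[of e]] unfolding diam_dist_on_less_iff[OF F(2,3) \<epsilon>] by blast
    moreover have "e' \<in> U e" using UE(2)[of e'] e(3) by simp
    ultimately show False using g UE(2)[of e] by fastforce
  qed
  then show ?thesis using UE U by (metis card_inj_on_le image_subsetI)
qed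

text \<open>By maximality the open Bowen balls of radius \<epsilon> about E cover the space. Their
  diameters are at most 2 \<epsilon>, so 4 \<epsilon> leaves room for a strict inequality.\<close>

lemma maximal_separated:
  assumes F: "F \<subseteq> carrier G" "finite F" "F \<noteq> {}" and \<epsilon>: "\<epsilon> > 0"
  obtains E where "separated F \<epsilon> E" "E \<noteq> {}" "cover_num (dist_on \<phi> F) (4 * \<epsilon>) \<le> card E"
proof -
  let ?N = "Suc (cover_num (dist_on \<phi> F) \<epsilon>)"
  have "\<forall>E. separated F \<epsilon> E \<longrightarrow> card E < ?N"
    using card_separated_le_cover_num[OF F \<epsilon>] by (simp add: less_Suc_eq_le)
  moreover have "separated F \<epsilon> {undefined}" by (simp add: separated_def)
  ultimately obtain E where E: "separated F \<epsilon> E" and max: "\<And>D. separated F \<epsilon> D \<Longrightarrow> card D \<le> card E"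
    using ex_has_greatest_nat[of "separated F \<epsilon>" "{undefined}" card ?N] by metis
  have fE: "finite E" using E by (simp add: separated_def)
  have ne: "E \<noteq> {}" using max[of "{undefined}"] by (auto simp: separated_def)
  define B where "B e = (\<Inter>g\<in>F. \<phi> g -` ball (\<phi> g e) \<epsilon>)" for e
  have op: "open (B x)" for x
    unfolding B_def using F by (intro open_INT ballI) (auto intro: act_open_vimage)
  have cov: "\<exists>e\<in>E. x \<in> B e" for x
  proof (rule ccontr)
    assume neg: "\<not> ?thesis"
    have far: "\<exists>g\<in>F. \<epsilon> \<le> dist (\<phi> g e) (\<phi> g x)" if "e \<in> E" for e
      using neg that by (auto simp: B_def not_less)
    have "x \<notin> E" using neg \<epsilon> by (auto simp: B_def)
    moreover have "separated F \<epsilon> (insert x E)"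
      using E far unfolding separated_def by (auto simp: dist_commute)
    ultimately show False using max[of "insert x E"] fE by simp
  qed
  have "diam (dist_on \<phi> F) (B e) < 4 * \<epsilon>" for e
  proof -
    have "dist (\<phi> g y) (\<phi> g z) \<le> 2 * \<epsilon>" if "y \<in> B e" "z \<in> B e" "g \<in> F" for y z g
    proof -
      have "dist (\<phi> g e) (\<phi> g y) < \<epsilon>" "dist (\<phi> g e) (\<phi> g z) < \<epsilon>" using that by (auto simp: B_def)
      then show ?thesis using dist_triangle3[of "\<phi> g y" "\<phi> g z" "\<phi> g e"] by simp
    qed
    then show ?thesis using \<epsilon> F by (subst diam_dist_on_less_iff) (auto intro!: exI[of _ "2 * \<epsilon>"])
  qed
  then have "cover_num (dist_on \<phi> F) (4 * \<epsilon>) \<le> card (B ` E)"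
    using op fE cov by (intro cover_num_le) auto
  also have "\<dots> \<le> card E" using fE by (rule card_image_le)
  finally show thesis using E ne that by blast
qed

lemma empirical_nonneg: "0 \<le> empirical F E A"
  by (simp add: empirical_def sum_nonneg)

lemma empirical_le_1:
  assumes "finite F" "F \<noteq> {}" "finite E" "E \<noteq> {}"
  shows "empirical F E A \<le> 1"
proof -
  have "(\<Sum>c\<in>F. real (card {e\<in>E. \<phi> c e \<in> A}) / card E) \<le> (\<Sum>c\<in>F. 1)"
    using assms by (intro sum_mono) (simp add: divide_le_eq_1 card_gt_0_iff card_mono)
  then show ?thesis using assms by (simp add: empirical_def divide_le_eq_1 card_gt_0_iff)
qed

lemma empirical_UNIV:
  assumes "finite F" "F \<noteq> {}" "finite E" "E \<noteq> {}"
  shows "empirical F E UNIV = 1"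
  using assms by (simp add: empirical_def)

lemma empirical_additive:
  assumes "finite E" "A \<inter> B = {}"
  shows "empirical F E (A \<union> B) = empirical F E A + empirical F E B"
proof -
  have "card {e\<in>E. \<phi> c e \<in> A \<union> B} = card {e\<in>E. \<phi> c e \<in> A} + card {e\<in>E. \<phi> c e \<in> B}" for c
    using assms by (subst card_Un_disjoint[symmetric]) (auto intro: arg_cong[of _ _ card])
  then show ?thesis by (simp add: empirical_def add_divide_distrib sum.distrib)
qed

text \<open>Pulling back by g replaces the sum over F by the sum over g F. The summands lie in
  [0,1], so only the symmetric difference counts.\<close>

lemma empirical_vimage_diff:
  assumes F: "F \<subseteq> carrier G" "finite F" and E: "finite E" "E \<noteq> {}" and g: "g \<in> carrier G"
  shows "\<bar>empirical F E (\<phi> g -` A) - empirical F E A\<bar>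
    \<le> real (card (l_coset G g F - F)) / card F + real (card (F - l_coset G g F)) / card F"
proof -
  define r where "r c = real (card {e\<in>E. \<phi> c e \<in> A}) / card E" for c
  have r: "0 \<le> r c" "r c \<le> 1" for c
    using E by (auto simp: r_def divide_le_eq_1 card_gt_0_iff card_mono)
  let ?gF = "l_coset G g F"
  have gF: "?gF = (\<lambda>c. g \<otimes> c) ` F" by (auto simp: l_coset_def)
  have fgF: "finite ?gF" using F by (simp add: gF)
  have inj: "inj_on (\<lambda>c. g \<otimes> c) F" using F g by (auto intro!: inj_onI simp: subset_iff)
  have "empirical F E (\<phi> g -` A) = (\<Sum>c\<in>F. r (g \<otimes> c)) / card F"
    unfolding empirical_def r_def using F g
    by (intro arg_cong2[of _ _ _ _ "(/)"] sum.cong refl) (auto simp: act_mult subset_iff)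
  also have "(\<Sum>c\<in>F. r (g \<otimes> c)) = sum r ?gF" unfolding gF using inj by (simp add: sum.reindex)
  finally have 1: "empirical F E (\<phi> g -` A) = sum r ?gF / card F" .
  have 2: "empirical F E A = sum r F / card F" by (simp add: empirical_def r_def)
  have "sum r ?gF = sum r (?gF \<inter> F) + sum r (?gF - F)" "sum r F = sum r (?gF \<inter> F) + sum r (F - ?gF)"
    using sum.Int_Diff[OF fgF, of r F] sum.Int_Diff[OF F(2), of r ?gF] by (simp_all add: Int_commute)
  moreover have "0 \<le> sum r (?gF - F)" "sum r (?gF - F) \<le> card (?gF - F)"
    "0 \<le> sum r (F - ?gF)" "sum r (F - ?gF) \<le> card (F - ?gF)"
    using r sum_mono[of _ r "\<lambda>_. 1"] by (auto simp: sum_nonneg)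
  ultimately have "\<bar>sum r ?gF - sum r F\<bar> \<le> real (card (?gF - F)) + real (card (F - ?gF))" by linarith
  then have "\<bar>sum r ?gF - sum r F\<bar> / card F \<le> (real (card (?gF - F)) + real (card (F - ?gF))) / card F"
    by (rule divide_right_mono) simp
  then show ?thesis by (simp add: 1 2 add_divide_distrib abs_divide flip: diff_divide_distrib)
qed

text \<open>Convergence on all subsets transfers the entropy inequality to all finite labellings l
  simultaneously, even non-measurable ones, since only finitely many cylinders enter for each T. So
  l may later depend on the measure obtained from \<nu>.\<close>

lemma finitely_additive_limit:
  assumes F: "folner_sequence G F" and \<epsilon>: "\<epsilon> > 0"
  obtains \<nu> :: "'x set \<Rightarrow> real" where "finitely_additive_prob \<nu>"
    and "\<And>g A. g \<in> carrier G \<Longrightarrow> \<nu> (\<phi> g -` A) = \<nu> A"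
    and "\<And>T l k. T \<subseteq> carrier G \<Longrightarrow> finite T \<Longrightarrow> (\<And>x. l x < k) \<Longrightarrow> (\<And>x y. l x = l y \<Longrightarrow> dist x y < \<epsilon>) \<Longrightarrow>
      card T * cover_entropy G \<phi> (4 * \<epsilon>) \<le> (\<Sum>u\<in>T \<rightarrow>\<^sub>E {..<k}. entropy_term (\<nu> (cylinder l T u)))"
proof -
  have Fn: "F n \<subseteq> carrier G" "finite (F n)" "F n \<noteq> {}" for n using F by (auto simp: folner_sequence_def)
  have pos: "real (card (F n)) > 0" for n using Fn[of n] by (simp add: card_gt_0_iff)
  have "\<exists>E. separated (F n) \<epsilon> E \<and> E \<noteq> {} \<and> cover_num (dist_on \<phi> (F n)) (4 * \<epsilon>) \<le> card E" for n
    using maximal_separated[OF Fn \<epsilon>] by metis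
  then obtain E where E: "\<And>n. separated (F n) \<epsilon> (E n)" "\<And>n. E n \<noteq> {}"
    "\<And>n. cover_num (dist_on \<phi> (F n)) (4 * \<epsilon>) \<le> card (E n)" by metis
  have fE: "finite (E n)" for n using E(1) by (simp add: separated_def)
  let ?u = "\<lambda>n. empirical (F n) (E n)"
  have u1: "?u n A \<le> 1" for n A by (rule empirical_le_1[OF Fn(2,3) fE E(2)])
  obtain K \<nu> where K: "K \<noteq> bot" "K \<le> sequentially" and lim: "\<And>A. ((\<lambda>n. ?u n A) \<longlongrightarrow> \<nu> A) K"
    using convergent_subfilter[of ?u] empirical_nonneg u1 by blast
  have seq: "(f \<longlongrightarrow> c) K" if "f \<longlonglongrightarrow> c" for f :: "nat \<Rightarrow> real" and c
    using that K(2) tendsto_mono by blast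
  show thesis
  proof (rule that)
    show "finitely_additive_prob \<nu>"
    proof
      show "compact (UNIV :: 'x set)" by (rule compact_UNIV)
      show "0 \<le> \<nu> A" for A
        by (rule tendsto_lowerbound[OF lim _ K(1)]) (simp add: empirical_nonneg)
      show "\<nu> UNIV = 1"
        by (rule tendsto_unique[OF K(1) lim]) (simp add: empirical_UNIV Fn fE E(2))
      show "\<nu> (A \<union> B) = \<nu> A + \<nu> B" if "A \<inter> B = {}" for A B
        by (rule tendsto_unique[OF K(1) lim]) (use tendsto_add[OF lim lim] in \<open>simp add: empirical_additive fE that\<close>)
    qed
    show "\<nu> (\<phi> g -` A) = \<nu> A" if g: "g \<in> carrier G" for g A
    proof -
      have "(\<lambda>n. real (card (l_coset G g (F n) - F n)) / card (F n)
          + real (card (F n - l_coset G g (F n))) / card (F n)) \<longlonglongrightarrow> 0 + 0"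
        by (intro tendsto_add folner_Diff_tendsto[OF F g])
      then have "((\<lambda>n. real (card (l_coset G g (F n) - F n)) / card (F n)
          + real (card (F n - l_coset G g (F n))) / card (F n)) \<longlongrightarrow> 0) K" by (intro seq) simp
      then have "((\<lambda>n. ?u n (\<phi> g -` A) - ?u n A) \<longlongrightarrow> 0) K"
        by (rule Lim_null_comparison[rotated])
          (auto intro!: always_eventually empirical_vimage_diff Fn fE E(2) g)
      moreover have "((\<lambda>n. ?u n (\<phi> g -` A) - ?u n A) \<longlongrightarrow> \<nu> (\<phi> g -` A) - \<nu> A) K"
        by (intro tendsto_diff lim)
      ultimately have "\<nu> (\<phi> g -` A) - \<nu> A = 0" using tendsto_unique[OF K(1)] by blast
      then show ?thesis by simp
    qed
    show "card T * cover_entropy G \<phi> (4 * \<epsilon>) \<le> (\<Sum>u\<in>T \<rightarrow>\<^sub>E {..<k}. entropy_term (\<nu> (cylinder l T u)))"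
      if T: "T \<subseteq> carrier G" "finite T" and l: "\<And>x. l x < k" "\<And>x y. l x = l y \<Longrightarrow> dist x y < \<epsilon>" for T l k
    proof -
      let ?U = "T \<rightarrow>\<^sub>E {..<k}"
      let ?d = "\<lambda>n. \<Sum>t\<in>T. real (card (F n - l_coset G t (F n))) / card (F n)"
      let ?rhs = "\<lambda>n. (\<Sum>u\<in>?U. entropy_term (?u n (cylinder l T u))) + ln (real k) * ?d n"
      have le: "card T * (ln (real (cover_num (dist_on \<phi> (F n)) (4 * \<epsilon>))) / card (F n)) \<le> ?rhs n" for n
      proof -
        have sep: "e = e'" if e: "e \<in> E n" "e' \<in> E n" and eq: "\<And>g. g \<in> F n \<Longrightarrow> l (\<phi> g e) = l (\<phi> g e')" for e e'
        proof (rule ccontr)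
          assume "e \<noteq> e'"
          then obtain g where "g \<in> F n" "\<epsilon> \<le> dist (\<phi> g e) (\<phi> g e')"
            using E(1)[of n] e unfolding separated_def by blast
          then show False using l(2)[OF eq] by fastforce
        qed
        have "ln (real (cover_num (dist_on \<phi> (F n)) (4 * \<epsilon>))) \<le> ln (card (E n))"
          using E(3)[of n] cover_num_ge_1[OF Fn[of n], of "4 * \<epsilon>"] \<epsilon> by (intro ln_mono) auto
        then have "card T * ln (real (cover_num (dist_on \<phi> (F n)) (4 * \<epsilon>))) \<le> card T * ln (card (E n))"
          by (intro mult_left_mono) auto
        also have "\<dots> \<le> card (F n) * (\<Sum>u\<in>?U. entropy_term (?u n (cylinder l T u)))
            + ln (real k) * (\<Sum>t\<in>T. real (card (F n - l_coset G t (F n))))"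
          by (rule ln_card_separated_le[OF Fn fE E(2) T l(1) sep])
        finally have "card T * ln (real (cover_num (dist_on \<phi> (F n)) (4 * \<epsilon>))) / card (F n)
            \<le> (card (F n) * (\<Sum>u\<in>?U. entropy_term (?u n (cylinder l T u)))
            + ln (real k) * (\<Sum>t\<in>T. real (card (F n - l_coset G t (F n))))) / card (F n)"
          by (rule divide_right_mono) simp
        also have "\<dots> = ?rhs n" using pos[of n] by (simp add: add_divide_distrib flip: sum_divide_distrib)
        finally show ?thesis by simp
      qed
      have "(\<lambda>n. card T * (ln (real (cover_num (dist_on \<phi> (F n)) (4 * \<epsilon>))) / card (F n)))
          \<longlonglongrightarrow> card T * cover_entropy G \<phi> (4 * \<epsilon>)"
        using \<epsilon> by (intro tendsto_mult tendsto_const cover_entropy_tendsto[OF F]) auto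
      note lhs = seq[OF this]
      have "?d \<longlonglongrightarrow> 0" by (rule tendsto_null_sum) (use folner_Diff_tendsto(2)[OF F] T in auto)
      then have "(?rhs \<longlongrightarrow> (\<Sum>u\<in>?U. entropy_term (\<nu> (cylinder l T u))) + ln (real k) * 0) K"
        by (intro tendsto_add tendsto_sum tendsto_mult tendsto_const tendsto_entropy_term lim seq empirical_nonneg u1)
      then have "(?rhs \<longlongrightarrow> (\<Sum>u\<in>?U. entropy_term (\<nu> (cylinder l T u)))) K" by simp
      from tendsto_le[OF K(1) this lhs] show ?thesis using le by simp
    qed
  qed
qed

end

section \<open>Padded partitions\<close>

lemma borel_dist_sets:
  fixes x :: "'x::metric_space"
  shows "{y. dist x y = R} \<in> sets borel" "{y. \<bar>dist x y - R\<bar> < r} \<in> sets borel"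
proof -
  have "closed {y. dist x y = R}" by (intro closed_Collect_eq continuous_intros)
  then show "{y. dist x y = R} \<in> sets borel" by simp
  have "open {y. \<bar>dist x y - R\<bar> < r}" by (intro open_Collect_less continuous_intros)
  then show "{y. \<bar>dist x y - R\<bar> < r} \<in> sets borel" by simp
qed

text \<open>These radii are the atoms of the law of the distance to x.\<close>

lemma countable_positive_spheres:
  fixes x :: "'x::metric_space"
  assumes "finite_measure M" "sets M = sets borel"
  shows "countable {R. measure M {y. dist x y = R} \<noteq> 0}"
proof -
  interpret finite_measure M by fact
  have d: "dist x \<in> measurable M borel"
    unfolding measurable_cong_sets[OF assms(2) refl] by (intro borel_measurable_continuous_onI continuous_intros)
  interpret D: finite_measure "distr M borel (dist x)" by (rule finite_measure_distr[OF d])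
  have "countable {R. measure (distr M borel (dist x)) {R} \<noteq> 0}" by (rule D.countable_support)
  moreover have "measure (distr M borel (dist x)) {R} = measure M {y. dist x y = R}" for R
    using sets_eq_imp_space_eq[OF assms(2)] by (subst measure_distr[OF d]) (auto intro!: arg_cong[of _ _ "measure M"])
  ultimately show ?thesis by simp
qed

text \<open>Region growing: the volume \<open>v s = \<mu> (A \<inter> ball x s) + 1 / N\<close> cannot grow by a factor exceeding
  \<open>1 + \<kappa>\<close> in each of \<open>J\<close> steps, since \<open>(1 + \<kappa>)\<^sup>J \<ge> N + 1\<close>.\<close>

lemma exists_good_radius:
  fixes x :: "'x::metric_space" and M :: "'x measure" and N J :: nat and a w r \<kappa> :: real
  assumes M: "prob_space M" "sets M = sets borel" and A: "A \<in> sets borel"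
    and N: "N > 0" and \<kappa>: "real (N + 1) \<le> (1 + \<kappa>) ^ J" "\<kappa> \<ge> 0" and r: "0 < r" "2 * r < w"
  shows "\<exists>R. a < R \<and> R < a + J * w \<and> measure M {y. dist x y = R} = 0 \<and>
    measure M (A \<inter> {y. \<bar>dist x y - R\<bar> < r}) \<le> \<kappa> * (measure M (A \<inter> ball x R) + 1 / N)"
proof -
  interpret prob_space M by fact
  have sp: "space M = UNIV" using sets_eq_imp_space_eq[OF M(2)] by simp
  define v where "v s = measure M (A \<inter> ball x s) + 1 / N" for s
  have ev: "A \<inter> ball x s \<in> events" for s using A M(2) by auto
  have v: "1 / N \<le> v s" "v s \<le> 1 + 1 / N" for s
    by (auto simp: v_def)
  have "\<exists>j<J. v (a + (real j + 1) * w) \<le> (1 + \<kappa>) * v (a + real j * w)"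
  proof (rule ccontr)
    assume neg: "\<not> ?thesis"
    \<comment> \<open>The contradiction needs strict growth, because the bound 1 + 1 / N is attained
      by (N + 1) * (1 / N). Strictness starts at j = 1, and J > 0 follows from N + 1 \<le> (1 +
      \<kappa>) ^ J.\<close>
    have grow: "(1 + \<kappa>) ^ j * v a \<le> v (a + real j * w) \<and> (j > 0 \<longrightarrow> (1 + \<kappa>) ^ j * v a < v (a + real j * w))" if "j \<le> J" for j
      using that
    proof (induction j)
      case (Suc j)
      have "(1 + \<kappa>) * ((1 + \<kappa>) ^ j * v a) \<le> (1 + \<kappa>) * v (a + real j * w)"
        using Suc \<kappa> by (intro mult_left_mono) auto
      also have "\<dots> < v (a + (real j + 1) * w)" using neg Suc.prems by (auto simp: not_le)
      finally show ?case by (simp add: algebra_simps)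
    qed simp
    have "J > 0" using \<kappa>(1) N by (cases J) auto
    then have "(1 + \<kappa>) ^ J * v a < v (a + real J * w)" using grow[of J] by auto
    also have "\<dots> \<le> 1 + 1 / N" by (rule v)
    also have "\<dots> = real (N + 1) * (1 / N)" using N by (simp add: field_simps)
    also have "\<dots> \<le> (1 + \<kappa>) ^ J * v a" using \<kappa> v(1)[of a] N by (intro mult_mono) auto
    finally show False by simp
  qed
  then obtain j where j: "j < J" "v (a + (real j + 1) * w) \<le> (1 + \<kappa>) * v (a + real j * w)" by blast
  let ?lo = "a + real j * w" and ?hi = "a + (real j + 1) * w"
  \<comment> \<open>A radius at distance more than r from both ends keeps its r-collar inside the
    slow annulus. Uncountably many such radii remain, so one has a null sphere.\<close>
  have "uncountable {?lo + r<..<?hi - r}" using r by (simp add: uncountable_open_interval algebra_simps)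
  moreover have "countable {R. measure M {y. dist x y = R} \<noteq> 0}"
    by (rule countable_positive_spheres[OF finite_measure_axioms M(2)])
  ultimately have "\<not> {?lo + r<..<?hi - r} \<subseteq> {R. measure M {y. dist x y = R} \<noteq> 0}"
    using countable_subset by metis
  then obtain R where R: "R \<in> {?lo + r<..<?hi - r}" "measure M {y. dist x y = R} = 0"
    by blast
  have w: "w > 0" using r by simp
  have 1: "A \<inter> {y. \<bar>dist x y - R\<bar> < r} \<subseteq> (A \<inter> ball x ?hi) - (A \<inter> ball x ?lo)"
    using R(1) by (auto simp: abs_less_iff)
  have "measure M (A \<inter> {y. \<bar>dist x y - R\<bar> < r}) \<le> measure M ((A \<inter> ball x ?hi) - (A \<inter> ball x ?lo))"
    using ev by (intro finite_measure_mono 1) auto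
  also have "\<dots> = measure M (A \<inter> ball x ?hi) - measure M (A \<inter> ball x ?lo)"
    using ev w by (intro finite_measure_Diff) (auto simp: algebra_simps)
  also have "\<dots> \<le> \<kappa> * v ?lo" using j(2) by (simp add: v_def algebra_simps add_divide_distrib)
  also have "\<dots> \<le> \<kappa> * v R"
    unfolding v_def using \<kappa> R(1) r ev by (intro mult_left_mono add_right_mono finite_measure_mono) auto
  finally have "measure M (A \<inter> {y. \<bar>dist x y - R\<bar> < r}) \<le> \<kappa> * (measure M (A \<inter> ball x R) + 1 / N)"
    by (simp add: v_def)
  moreover have "?lo + r > a" using w r by (simp add: add_nonneg_pos)
  then have "a < R" using R(1) by auto
  moreover have "?hi - r \<le> a + J * w"
  proof -
    have "(real j + 1) * w \<le> real J * w" using j(1) w by (intro mult_right_mono) auto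
    then show ?thesis using r(1) by (simp add: add.assoc)
  qed
  then have "R < a + J * w" using R(1) by auto
  ultimately show ?thesis using R(2) by blast
qed

definition first_ball :: "(nat \<Rightarrow> 'x::metric_space) \<Rightarrow> (nat \<Rightarrow> real) \<Rightarrow> 'x \<Rightarrow> nat" where
  "first_ball c R x = (LEAST i. x \<in> ball (c i) (R i))"

lemma first_ball_eq:
  assumes "\<And>x. \<exists>i<N. x \<in> ball (c i) (R i)"
  shows "first_ball c R x < N" "x \<in> ball (c (first_ball c R x)) (R (first_ball c R x))"
    "first_ball c R -` {i} = ball (c i) (R i) - (\<Union>j<i. ball (c j) (R j))"
proof -
  obtain k where k: "k < N" "x \<in> ball (c k) (R k)" using assms by blast
  show "first_ball c R x < N" using Least_le[of "\<lambda>i. x \<in> ball (c i) (R i)", OF k(2)] k(1) by (simp add: first_ball_def)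
  have L: "x \<in> ball (c (first_ball c R x)) (R (first_ball c R x))" for x
  proof -
    obtain k where "x \<in> ball (c k) (R k)" using assms by blast
    then show ?thesis unfolding first_ball_def by (rule LeastI)
  qed
  then show "x \<in> ball (c (first_ball c R x)) (R (first_ball c R x))" .
  show "first_ball c R -` {i} = ball (c i) (R i) - (\<Union>j<i. ball (c j) (R j))"
  proof (intro equalityI subsetI)
    fix y assume "y \<in> first_ball c R -` {i}"
    then have y: "first_ball c R y = i" by simp
    have "y \<notin> ball (c j) (R j)" if "j < i" for j
      using not_less_Least[of j "\<lambda>i. y \<in> ball (c i) (R i)"] that y by (simp add: first_ball_def)
    then show "y \<in> ball (c i) (R i) - (\<Union>j<i. ball (c j) (R j))" using L[of y] y by auto
  next
    fix y assume y: "y \<in> ball (c i) (R i) - (\<Union>j<i. ball (c j) (R j))"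
    then have "first_ball c R y \<le> i" unfolding first_ball_def by (intro Least_le) auto
    moreover have "\<not> first_ball c R y < i" using y L[of y] by auto
    ultimately show "y \<in> first_ball c R -` {i}" by simp
  qed
qed

text \<open>Balls are carved out in order, the i-th radius being chosen for the rest
  \<open>A i R\<close> left by the earlier ones. A point with a differently labelled point within r
  lies in the r-collar of the ball with the smaller label. Inside the rest, that collar has mass at
  most \<kappa> (\<mu> (cell i) + 1 / N), and summation over N cells gives \<kappa> (1 + 1).\<close>

theorem padded_partition:
  fixes c :: "nat \<Rightarrow> 'x::metric_space" and M :: "'x measure" and N J :: nat and a w r \<kappa> :: real
  assumes M: "prob_space M" "sets M = sets borel"
    and cov: "\<And>x. \<exists>i<N. dist (c i) x \<le> a"
    and \<kappa>: "real (N + 1) \<le> (1 + \<kappa>) ^ J" "\<kappa> \<ge> 0" and r: "0 < r" "2 * r < w"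
  obtains R where "\<And>i. a < R i" "\<And>i. R i < a + J * w"
    "\<And>i. measure M {y. dist (c i) y = R i} = 0"
    "measure M {x. \<exists>y. dist x y < r \<and> first_ball c R y \<noteq> first_ball c R x} \<le> 2 * \<kappa>"
    "{x. \<exists>y. dist x y < r \<and> first_ball c R y \<noteq> first_ball c R x} \<in> sets borel"
proof -
  interpret prob_space M by fact
  have N: "N > 0" using cov[of undefined] by auto
  define A where "A i R = UNIV - (\<Union>j<i. ball (c j) (R j))" for i and R :: "nat \<Rightarrow> real"
  define good where "good i R s \<longleftrightarrow> a < s \<and> s < a + J * w \<and> measure M {y. dist (c i) y = s} = 0 \<and>
    measure M (A i R \<inter> {y. \<bar>dist (c i) y - s\<bar> < r}) \<le> \<kappa> * (measure M (A i R \<inter> ball (c i) s) + 1 / N)" for i R s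
  have ex: "\<exists>s. good i R s" for i R
    unfolding good_def by (rule exists_good_radius[OF M _ N \<kappa> r]) (auto simp: A_def)
  have Acong: "A i R = A i R'" if "\<And>j. j < i \<Longrightarrow> R j = R' j" for i R R'
    using that by (auto simp: A_def)
  have "\<exists>R. \<forall>i. good i R (R i)"
  proof -
    \<comment> \<open>Being good at i depends only on the radii below i, so the recursively built
      functions settle at every index and their diagonal is good throughout.\<close>
    define R where "R = rec_nat (\<lambda>_. 0 :: real) (\<lambda>n R. R(n := (SOME s. good n R s)))"
    have R_Suc: "R (Suc n) = (R n)(n := (SOME s. good n (R n) s))" for n unfolding R_def by simp
    have stable: "R m i = R (Suc i) i" if "Suc i \<le> m" for m i
      using that
    proof (induction m rule: dec_induct)
      case (step m)
      then show ?case unfolding R_Suc[of m] by simp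
    qed simp
    let ?R = "\<lambda>i. R (Suc i) i"
    have "good i ?R (?R i)" for i
    proof -
      have "A i ?R = A i (R i)" by (intro Acong stable[symmetric]) simp
      moreover have "good i (R i) (?R i)" unfolding R_Suc[of i] using someI_ex[OF ex[of i "R i"]] by simp
      ultimately show ?thesis by (simp add: good_def)
    qed
    then show ?thesis by blast
  qed
  then obtain R where R: "\<And>i. good i R (R i)" by blast
  let ?l = "first_ball c R"
  have cov': "\<exists>i<N. x \<in> ball (c i) (R i)" for x
  proof -
    obtain i where "i < N" "dist (c i) x \<le> a" using cov by blast
    moreover have "a < R i" using R by (simp add: good_def)
    ultimately show ?thesis by (intro exI[of _ i]) simp
  qed
  note l = first_ball_eq[where c = c and R = R, OF cov']
  have cell: "A i R \<inter> ball (c i) (R i) = ?l -` {i}" for i unfolding l(3) A_def by blast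
  define B where "B = {x. \<exists>y. dist x y < r \<and> ?l y \<noteq> ?l x}"
  have B_sub: "B \<subseteq> (\<Union>i<N. A i R \<inter> {y. \<bar>dist (c i) y - R i\<bar> < r})"
  proof
    fix x assume "x \<in> B"
    then obtain y where y: "dist x y < r" "?l y \<noteq> ?l x" by (auto simp: B_def)
    \<comment> \<open>Both points avoid the balls before the smaller label i and exactly one lies in
      ball i, so its sphere passes between them and |dist (c i) x - R i| is below r.\<close>
    define i where "i = min (?l x) (?l y)"
    have i: "i < N" using l(1)[of x] by (simp add: i_def min_less_iff_disj)
    have out: "z \<notin> ball (c j) (R j)" if "j < ?l z" for z j
    proof -
      have "z \<in> ?l -` {?l z}" by simp
      then show ?thesis unfolding l(3) using that by auto
    qed
    have xA: "x \<in> A i R" using out[of _ x] by (auto simp: A_def i_def)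
    have "\<bar>dist (c i) x - R i\<bar> < r"
    proof (cases "?l x < ?l y")
      case True
      then have "dist (c i) x < R i" "R i \<le> dist (c i) y"
        using l(2)[of x] out[of i y] by (auto simp: i_def)
      then show ?thesis using dist_triangle[of "c i" y x] y(1) by (simp add: abs_less_iff)
    next
      case False
      then have "dist (c i) y < R i" "R i \<le> dist (c i) x"
        using l(2)[of y] out[of i x] y(2) by (auto simp: i_def)
      then show ?thesis using dist_triangle[of "c i" x y] y(1) by (simp add: abs_less_iff dist_commute)
    qed
    then show "x \<in> (\<Union>i<N. A i R \<inter> {y. \<bar>dist (c i) y - R i\<bar> < r})" using i xA by blast
  qed
  have cell_sets: "?l -` {i} \<in> sets borel" for i unfolding l(3) by auto
  have A_sets: "A i R \<in> sets borel" for i by (auto simp: A_def)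
  have AD: "A i R \<inter> {y. \<bar>dist (c i) y - R i\<bar> < r} \<in> sets borel" for i
    by (intro sets.Int A_sets borel_dist_sets(2))
  have "measure M B \<le> measure M (\<Union>i<N. A i R \<inter> {y. \<bar>dist (c i) y - R i\<bar> < r})"
    using AD M(2) by (intro finite_measure_mono B_sub) auto
  also have "\<dots> \<le> (\<Sum>i<N. measure M (A i R \<inter> {y. \<bar>dist (c i) y - R i\<bar> < r}))"
    using AD M(2) by (intro finite_measure_subadditive_finite) auto
  also have "\<dots> \<le> (\<Sum>i<N. \<kappa> * (measure M (?l -` {i}) + 1 / N))"
    using R by (intro sum_mono) (simp add: good_def cell)
  also have "\<dots> = \<kappa> * ((\<Sum>i<N. measure M (?l -` {i})) + 1)"
    using N by (simp add: sum.distrib flip: sum_distrib_left)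
  also have "(\<Sum>i<N. measure M (?l -` {i})) = measure M (\<Union>i<N. ?l -` {i})"
    using cell_sets M(2) by (intro finite_measure_finite_Union[symmetric]) (auto simp: disjoint_family_on_def)
  also have "\<dots> \<le> 1" by simp
  finally have "measure M B \<le> \<kappa> * (1 + 1)" using \<kappa>(2) by (simp add: mult_left_mono)
  moreover have "B \<in> sets borel"
  proof -
    have "B = (\<Union>i<N. ?l -` {i} \<inter> {x. \<exists>y\<in>- (?l -` {i}). dist y x < r})"
      using l(1) by (auto simp: B_def dist_commute)
    also have "\<dots> = (\<Union>i<N. ?l -` {i} \<inter> (\<Union>y\<in>- (?l -` {i}). ball y r))" by (auto simp: ball_def)
    also have "\<dots> \<in> sets borel"
    proof (intro sets.finite_UN)
      have "(\<Union>y\<in>- (?l -` {i}). ball y r) \<in> sets borel" for i by (intro borel_open open_UN) auto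
      then show "?l -` {i} \<inter> (\<Union>y\<in>- (?l -` {i}). ball y r) \<in> sets borel" for i
        by (intro sets.Int cell_sets)
    qed auto
    finally show ?thesis .
  qed
  ultimately show thesis
    using R that[of R] by (simp add: B_def good_def)
qed

section \<open>The lower bound\<close>

text \<open>Gibbs' inequality for kernels: in I = H(X) - H(X|Y) the conditional entropy is at most
  the expectation of - ln q for any subprobability kernel q from cells of Y to cells of X. It
  follows termwise from ln x \<le> x - 1 at x = s q / r, with s the mass of the Y-cell and r the
  joint mass.\<close>

lemma (in prob_space) partition_info_ge:
  assumes X: "X \<in> measurable M A" and Y: "Y \<in> measurable M B"
    and P: "\<P> \<in> finite_partitions A" and Q: "\<Q> \<in> finite_partitions B"
    and q: "\<And>P Q. 0 < q P Q" "\<And>Q. Q \<in> \<Q> \<Longrightarrow> (\<Sum>P\<in>\<P>. q P Q) \<le> 1"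
  shows "(\<Sum>P\<in>\<P>. entropy_term (prob {\<omega>\<in>space M. X \<omega> \<in> P}))
      + (\<Sum>P\<in>\<P>. \<Sum>Q\<in>\<Q>. prob {\<omega>\<in>space M. X \<omega> \<in> P \<and> Y \<omega> \<in> Q} * ln (q P Q))
    \<le> partition_info M X Y \<P> \<Q>"
proof -
  define p where "p = (\<lambda>P. prob {\<omega>\<in>space M. X \<omega> \<in> P})"
  define s where "s = (\<lambda>Q. prob {\<omega>\<in>space M. Y \<omega> \<in> Q})"
  define r where "r = (\<lambda>P Q. prob {\<omega>\<in>space M. X \<omega> \<in> P \<and> Y \<omega> \<in> Q})"
  note J = joint_probs[OF X Y P Q p_def s_def r_def]
  have nn: "r P Q \<ge> 0" "s Q \<ge> 0" for P Q by (auto simp: r_def s_def)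
  have "(\<Sum>P\<in>\<P>. \<Sum>Q\<in>\<Q>. r P Q - s Q * q P Q + r P Q * ln (q P Q) + r P Q * (- ln (p P)))
      \<le> (\<Sum>P\<in>\<P>. \<Sum>Q\<in>\<Q>. r P Q * ln (r P Q / (p P * s Q)))"
  proof (intro sum_mono)
    fix P Q assume PQ: "P \<in> \<P>" "Q \<in> \<Q>"
    show "r P Q - s Q * q P Q + r P Q * ln (q P Q) + r P Q * (- ln (p P)) \<le> r P Q * ln (r P Q / (p P * s Q))"
    proof (cases "r P Q = 0")
      case True
      then show ?thesis using nn(2)[of Q] q(1)[of P Q] by simp
    next
      case False
      then have pos: "r P Q > 0" "p P > 0" "s Q > 0" using nn(1)[of P Q] J(5)[OF PQ] J(6)[OF PQ] by linarith+
      have "r P Q * ln (s Q * q P Q / r P Q) \<le> r P Q * (s Q * q P Q / r P Q - 1)"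
        using pos q(1)[of P Q] by (intro mult_left_mono ln_le_minus_one) auto
      then have *: "r P Q * ln (s Q * q P Q / r P Q) \<le> s Q * q P Q - r P Q"
        using pos by (simp add: right_diff_distrib)
      have eq: "ln (s Q * q P Q / r P Q) = ln (s Q) + ln (q P Q) - ln (r P Q)"
        "ln (r P Q / (p P * s Q)) = ln (r P Q) - ln (p P) - ln (s Q)"
        using pos q(1)[of P Q] by (simp_all add: ln_div ln_mult_pos)
      show ?thesis using *[unfolded eq] unfolding eq by (simp add: algebra_simps)
    qed
  qed
  also have "\<dots> = partition_info M X Y \<P> \<Q>"
    by (simp add: partition_info_def p_def s_def r_def)
  finally have main: "(\<Sum>P\<in>\<P>. \<Sum>Q\<in>\<Q>. r P Q) - (\<Sum>P\<in>\<P>. \<Sum>Q\<in>\<Q>. s Q * q P Q)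
      + (\<Sum>P\<in>\<P>. \<Sum>Q\<in>\<Q>. r P Q * ln (q P Q)) + (\<Sum>P\<in>\<P>. \<Sum>Q\<in>\<Q>. r P Q * (- ln (p P)))
      \<le> partition_info M X Y \<P> \<Q>"
    by (simp only: sum.distrib sum_subtractf)
  have "(\<Sum>P\<in>\<P>. \<Sum>Q\<in>\<Q>. r P Q) = 1" using J(1,3) by simp
  moreover have "(\<Sum>P\<in>\<P>. \<Sum>Q\<in>\<Q>. s Q * q P Q) \<le> 1"
  proof -
    have "(\<Sum>P\<in>\<P>. \<Sum>Q\<in>\<Q>. s Q * q P Q) = (\<Sum>Q\<in>\<Q>. s Q * (\<Sum>P\<in>\<P>. q P Q))"
      by (subst sum.swap) (simp add: sum_distrib_left)
    also have "\<dots> \<le> (\<Sum>Q\<in>\<Q>. s Q * 1)" using nn q(2) by (intro sum_mono mult_left_mono) auto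
    finally show ?thesis using J(4) by simp
  qed
  moreover have "(\<Sum>P\<in>\<P>. \<Sum>Q\<in>\<Q>. r P Q * (- ln (p P))) = (\<Sum>P\<in>\<P>. entropy_term (p P))"
  proof (rule sum.cong[OF refl])
    fix P assume "P \<in> \<P>"
    have "(\<Sum>Q\<in>\<Q>. r P Q * (- ln (p P))) = (\<Sum>Q\<in>\<Q>. r P Q) * (- ln (p P))" by (rule sum_distrib_right[symmetric])
    then show "(\<Sum>Q\<in>\<Q>. r P Q * (- ln (p P))) = entropy_term (p P)"
      using J(1)[OF \<open>P \<in> \<P>\<close>] by (simp add: entropy_term_def)
  qed
  ultimately show ?thesis using main by (simp add: p_def r_def)
qed

section \<open>Partitions into level sets and the reference kernel\<close>

text \<open>Unrealized labels are dropped because the cells of \<open>partition_on\<close> are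
  nonempty.\<close>

definition level_partition :: "'a measure \<Rightarrow> ('a \<Rightarrow> 'u) \<Rightarrow> 'u set \<Rightarrow> 'a set set" where
  "level_partition A L U = (\<lambda>u. {x\<in>space A. L x = u}) ` U - {{}}"

definition level_label :: "('a \<Rightarrow> 'u) \<Rightarrow> 'a set \<Rightarrow> 'u" where
  "level_label L P = L (SOME x. x \<in> P)"

lemma level_label_eq:
  assumes "P \<in> level_partition A L U" "x \<in> P"
  shows "level_label L P = L x"
proof -
  have "(SOME x. x \<in> P) \<in> P" using assms(2) by (rule someI)
  then show ?thesis using assms by (auto simp: level_partition_def level_label_def)
qed

lemma level_partition_finite_partitions:
  assumes "finite U" "\<And>x. x \<in> space A \<Longrightarrow> L x \<in> U" "\<And>u. u \<in> U \<Longrightarrow> {x\<in>space A. L x = u} \<in> sets A"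
  shows "level_partition A L U \<in> finite_partitions A"
  using assms unfolding finite_partitions_def level_partition_def partition_on_def disjoint_def by auto

lemma inj_on_level_label: "inj_on (level_label L) (level_partition A L U)"
proof (rule inj_onI)
  have rep: "P = {x\<in>space A. L x = level_label L P}" if P: "P \<in> level_partition A L U" for P
  proof -
    obtain x where x: "x \<in> P" using P by (auto simp: level_partition_def)
    then show ?thesis using P level_label_eq[OF P x] by (auto simp: level_partition_def)
  qed
  fix P P' assume "P \<in> level_partition A L U" "P' \<in> level_partition A L U" "level_label L P = level_label L P'"
  then show "P = P'" using rep by metis
qed

lemma level_label_in:
  assumes P: "P \<in> level_partition A L U"
  shows "level_label L P \<in> U"
proof -
  obtain x where x: "x \<in> P" using P by (auto simp: level_partition_def)
  then show ?thesis using P level_label_eq[OF P x] by (auto simp: level_partition_def)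
qed

lemma sum_level_partition:
  fixes h :: "'a set \<Rightarrow> real"
  assumes "finite U" "h {} = 0"
  shows "(\<Sum>P\<in>level_partition A L U. h P) = (\<Sum>u\<in>U. h {x\<in>space A. L x = u})"
proof -
  have "(\<Sum>P\<in>level_partition A L U. h P) = sum h ((\<lambda>u. {x\<in>space A. L x = u}) ` U)"
    unfolding level_partition_def using assms by (intro sum.mono_neutral_left) auto
  also have "\<dots> = (\<Sum>u\<in>U. h {x\<in>space A. L x = u})"
  proof (subst sum.reindex_nontrivial)
    fix u v assume "u \<noteq> v" "{x\<in>space A. L x = u} = {x\<in>space A. L x = v}"
    then have "{x\<in>space A. L x = u} = {}" by blast
    then show "h {x\<in>space A. L x = u} = 0" by (simp only: assms(2))
  qed (use assms in auto)
  finally show ?thesis .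
qed

text \<open>A guess of the label of \<^term>\<open>X\<close> from that of \<^term>\<open>Y\<close> which is right with probability \<open>1/2\<close>
  in each coordinate; as reference kernel it replaces Fano's inequality.\<close>

definition guess :: "nat \<Rightarrow> 'g set \<Rightarrow> ('g \<Rightarrow> nat) \<Rightarrow> ('g \<Rightarrow> nat) \<Rightarrow> real" where
  "guess k T u v = (\<Prod>g\<in>T. if u g = v g then 1 / 2 else 1 / (2 * real k))"

lemma guess_pos: "k > 0 \<Longrightarrow> 0 < guess k T u v"
  unfolding guess_def by (intro prod_pos) auto

text \<open>The sum factorizes over T. In one coordinate the matching label gives at most 1 / 2, and
  1 / (2 k) for each of the k labels adds at most another 1 / 2.\<close>

lemma sum_guess_le_1:
  assumes "finite T" "k > 0"
  shows "(\<Sum>u\<in>T \<rightarrow>\<^sub>E {..<k}. guess k T u v) \<le> 1"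
proof -
  have "(\<Sum>a<k. if a = b then 1 / 2 else 1 / (2 * real k)) \<le> 1" for b
  proof -
    have "(\<Sum>a<k. if a = b then 1 / 2 else 1 / (2 * real k)) \<le> (\<Sum>a<k. (if a = b then 1 / 2 else 0) + 1 / (2 * real k))"
      by (intro sum_mono) auto
    also have "\<dots> = (if b < k then 1 / 2 else 0) + 1 / 2"
      using assms by (simp add: sum.distrib)
    finally show ?thesis by (auto split: if_splits)
  qed
  then have "(\<Prod>g\<in>T. \<Sum>a<k. if a = v g then 1 / 2 else 1 / (2 * real k)) \<le> 1"
    by (intro prod_le_1 conjI sum_nonneg) auto
  moreover have "(\<Prod>g\<in>T. \<Sum>a<k. if a = v g then 1 / 2 else 1 / (2 * real k)) = (\<Sum>u\<in>T \<rightarrow>\<^sub>E {..<k}. guess k T u v)"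
    unfolding guess_def using assms by (intro prod_sum_PiE) auto
  ultimately show ?thesis by simp
qed

lemma ln_guess:
  assumes "finite T" "k > 0"
  shows "ln (guess k T u v) = - (card T * ln 2) - ln (real k) * (\<Sum>g\<in>T. if u g = v g then 0 else 1)"
proof -
  have "ln (guess k T u v) = (\<Sum>g\<in>T. ln (if u g = v g then 1 / 2 else 1 / (2 * real k)))"
    unfolding guess_def using assms by (intro ln_prod) auto
  also have "\<dots> = (\<Sum>g\<in>T. - ln 2 - ln (real k) * (if u g = v g then 0 else 1))"
    using assms by (intro sum.cong refl) (auto simp: ln_div ln_mult_pos)
  finally show ?thesis by (simp add: sum_subtractf sum_distrib_left)
qed

context compact_system
begin

text \<open>\<open>partition_info_ge\<close> with the kernel \<open>guess\<close>, for the
  partitions by the T-names of X and of Y. Every coordinate costs ln 2, and a wrong one costs ln k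
  in addition, so the information loss is governed by the expected number of mismatches.\<close>

lemma family_info_ge:
  fixes l :: "'x \<Rightarrow> nat" and M :: "'w measure"
  assumes M: "prob_space M" and X: "X \<in> borel_measurable M" and Y: "\<And>g. g \<in> T \<Longrightarrow> Y g \<in> borel_measurable M"
    and T: "T \<subseteq> carrier G" "finite T" and l: "l \<in> measurable borel (count_space UNIV)" "\<And>x. l x < k"
  shows "ereal ((\<Sum>u\<in>T \<rightarrow>\<^sub>E {..<k}. entropy_term (measure (distr M borel X) (cylinder l T u))) - card T * ln 2
      - ln (real k) * (\<Sum>g\<in>T. measure M {\<omega>\<in>space M. l (\<phi> g (X \<omega>)) \<noteq> l (Y g \<omega>)}))
    \<le> family_info T M X Y"
proof -
  interpret prob_space M by fact
  let ?U = "T \<rightarrow>\<^sub>E {..<k}" and ?Y = "\<lambda>\<omega>. \<lambda>g\<in>T. Y g \<omega>" and ?B = "Pi\<^sub>M T (\<lambda>_. borel :: 'x measure)"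
  have k: "k > 0" using l(2)[of undefined] by simp
  have fU: "finite ?U" using T by (intro finite_PiE) auto
  define LX where "LX x = (\<lambda>t\<in>T. l (\<phi> t x))" for x
  define LY where "LY y = (\<lambda>g\<in>T. l (y g))" for y
  have Y': "?Y \<in> measurable M ?B" by (rule measurable_restrict) (rule Y)
  have cyl: "{x\<in>space borel. LX x = u} = cylinder l T u" if "u \<in> ?U" for u
    using that by (auto simp: LX_def cylinder_def fun_eq_iff PiE_def extensional_def)
  have lphi: "(\<lambda>x. l (\<phi> t x)) \<in> measurable borel (count_space UNIV)" if "t \<in> T" for t
    using measurable_compose[OF act_measurable l(1)] that T by auto
  have LXs: "{x\<in>space borel. LX x = u} \<in> sets borel" if u: "u \<in> ?U" for u
  proof -
    have "{x\<in>space borel. LX x = u} = {x\<in>space borel. \<forall>t\<in>T. l (\<phi> t x) = u t}"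
      using cyl[OF u] by (simp add: cylinder_def)
    also have "\<dots> \<in> sets borel"
      using T lphi measurable_sets[OF lphi, of _ "{u _}"]
      by (intro sets.sets_Collect_finite_All) (auto simp: vimage_def)
    finally show ?thesis .
  qed
  have LYs: "{y\<in>space ?B. LY y = u} \<in> sets ?B" if u: "u \<in> ?U" for u
  proof -
    have "{y\<in>space ?B. LY y = u} = {y\<in>space ?B. \<forall>t\<in>T. l (y t) = u t}"
      using u by (auto simp: LY_def fun_eq_iff PiE_def extensional_def)
    also have "\<dots> \<in> sets ?B"
    proof (rule sets.sets_Collect_finite_All[OF _ T(2)])
      fix t assume t: "t \<in> T"
      have "(\<lambda>y. l (y t)) \<in> measurable ?B (count_space UNIV)"
        by (rule measurable_compose[OF measurable_component_singleton[OF t] l(1)])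
      from measurable_sets[OF this, of "{u t}"] show "{y\<in>space ?B. l (y t) = u t} \<in> sets ?B"
        by (simp add: vimage_def Int_def conj_commute)
    qed
    finally show ?thesis .
  qed
  let ?P = "level_partition borel LX ?U" and ?Q = "level_partition ?B LY ?U"
  have P: "?P \<in> finite_partitions borel"
    using fU LXs l(2) by (intro level_partition_finite_partitions) (auto simp: LX_def)
  have Q: "?Q \<in> finite_partitions ?B"
    using fU LYs l(2) by (intro level_partition_finite_partitions) (auto simp: LY_def)
  define lX where "lX = level_label LX" define lY where "lY = level_label LY"
  let ?q = "\<lambda>P Q. guess k T (lX P) (lY Q)"
  have q1: "(\<Sum>P\<in>?P. ?q P Q) \<le> 1" for Q
  proof -
    have "(\<Sum>P\<in>?P. ?q P Q) = (\<Sum>u\<in>lX ` ?P. guess k T u (lY Q))"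
      unfolding lX_def by (simp add: sum.reindex[OF inj_on_level_label])
    also have "\<dots> \<le> (\<Sum>u\<in>?U. guess k T u (lY Q))"
    proof (rule sum_mono2[OF fU])
      show "lX ` ?P \<subseteq> ?U" unfolding lX_def by (rule image_subsetI) (rule level_label_in)
    qed (use k in \<open>simp add: less_imp_le guess_pos\<close>)
    also have "\<dots> \<le> 1" by (rule sum_guess_le_1[OF T(2) k])
    finally show ?thesis .
  qed
  define r where "r P Q = prob {\<omega>\<in>space M. X \<omega> \<in> P \<and> ?Y \<omega> \<in> Q}" for P Q
  have "(\<Sum>P\<in>?P. entropy_term (prob {\<omega>\<in>space M. X \<omega> \<in> P})) + (\<Sum>P\<in>?P. \<Sum>Q\<in>?Q. r P Q * ln (?q P Q))
      \<le> partition_info M X ?Y ?P ?Q"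
    unfolding r_def by (rule partition_info_ge[OF X Y' P Q]) (use guess_pos k q1 in auto)
  moreover have "ereal (partition_info M X ?Y ?P ?Q) \<le> family_info T M X Y"
    unfolding family_info_def mutual_info_def using P Q by (intro SUP_upper2[of "(?P, ?Q)"]) auto
  moreover have "(\<Sum>P\<in>?P. entropy_term (prob {\<omega>\<in>space M. X \<omega> \<in> P}))
      = (\<Sum>u\<in>?U. entropy_term (measure (distr M borel X) (cylinder l T u)))"
  proof -
    have "(\<Sum>P\<in>?P. entropy_term (prob {\<omega>\<in>space M. X \<omega> \<in> P}))
        = (\<Sum>u\<in>?U. entropy_term (prob {\<omega>\<in>space M. X \<omega> \<in> {x\<in>space borel. LX x = u}}))"
      using fU by (rule sum_level_partition) simp
    also have "\<dots> = (\<Sum>u\<in>?U. entropy_term (measure (distr M borel X) (cylinder l T u)))"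
    proof (rule sum.cong[OF refl])
      fix u assume u: "u \<in> ?U"
      have "measure (distr M borel X) (cylinder l T u) = prob (X -` cylinder l T u \<inter> space M)"
        using LXs[OF u] cyl[OF u] by (intro measure_distr X) simp
      then show "entropy_term (prob {\<omega>\<in>space M. X \<omega> \<in> {x\<in>space borel. LX x = u}})
          = entropy_term (measure (distr M borel X) (cylinder l T u))"
        unfolding cyl[OF u] by (simp add: vimage_def Int_def conj_commute)
    qed
    finally show ?thesis .
  qed
  moreover have "- (card T * ln 2) - ln (real k) * (\<Sum>g\<in>T. prob {\<omega>\<in>space M. l (\<phi> g (X \<omega>)) \<noteq> l (Y g \<omega>)})
      \<le> (\<Sum>P\<in>?P. \<Sum>Q\<in>?Q. r P Q * ln (?q P Q))"
  proof -
    have tot: "(\<Sum>P\<in>?P. \<Sum>Q\<in>?Q. r P Q) = 1"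
      using joint_probs(1,3)[OF X Y' P Q refl refl refl] by (simp add: r_def)
    let ?e = "\<lambda>g P Q. if lX P g = lY Q g then 0 else 1 :: real"
    have err: "(\<Sum>P\<in>?P. \<Sum>Q\<in>?Q. r P Q * ?e g P Q) \<le> prob {\<omega>\<in>space M. l (\<phi> g (X \<omega>)) \<noteq> l (Y g \<omega>)}"
      if g: "g \<in> T" for g
    proof -
      let ?E = "{\<omega>\<in>space M. l (\<phi> g (X \<omega>)) \<noteq> l (Y g \<omega>)}"
      have lX_meas: "(\<lambda>\<omega>. l (\<phi> g (X \<omega>))) \<in> measurable M (count_space UNIV)"
        by (rule measurable_compose[OF X lphi[OF g]])
      have lY_meas: "(\<lambda>\<omega>. l (Y g \<omega>)) \<in> measurable M (count_space UNIV)"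
        by (rule measurable_compose[OF Y[OF g] l(1)])
      have E: "?E \<in> events"
      proof -
        have "?E = (\<Union>n. ((\<lambda>\<omega>. l (\<phi> g (X \<omega>))) -` {n} \<inter> space M) \<inter> ((\<lambda>\<omega>. l (Y g \<omega>)) -` (- {n}) \<inter> space M))"
          by auto
        also have "\<dots> \<in> events"
          by (intro sets.countable_UN sets.Int subsetI)
            (use measurable_sets[OF lX_meas] measurable_sets[OF lY_meas] in auto)
        finally show ?thesis .
      qed
      have EP: "{\<omega>\<in>space M. \<omega> \<in> ?E \<and> X \<omega> \<in> P} \<in> events" if "P \<in> ?P" for P
      proof -
        have "{\<omega>\<in>space M. \<omega> \<in> ?E \<and> X \<omega> \<in> P} = ?E \<inter> (X -` P \<inter> space M)" by auto
        moreover have "P \<in> sets borel" using that P by (auto simp: finite_partitions_def)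
        ultimately show ?thesis using E measurable_sets[OF X] by auto
      qed
      have "(\<Sum>P\<in>?P. \<Sum>Q\<in>?Q. r P Q * ?e g P Q)
          \<le> (\<Sum>P\<in>?P. \<Sum>Q\<in>?Q. prob {\<omega>\<in>space M. \<omega> \<in> {\<omega>\<in>space M. \<omega> \<in> ?E \<and> X \<omega> \<in> P} \<and> ?Y \<omega> \<in> Q})"
      proof (intro sum_mono)
        fix P Q assume PQ: "P \<in> ?P" "Q \<in> ?Q"
        show "r P Q * ?e g P Q \<le> prob {\<omega>\<in>space M. \<omega> \<in> {\<omega>\<in>space M. \<omega> \<in> ?E \<and> X \<omega> \<in> P} \<and> ?Y \<omega> \<in> Q}"
        proof (cases "lX P g = lY Q g")
          case False
          have "{\<omega>\<in>space M. X \<omega> \<in> P \<and> ?Y \<omega> \<in> Q}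
              = {\<omega>\<in>space M. \<omega> \<in> {\<omega>\<in>space M. \<omega> \<in> ?E \<and> X \<omega> \<in> P} \<and> ?Y \<omega> \<in> Q}"
          proof -
            have "\<omega> \<in> ?E" if "\<omega> \<in> space M" "X \<omega> \<in> P" "?Y \<omega> \<in> Q" for \<omega>
            proof -
              have "lX P = LX (X \<omega>)" unfolding lX_def by (rule level_label_eq[OF PQ(1) that(2)])
              moreover have "lY Q = LY (?Y \<omega>)" unfolding lY_def by (rule level_label_eq[OF PQ(2) that(3)])
              ultimately show ?thesis using False g that(1) by (simp add: LX_def LY_def)
            qed
            then show ?thesis by blast
          qed
          then show ?thesis using False by (simp add: r_def)
        qed simp
      qed
      also have "\<dots> = (\<Sum>P\<in>?P. prob {\<omega>\<in>space M. \<omega> \<in> ?E \<and> X \<omega> \<in> P})"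
        by (intro sum.cong refl sum_prob_partition[OF Y' Q] EP)
      also have "\<dots> = prob ?E" by (rule sum_prob_partition[OF X P E])
      finally show ?thesis .
    qed
    have "(\<Sum>P\<in>?P. \<Sum>Q\<in>?Q. r P Q * ln (?q P Q))
        = (\<Sum>P\<in>?P. \<Sum>Q\<in>?Q. r P Q * (- (card T * ln 2)) - ln (real k) * (\<Sum>g\<in>T. r P Q * ?e g P Q))"
      unfolding ln_guess[OF T(2) k] by (intro sum.cong refl) (simp add: right_diff_distrib sum_distrib_left mult_ac)
    also have "\<dots> = (\<Sum>P\<in>?P. \<Sum>Q\<in>?Q. r P Q) * (- (card T * ln 2))
        - ln (real k) * (\<Sum>P\<in>?P. \<Sum>Q\<in>?Q. \<Sum>g\<in>T. r P Q * ?e g P Q)"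
      by (simp only: sum_subtractf sum_distrib_left sum_distrib_right)
    also have "(\<Sum>P\<in>?P. \<Sum>Q\<in>?Q. \<Sum>g\<in>T. r P Q * ?e g P Q) = (\<Sum>g\<in>T. \<Sum>P\<in>?P. \<Sum>Q\<in>?Q. r P Q * ?e g P Q)"
      by (subst (2) sum.swap, subst sum.swap) (rule refl)
    finally have "(\<Sum>P\<in>?P. \<Sum>Q\<in>?Q. r P Q * ln (?q P Q))
        = - (card T * ln 2) - ln (real k) * (\<Sum>g\<in>T. \<Sum>P\<in>?P. \<Sum>Q\<in>?Q. r P Q * ?e g P Q)"
      using tot by simp
    moreover have "ln (real k) * (\<Sum>g\<in>T. \<Sum>P\<in>?P. \<Sum>Q\<in>?Q. r P Q * ?e g P Q)
        \<le> ln (real k) * (\<Sum>g\<in>T. prob {\<omega>\<in>space M. l (\<phi> g (X \<omega>)) \<noteq> l (Y g \<omega>)})"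
      using k err by (intro mult_left_mono sum_mono) auto
    ultimately show ?thesis by linarith
  qed
  ultimately show ?thesis
    by (smt (verit) ereal_less_eq(3) order_trans)
qed

text \<open>Markov's inequality for the p-th powers in each coordinate; \<open>lp_close\<close>
  controls only their sum.\<close>

lemma sum_prob_far_le:
  assumes adm: "admissible \<phi> \<mu> p e T M X Y" and T: "T \<subseteq> carrier G" "finite T" "T \<noteq> {}"
    and p: "p > 0" and r: "r > 0"
  shows "(\<Sum>g\<in>T. measure M {\<omega>\<in>space M. r \<le> dist (\<phi> g (X \<omega>)) (Y g \<omega>)}) \<le> card T * (e powr p / r powr p)"
proof -
  have M: "prob_space M" and X: "X \<in> borel_measurable M" and Y: "\<And>g. g \<in> T \<Longrightarrow> Y g \<in> borel_measurable M"
    and cl: "(\<integral>\<omega>. 1 / real (card T) * (\<Sum>g\<in>T. dist (\<phi> g (X \<omega>)) (Y g \<omega>) powr p) \<partial>M) < e powr p"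
    using adm by (auto simp: admissible_def lp_close_def)
  interpret prob_space M by fact
  let ?d = "\<lambda>g \<omega>. dist (\<phi> g (X \<omega>)) (Y g \<omega>)"
  have cT: "real (card T) > 0" using T by (simp add: card_gt_0_iff)
  have d: "?d g \<in> borel_measurable M" if "g \<in> T" for g
    using measurable_compose[OF X act_measurable] Y that T by (intro borel_measurable_dist_compact compact_UNIV) auto
  obtain B where B: "B > 0" "\<And>x y :: 'x. dist x y \<le> B" using dist_bounded by blast
  have int: "integrable M (\<lambda>\<omega>. ?d g \<omega> powr p)" if "g \<in> T" for g
  proof (rule integrable_const_bound[of _ "B powr p"])
    show "AE \<omega> in M. norm (?d g \<omega> powr p) \<le> B powr p"
      using B p by (intro AE_I2) (auto intro!: powr_mono2)
    show "(\<lambda>\<omega>. ?d g \<omega> powr p) \<in> borel_measurable M" using d[OF that] by measurable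
  qed
  have "(\<Sum>g\<in>T. prob {\<omega>\<in>space M. r \<le> ?d g \<omega>}) \<le> (\<Sum>g\<in>T. (\<integral>\<omega>. ?d g \<omega> powr p \<partial>M) / r powr p)"
  proof (rule sum_mono)
    fix g assume g: "g \<in> T"
    have "{\<omega>\<in>space M. r \<le> ?d g \<omega>} \<subseteq> {\<omega>\<in>space M. r powr p \<le> ?d g \<omega> powr p}"
      using r p by (auto intro!: powr_mono2)
    moreover have "{\<omega>\<in>space M. r powr p \<le> ?d g \<omega> powr p} \<in> events" using d[OF g] by measurable
    ultimately have "prob {\<omega>\<in>space M. r \<le> ?d g \<omega>} \<le> prob {\<omega>\<in>space M. r powr p \<le> ?d g \<omega> powr p}"
      by (rule finite_measure_mono)
    also have "\<dots> \<le> (\<integral>\<omega>. ?d g \<omega> powr p \<partial>M) / r powr p"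
      using int[OF g] r by (intro integral_Markov_inequality_measure[where A = "{}"]) auto
    finally show "prob {\<omega>\<in>space M. r \<le> ?d g \<omega>} \<le> (\<integral>\<omega>. ?d g \<omega> powr p \<partial>M) / r powr p" .
  qed
  also have "\<dots> = (\<integral>\<omega>. (\<Sum>g\<in>T. ?d g \<omega> powr p) \<partial>M) / r powr p"
    using int by (simp add: Bochner_Integration.integral_sum sum_divide_distrib)
  also have "\<dots> \<le> card T * (e powr p / r powr p)"
  proof -
    have "(\<integral>\<omega>. (\<Sum>g\<in>T. ?d g \<omega> powr p) \<partial>M) / card T \<le> e powr p" using cl by simp
    then have "(\<integral>\<omega>. (\<Sum>g\<in>T. ?d g \<omega> powr p) \<partial>M) \<le> card T * e powr p" using cT by (simp add: divide_le_eq mult.commute)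
    then show ?thesis using r by (simp add: divide_right_mono)
  qed
  finally show ?thesis .
qed

text \<open>The measure and the partition are fixed before T, p and e. A mismatch of labels at g
  means that Y g is at distance at least r from g X, or that the r-ball about g X meets a second
  cell; Markov bounds the first event, padding and invariance of \<mu> the second. Radii below a + J
  w \<le> \<epsilon> / 2 make points of a common cell closer than \<epsilon>.\<close>

theorem rate_distortion_lower_bound:
  fixes c :: "nat \<Rightarrow> 'x" and N J :: nat and a w r \<kappa> \<epsilon> :: real
  assumes F: "folner_sequence G F" and \<epsilon>: "\<epsilon> > 0"
    and cov: "\<And>x. \<exists>i<N. dist (c i) x \<le> a" and aw: "a + J * w \<le> \<epsilon> / 2"
    and \<kappa>: "real (N + 1) \<le> (1 + \<kappa>) ^ J" "\<kappa> \<ge> 0" and r: "0 < r" "2 * r < w"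
  obtains \<mu> where "\<mu> \<in> invariant_measures G \<phi>"
    "\<And>T p e. T \<subseteq> carrier G \<Longrightarrow> finite T \<Longrightarrow> T \<noteq> {} \<Longrightarrow> p > 0 \<Longrightarrow> e > 0 \<Longrightarrow>
      ereal (card T * (cover_entropy G \<phi> (4 * \<epsilon>) - ln 2 - ln (real N) * (e powr p / r powr p + 2 * \<kappa>)))
        \<le> rate_distortion \<phi> \<mu> p e T"
proof -
  obtain \<nu> :: "'x set \<Rightarrow> real" where \<nu>: "finitely_additive_prob \<nu>"
    and inv\<nu>: "\<And>g A. g \<in> carrier G \<Longrightarrow> \<nu> (\<phi> g -` A) = \<nu> A"
    and H\<nu>: "\<And>T l k. T \<subseteq> carrier G \<Longrightarrow> finite T \<Longrightarrow> (\<And>x. l x < k) \<Longrightarrow> (\<And>x y. l x = l y \<Longrightarrow> dist x y < \<epsilon>) \<Longrightarrow>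
      card T * cover_entropy G \<phi> (4 * \<epsilon>) \<le> (\<Sum>u\<in>T \<rightarrow>\<^sub>E {..<k}. entropy_term (\<nu> (cylinder l T u)))"
    using finitely_additive_limit[OF F \<epsilon>] by blast
  interpret R: finitely_additive_prob \<nu> by fact
  obtain \<mu> where \<mu>s: "sets \<mu> = sets borel" and \<mu>p: "prob_space \<mu>" and \<mu>o: "\<And>U. open U \<Longrightarrow> emeasure \<mu> U = R.inner_content U"
    using R.regularization by blast
  interpret \<mu>: prob_space \<mu> by fact
  have sp: "space \<mu> = UNIV" using sets_eq_imp_space_eq[OF \<mu>s] by simp
  have \<mu>_inv: "distr \<mu> borel (\<phi> g) = \<mu>" if g: "g \<in> carrier G" for g
  proof (rule measure_eqI_open[symmetric])
    have gm: "\<phi> g \<in> measurable \<mu> borel"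
      unfolding measurable_cong_sets[OF \<mu>s refl] by (rule act_measurable[OF g])
    show "sets \<mu> = sets borel" "sets (distr \<mu> borel (\<phi> g)) = sets borel" "finite_measure \<mu>"
      using \<mu>s \<mu>.finite_measure_axioms by auto
    fix U :: "'x set" assume U: "open U"
    have "emeasure (distr \<mu> borel (\<phi> g)) U = emeasure \<mu> (\<phi> g -` U)"
      using U sp by (simp add: emeasure_distr[OF gm])
    also have "\<dots> = R.inner_content (\<phi> g -` U)" by (rule \<mu>o[OF act_open_vimage[OF g U]])
    \<comment> \<open>Preimages under the action preserve closed sets and \<nu>, giving one
      inequality for every h; g and its inverse together give equality.\<close>
    also have "\<dots> = R.inner_content U"
    proof -
      let ?g = "\<phi> (inv g)"
      have i1: "?g (\<phi> g x) = x" and i2: "\<phi> g (?g x) = x" for x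
        using g act_one by (simp_all flip: act_mult)
      have le: "R.inner_content V \<le> R.inner_content (\<phi> h -` V)" if "h \<in> carrier G" for h V
        unfolding R.inner_content_def
      proof (rule SUP_mono, clarify)
        fix K assume K: "closed K" "K \<subseteq> V"
        then show "\<exists>K'\<in>{K. closed K \<and> K \<subseteq> \<phi> h -` V}. ennreal (\<nu> K) \<le> ennreal (\<nu> K')"
          using inv\<nu>[OF that, of K] act_closed_vimage[OF that K(1)] by (intro bexI[of _ "\<phi> h -` K"]) auto
      qed
      have "?g -` (\<phi> g -` U) = U" using i2 by auto
      then show ?thesis using le[OF g, of U] le[OF inv_closed[OF g], of "\<phi> g -` U"] by (simp add: antisym)
    qed
    finally show "emeasure \<mu> U = emeasure (distr \<mu> borel (\<phi> g)) U" using \<mu>o[OF U] by simp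
  qed
  then have \<mu>inv: "\<mu> \<in> invariant_measures G \<phi>" using \<mu>s \<mu>p by (simp add: invariant_measures_def)
  have \<mu>_vim: "measure \<mu> (\<phi> g -` A) = measure \<mu> A" if g: "g \<in> carrier G" and A: "A \<in> sets borel" for g A
  proof -
    have gm: "\<phi> g \<in> measurable \<mu> borel"
      unfolding measurable_cong_sets[OF \<mu>s refl] by (rule act_measurable[OF g])
    have "measure (distr \<mu> borel (\<phi> g)) A = measure \<mu> (\<phi> g -` A)"
      using A sp by (simp add: measure_distr[OF gm])
    then show ?thesis using \<mu>_inv[OF g] by simp
  qed
  have \<mu>_open: "measure \<mu> U \<le> \<nu> U" if "open U" for U
  proof -
    have "ennreal (measure \<mu> U) \<le> ennreal (\<nu> U)"
      using \<mu>o[OF that] R.inner_le[of U] by (simp add: \<mu>.emeasure_eq_measure)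
    then show ?thesis using ennreal_le_iff[OF R.nonneg] by blast
  qed
  have \<mu>_closed: "\<nu> C \<le> measure \<mu> C" if C: "closed C" for C
  proof -
    have "measure \<mu> (- C) \<le> \<nu> (- C)" using C by (intro \<mu>_open) auto
    moreover have "measure \<mu> (- C) = 1 - measure \<mu> C"
      using \<mu>.prob_compl[of C] C \<mu>s sp by (simp add: Compl_eq_Diff_UNIV)
    ultimately show ?thesis by (simp add: R.compl)
  qed
  \<comment> \<open>Continuity sets, described by witnesses instead of interior and closure so that
    intersections, complements and preimages are immediate. Then \<mu> U \<le> \<nu> U \<le> \<nu> A
    \<le> \<nu> C \<le> \<mu> C, and the ends coincide.\<close>
  define cont where "cont A \<longleftrightarrow> (\<exists>U C. open U \<and> closed C \<and> U \<subseteq> A \<and> A \<subseteq> C \<and> measure \<mu> (C - U) = 0)" for A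
  have cont_eq: "\<nu> A = measure \<mu> A" if "cont A" "A \<in> sets borel" for A
  proof -
    obtain U C where UC: "open U" "closed C" "U \<subseteq> A" "A \<subseteq> C" "measure \<mu> (C - U) = 0"
      using \<open>cont A\<close> by (auto simp: cont_def)
    have s: "U \<in> sets \<mu>" "C \<in> sets \<mu>" "A \<in> sets \<mu>" using UC that(2) \<mu>s by auto
    have "measure \<mu> C = measure \<mu> U" using \<mu>.finite_measure_Diff[OF s(2,1)] UC by auto
    moreover have "measure \<mu> U \<le> measure \<mu> A" "measure \<mu> A \<le> measure \<mu> C"
      using s UC by (auto intro: \<mu>.finite_measure_mono)
    moreover have "measure \<mu> U \<le> \<nu> A" using \<mu>_open[OF UC(1)] R.mono[OF UC(3)] by linarith
    moreover have "\<nu> A \<le> measure \<mu> C" using \<mu>_closed[OF UC(2)] R.mono[OF UC(4)] by linarith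
    ultimately show ?thesis by linarith
  qed
  have null_mono: "measure \<mu> D = 0" if "measure \<mu> D' = 0" "D \<subseteq> D'" "D' \<in> sets borel" for D D'
    using \<mu>.finite_measure_mono[OF that(2)] that \<mu>s measure_nonneg[of \<mu> D] by simp
  have cont_Int: "cont (A \<inter> A')" if "cont A" "cont A'" for A A'
  proof -
    obtain U C where UC: "open U" "closed C" "U \<subseteq> A" "A \<subseteq> C" "measure \<mu> (C - U) = 0"
      using \<open>cont A\<close> by (auto simp: cont_def)
    obtain U' C' where UC': "open U'" "closed C'" "U' \<subseteq> A'" "A' \<subseteq> C'" "measure \<mu> (C' - U') = 0"
      using \<open>cont A'\<close> by (auto simp: cont_def)
    have s: "C - U \<in> sets \<mu>" "C' - U' \<in> sets \<mu>" using UC UC' \<mu>s by auto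
    have "measure \<mu> ((C - U) \<union> (C' - U')) = 0"
      using measure_Un_le[OF s] UC(5) UC'(5) measure_nonneg[of \<mu> "(C - U) \<union> (C' - U')"] by simp
    then have "measure \<mu> (C \<inter> C' - U \<inter> U') = 0"
      by (rule null_mono) (use s \<mu>s in auto)
    then show ?thesis unfolding cont_def using UC UC' by (intro exI[of _ "U \<inter> U'"] exI[of _ "C \<inter> C'"]) auto
  qed
  have cont_Compl: "cont (- A)" if "cont A" for A
  proof -
    obtain U C where UC: "open U" "closed C" "U \<subseteq> A" "A \<subseteq> C" "measure \<mu> (C - U) = 0"
      using \<open>cont A\<close> by (auto simp: cont_def)
    moreover have "- U - - C = C - U" by auto
    ultimately show ?thesis unfolding cont_def by (intro exI[of _ "- C"] exI[of _ "- U"]) auto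
  qed
  have cont_UNIV: "cont UNIV" unfolding cont_def by (intro exI[of _ UNIV]) auto
  have cont_INT: "cont (\<Inter>i\<in>I. A i)" if "finite I" "\<And>i. i \<in> I \<Longrightarrow> cont (A i)" for I :: "nat set" and A
    using that by (induction I rule: finite_induct) (auto intro: cont_UNIV cont_Int)
  have cont_INT': "cont (\<Inter>i\<in>I. A i)" if "finite I" "\<And>i. i \<in> I \<Longrightarrow> cont (A i)" for I :: "'a set" and A
    using that by (induction I rule: finite_induct) (auto intro: cont_UNIV cont_Int)
  have cont_vimage: "cont (\<phi> g -` A)" if "cont A" and g: "g \<in> carrier G" for A g
  proof -
    obtain U C where UC: "open U" "closed C" "U \<subseteq> A" "A \<subseteq> C" "measure \<mu> (C - U) = 0"
      using \<open>cont A\<close> by (auto simp: cont_def)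
    have "measure \<mu> (\<phi> g -` C - \<phi> g -` U) = 0"
      using \<mu>_vim[OF g, of "C - U"] UC by (auto simp: vimage_Diff)
    then show ?thesis unfolding cont_def
      using UC act_open_vimage[OF g] act_closed_vimage[OF g] by (intro exI[of _ "\<phi> g -` U"] exI[of _ "\<phi> g -` C"]) auto
  qed
  \<comment> \<open>The radii are adapted to \<mu>: null spheres make every ball, hence every cell
    and every cylinder, a continuity set, so the entropies under \<nu> and \<mu> agree.\<close>
  obtain \<rho> where \<rho>: "\<And>i. a < \<rho> i" "\<And>i. \<rho> i < a + J * w" "\<And>i. measure \<mu> {y. dist (c i) y = \<rho> i} = 0"
    and pad: "measure \<mu> {x. \<exists>y. dist x y < r \<and> first_ball c \<rho> y \<noteq> first_ball c \<rho> x} \<le> 2 * \<kappa>"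
    and pad_s: "{x. \<exists>y. dist x y < r \<and> first_ball c \<rho> y \<noteq> first_ball c \<rho> x} \<in> sets borel"
    using padded_partition[OF \<mu>p \<mu>s cov \<kappa> r] by blast
  define l where "l = first_ball c \<rho>"
  define bad where "bad = {x. \<exists>y. dist x y < r \<and> l y \<noteq> l x}"
  have bad: "measure \<mu> bad \<le> 2 * \<kappa>" "bad \<in> sets borel" using pad pad_s by (simp_all add: bad_def l_def)
  have cov': "\<exists>i<N. x \<in> ball (c i) (\<rho> i)" for x
  proof -
    obtain i where "i < N" "dist (c i) x \<le> a" using cov by blast
    then show ?thesis using \<rho>(1)[of i] by (intro exI[of _ i]) simp
  qed
  note fb = first_ball_eq[where c = c and R = \<rho>, OF cov', folded l_def]
  have lN: "l x < N" for x by (rule fb(1))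
  have l_dist: "dist x y < \<epsilon>" if "l x = l y" for x y
  proof -
    have "dist (c (l x)) x < \<rho> (l x)" "dist (c (l x)) y < \<rho> (l x)"
      using fb(2)[of x] fb(2)[of y] that by auto
    moreover have "\<rho> (l x) < \<epsilon> / 2" using \<rho>(2)[of "l x"] aw by linarith
    ultimately show ?thesis using dist_triangle3[of x y "c (l x)"] by simp
  qed
  have cell_s: "l -` {i} \<in> sets borel" for i unfolding fb(3) by auto
  have l_meas: "l \<in> measurable borel (count_space UNIV)"
  proof (rule measurable_count_space_eq2_countable[THEN iffD2, rotated])
    show "l \<in> space borel \<rightarrow> UNIV \<and> (\<forall>a\<in>UNIV. l -` {a} \<inter> space borel \<in> sets borel)" using cell_s by auto
  qed
  have cont_ball: "cont (ball (c i) (\<rho> i))" for i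
  proof -
    have "cball (c i) (\<rho> i) - ball (c i) (\<rho> i) = {y. dist (c i) y = \<rho> i}" by auto
    then show ?thesis unfolding cont_def using \<rho>(3)[of i]
      by (intro exI[of _ "ball (c i) (\<rho> i)"] exI[of _ "cball (c i) (\<rho> i)"]) auto
  qed
  have cont_cell: "cont (l -` {i})" for i
  proof -
    have "l -` {i} = ball (c i) (\<rho> i) \<inter> (\<Inter>j\<in>{..<i}. - ball (c j) (\<rho> j))" unfolding fb(3) by auto
    then show ?thesis using cont_ball by (auto intro!: cont_Int cont_INT cont_Compl)
  qed
  show thesis
  proof (rule that[OF \<mu>inv])
    fix T p and e :: real assume T: "T \<subseteq> carrier G" "finite T" "T \<noteq> {}" and p: "p > (0::real)" and e: "e > 0"
    have cyl: "cylinder l T u = (\<Inter>t\<in>T. \<phi> t -` (l -` {u t}))" for u by (auto simp: cylinder_def)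
    have cyl_eq: "\<nu> (cylinder l T u) = measure \<mu> (cylinder l T u)" for u
    proof (rule cont_eq)
      show "cont (cylinder l T u)"
        unfolding cyl using T by (intro cont_INT' cont_vimage cont_cell) auto
      have "\<phi> t -` (l -` {u t}) \<in> sets borel" if "t \<in> T" for t
        using measurable_sets[OF act_measurable cell_s, of t] that T by auto
      then show "cylinder l T u \<in> sets borel" unfolding cyl using T by (intro sets.finite_INT) auto
    qed
    have ent: "card T * cover_entropy G \<phi> (4 * \<epsilon>) \<le> (\<Sum>u\<in>T \<rightarrow>\<^sub>E {..<N}. entropy_term (measure \<mu> (cylinder l T u)))"
    proof -
      have "card T * cover_entropy G \<phi> (4 * \<epsilon>) \<le> (\<Sum>u\<in>T \<rightarrow>\<^sub>E {..<N}. entropy_term (\<nu> (cylinder l T u)))"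
        by (rule H\<nu>) (use T lN l_dist in auto)
      then show ?thesis unfolding cyl_eq .
    qed
    show "ereal (card T * (cover_entropy G \<phi> (4 * \<epsilon>) - ln 2 - ln (real N) * (e powr p / r powr p + 2 * \<kappa>)))
        \<le> rate_distortion \<phi> \<mu> p e T"
      unfolding rate_distortion_def
    proof (rule Inf_greatest, clarify)
      fix M :: "('x \<times> ('a \<Rightarrow> 'x)) measure" and X Y assume adm: "admissible \<phi> \<mu> p e T M X Y"
      then have M: "prob_space M" and X: "X \<in> borel_measurable M" and Y: "\<And>g. g \<in> T \<Longrightarrow> Y g \<in> borel_measurable M"
        and dX: "distr M borel X = \<mu>" by (auto simp: admissible_def)
      interpret M: prob_space M by fact
      have "(\<Sum>g\<in>T. measure M {\<omega>\<in>space M. l (\<phi> g (X \<omega>)) \<noteq> l (Y g \<omega>)})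
          \<le> (\<Sum>g\<in>T. measure M {\<omega>\<in>space M. r \<le> dist (\<phi> g (X \<omega>)) (Y g \<omega>)} + 2 * \<kappa>)"
      proof (rule sum_mono)
        fix g assume g: "g \<in> T"
        then have gc: "g \<in> carrier G" using T by auto
        let ?far = "{\<omega>\<in>space M. r \<le> dist (\<phi> g (X \<omega>)) (Y g \<omega>)}" and ?bad = "{\<omega>\<in>space M. \<phi> g (X \<omega>) \<in> bad}"
        have gX: "(\<lambda>\<omega>. \<phi> g (X \<omega>)) \<in> borel_measurable M" by (rule measurable_compose[OF X act_measurable[OF gc]])
        have "(\<lambda>\<omega>. dist (\<phi> g (X \<omega>)) (Y g \<omega>)) \<in> borel_measurable M"
          by (rule borel_measurable_dist_compact[OF compact_UNIV gX Y[OF g]])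
        then have far: "?far \<in> sets M" by measurable
        have bd: "?bad \<in> sets M" using measurable_sets[OF gX bad(2)] by (simp add: vimage_def Int_def conj_commute)
        \<comment> \<open>Outside both events Y g is within r of g X, and the r-ball about g X
          carries a single label.\<close>
        have "measure M {\<omega>\<in>space M. l (\<phi> g (X \<omega>)) \<noteq> l (Y g \<omega>)} \<le> measure M (?far \<union> ?bad)"
          using far bd by (intro M.finite_measure_mono) (auto simp: bad_def not_le)
        also have "\<dots> \<le> measure M ?far + measure M ?bad" by (rule measure_Un_le[OF far bd])
        also have "measure M ?bad = measure \<mu> (\<phi> g -` bad)"
        proof -
          have "measure (distr M borel X) (\<phi> g -` bad) = measure M (X -` (\<phi> g -` bad) \<inter> space M)"
            using measurable_sets[OF act_measurable[OF gc] bad(2)] by (intro measure_distr X) simp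
          then show ?thesis unfolding dX by (simp add: vimage_def Int_def conj_commute)
        qed
        also have "\<dots> \<le> 2 * \<kappa>" using \<mu>_vim[OF gc bad(2)] bad(1) by simp
        finally show "measure M {\<omega>\<in>space M. l (\<phi> g (X \<omega>)) \<noteq> l (Y g \<omega>)} \<le> measure M ?far + 2 * \<kappa>" by simp
      qed
      also have "\<dots> \<le> card T * (e powr p / r powr p) + card T * (2 * \<kappa>)"
        using sum_prob_far_le[OF adm T p r(1)] by (simp add: sum.distrib)
      finally have err: "(\<Sum>g\<in>T. measure M {\<omega>\<in>space M. l (\<phi> g (X \<omega>)) \<noteq> l (Y g \<omega>)})
          \<le> card T * (e powr p / r powr p + 2 * \<kappa>)" by (simp add: algebra_simps)
      have "N > 0" using lN[of undefined] by simp
      then have "ln (real N) * (\<Sum>g\<in>T. measure M {\<omega>\<in>space M. l (\<phi> g (X \<omega>)) \<noteq> l (Y g \<omega>)})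
          \<le> ln (real N) * (card T * (e powr p / r powr p + 2 * \<kappa>))"
        using err by (intro mult_left_mono) auto
      then have "card T * (cover_entropy G \<phi> (4 * \<epsilon>) - ln 2 - ln (real N) * (e powr p / r powr p + 2 * \<kappa>))
          \<le> (\<Sum>u\<in>T \<rightarrow>\<^sub>E {..<N}. entropy_term (measure \<mu> (cylinder l T u))) - card T * ln 2
            - ln (real N) * (\<Sum>g\<in>T. measure M {\<omega>\<in>space M. l (\<phi> g (X \<omega>)) \<noteq> l (Y g \<omega>)})"
        using ent by (simp add: algebra_simps)
      then have "ereal (card T * (cover_entropy G \<phi> (4 * \<epsilon>) - ln 2 - ln (real N) * (e powr p / r powr p + 2 * \<kappa>)))
          \<le> ereal ((\<Sum>u\<in>T \<rightarrow>\<^sub>E {..<N}. entropy_term (measure \<mu> (cylinder l T u))) - card T * ln 2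
            - ln (real N) * (\<Sum>g\<in>T. measure M {\<omega>\<in>space M. l (\<phi> g (X \<omega>)) \<noteq> l (Y g \<omega>)}))"
        by simp
      also have "\<dots> \<le> family_info T M X Y"
        using family_info_ge[OF M X Y T(1,2) l_meas lN] unfolding dX .
      finally show "ereal (card T * (cover_entropy G \<phi> (4 * \<epsilon>) - ln 2 - ln (real N) * (e powr p / r powr p + 2 * \<kappa>)))
          \<le> family_info T M X Y" .
    qed
  qed
qed

end

section \<open>Asymptotics\<close>

lemma filterlim_powr_at_right_0:
  fixes \<beta> :: real
  assumes "\<beta> > 0"
  shows "filterlim (\<lambda>e. e powr \<beta>) (at_right 0) (at_right 0)"
  unfolding filterlim_at
proof
  have pos: "\<forall>\<^sub>F e in at_right (0::real). e > 0" by (simp add: eventually_at_right_less)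
  show "\<forall>\<^sub>F e in at_right 0. e powr \<beta> \<in> {0<..} \<and> e powr \<beta> \<noteq> 0"
    using pos by eventually_elim auto
  have "((\<lambda>e. e powr \<beta>) \<longlongrightarrow> 0 powr \<beta>) (at_right 0)"
    using assms pos by (intro tendsto_powr') (auto intro!: tendsto_ident_at elim!: eventually_mono)
  then show "((\<lambda>e. e powr \<beta>) \<longlongrightarrow> 0) (at_right 0)" by simp
qed

text \<open>Lets a statement that holds eventually at scale e powr \<theta> be read as one at scale
  e, and conversely.\<close>

lemma filtermap_powr_at_right_0:
  fixes \<beta> :: real
  assumes "\<beta> > 0"
  shows "filtermap (\<lambda>e. e powr \<beta>) (at_right 0) = at_right 0"
proof (rule filtermap_fun_inverse)
  show "filterlim (\<lambda>e. e powr (1 / \<beta>)) (at_right 0) (at_right 0)"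
    using assms by (intro filterlim_powr_at_right_0) auto
  have "\<forall>\<^sub>F e in at_right (0::real). e > 0" by (simp add: eventually_at_right_less)
  then show "\<forall>\<^sub>F e in at_right 0. (e powr (1 / \<beta>)) powr \<beta> = e"
    by eventually_elim (use assms in \<open>simp add: powr_powr\<close>)
qed (rule filterlim_powr_at_right_0[OF assms])

text \<open>With J = \<lfloor>y\<rfloor> and \<kappa> = exp (ln (N + 1) / J) - 1 the power equals N
  + 1 exactly. The constant 4 comes from J \<ge> y / 2 and from exp x - 1 \<le> 2 x on [0,1], where
  the second hypothesis puts the exponent.\<close>

lemma growth_step_exists:
  fixes y :: real and N :: nat
  assumes y: "y \<ge> 1" and x: "2 * ln (real N + 1) \<le> y"
  obtains J :: nat and \<kappa> where "J > 0" "real J \<le> y" "real (N + 1) \<le> (1 + \<kappa>) ^ J" "0 \<le> \<kappa>"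
    "\<kappa> \<le> 4 * ln (real N + 1) / y"
proof -
  define J where "J = nat \<lfloor>y\<rfloor>"
  have fl: "1 \<le> \<lfloor>y\<rfloor>" using y by simp
  then have Jf: "real J = real_of_int \<lfloor>y\<rfloor>" by (simp add: J_def)
  have J: "J > 0" "real J \<le> y" "y / 2 \<le> real J"
    using fl Jf floor_correct[of y] by linarith+
  let ?L = "ln (real N + 1)"
  define x where "x = ?L / J"
  have L0: "?L \<ge> 0" by simp
  have x0: "0 \<le> x" using L0 J by (simp add: x_def)
  have x_le: "x \<le> 2 * ?L / y"
  proof -
    have "x \<le> ?L / (y / 2)" unfolding x_def using L0 J y by (intro divide_left_mono) auto
    then show ?thesis by (simp add: mult.commute)
  qed
  also have "\<dots> \<le> 1" using x y by simp
  finally have x1: "x \<le> 1" .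
  have "exp x - 1 \<le> x + x\<^sup>2" using exp_bound[OF x0 x1] by simp
  also have "\<dots> \<le> 2 * x" using x0 x1 by (simp add: power2_eq_square mult_left_le)
  also have "\<dots> \<le> 4 * ?L / y" using x_le by simp
  finally have "exp x - 1 \<le> 4 * ?L / y" .
  moreover have "(1 + (exp x - 1)) ^ J = real (N + 1)"
    using J by (simp add: x_def flip: exp_of_nat_mult)
  ultimately show thesis using J x0 by (intro that[of J "exp x - 1"]) auto
qed

section \<open>Choice of the scales and comparison of the limits\<close>

context compact_system
begin

lemma dist_eq_dist_on: "(dist :: 'x \<Rightarrow> 'x \<Rightarrow> real) = dist_on \<phi> {\<one>}"
  by (simp add: fun_eq_iff dist_on_def act_one)

lemma cover_num_centers:
  assumes "u > 0"
  obtains c :: "nat \<Rightarrow> 'x" where "\<And>x. \<exists>i<cover_num (dist :: 'x \<Rightarrow> 'x \<Rightarrow> real) u. dist (c i) x \<le> u"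
proof -
  have one: "{\<one>} \<subseteq> carrier G" "finite {\<one>}" "{\<one>} \<noteq> {}" by auto
  obtain \<U> where U: "finite \<U>" "\<And>U. U \<in> \<U> \<Longrightarrow> open U" "\<And>U. U \<in> \<U> \<Longrightarrow> diam (dist_on \<phi> {\<one>}) U < u"
    "\<Union>\<U> = UNIV" "card \<U> = cover_num (dist_on \<phi> {\<one>}) u" using dist_on_cover[OF one assms] by blast
  obtain C and N :: nat where C: "\<U> = C ` {i. i < N}" and inj: "inj_on C {i. i < N}"
    using finite_imp_nat_seg_image_inj_on[OF U(1)] by metis
  have N: "N = cover_num (dist_on \<phi> {\<one>}) u" using U(5) C card_image[OF inj] by simp
  define c where "c i = (SOME z. z \<in> C i)" for i
  have "\<exists>i<N. dist (c i) x \<le> u" for x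
  proof -
    have "x \<in> \<Union>\<U>" using U(4) by simp
    then obtain i where i: "i < N" "x \<in> C i" using C by auto
    then have ci: "c i \<in> C i" unfolding c_def by (intro someI)
    have "C i \<in> \<U>" using i C by auto
    then obtain s where "s < u" "\<forall>x\<in>C i. \<forall>y\<in>C i. \<forall>g\<in>{\<one>}. dist (\<phi> g x) (\<phi> g y) \<le> s"
      using U(3) diam_dist_on_less_iff[OF one(2,3) assms] by blast
    then have "dist (c i) x \<le> s" "s < u" using i ci by (auto simp: act_one)
    then show ?thesis using i(1) by (intro exI[of _ i]) auto
  qed
  moreover have "cover_num (dist :: 'x \<Rightarrow> 'x \<Rightarrow> real) u = N" unfolding N dist_eq_dist_on ..
  ultimately show thesis by (intro that[of c]) simp
qed

text \<open>Here t is the scale of the covering entropy, u that of the ball centers, e the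
  distortion. The majorant V = u powr (- \<delta>) satisfies 2 ln N \<le> V and ln (N + 1) \<le> V.
  The losses are ln 2 per coordinate, the Markov term and the padding term; together they stay below
  3.\<close>

lemma rate_lower_ge:
  assumes F: "folner_sequence G F" and p: "p \<ge> 1" and e: "0 < e"
    and t: "t > 0" and u: "u = t / 16" "u < 1" and \<delta>: "\<delta> > 0"
    and N: "u powr \<delta> * ln (real (cover_num (dist :: 'x \<Rightarrow> 'x \<Rightarrow> real) u)) \<le> 1 / 2"
    and ln2: "u powr \<delta> * ln 2 \<le> 1 / 2" and eu: "24 * e * u powr - (1 + 3 * \<delta>) \<le> 1"
  obtains \<mu> where "\<mu> \<in> invariant_measures G \<phi>" "ereal (cover_entropy G \<phi> t - 3) \<le> rate_lower \<phi> \<mu> p F e"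
proof -
  have Fn: "F n \<subseteq> carrier G" "finite (F n)" "F n \<noteq> {}" for n using F by (auto simp: folner_sequence_def)
  have u0: "u > 0" using t u by simp
  define N where "N = cover_num (dist :: 'x \<Rightarrow> 'x \<Rightarrow> real) u"
  define V where "V = u powr - \<delta>"
  have V0: "V > 0" using u0 by (simp add: V_def)
  have "u powr \<delta> \<le> 1" using u0 u(2) \<delta> by (intro powr_le1) auto
  then have V1: "V \<ge> 1" using u0 by (simp add: V_def powr_minus one_le_inverse)
  have uV: "u powr \<delta> = 1 / V" using u0 by (simp add: V_def powr_minus divide_inverse)
  have N1: "N \<ge> 1" unfolding N_def dist_eq_dist_on using u0 by (intro cover_num_ge_1) auto
  have lnN: "ln (real N) \<le> V / 2" using assms(8) V0 by (simp add: N_def[symmetric] uV field_simps)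
  have lnN1: "ln (real N + 1) \<le> V"
  proof -
    have "ln (real N + 1) \<le> ln (2 * real N)" using N1 by (intro ln_mono) auto
    also have "\<dots> = ln 2 + ln (real N)" using N1 by (simp add: ln_mult_pos)
    also have "ln 2 \<le> V / 2" using ln2 V0 by (simp add: uV field_simps)
    finally show ?thesis using lnN by simp
  qed
  have lnN0: "ln (real N) \<ge> 0" "ln (real N + 1) \<ge> 0" using N1 by auto
  \<comment> \<open>With e / r = 1 / V and p \<ge> 1 the Markov term is at most 1 / V, which absorbs
    ln N.\<close>
  define r where "r = e * V"
  have r0: "r > 0" using e V0 by (simp add: r_def)
  \<comment> \<open>One factor V is hidden in r, one enters \<kappa> through ln (N + 1), and one is
    the ln N multiplying \<kappa>. Hence the exponent 1 + 3 \<delta> in the hypothesis.\<close>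
  have key: "24 * r * V * V \<le> u"
  proof -
    have "u powr - (1 + 3 * \<delta>) = V * V * V / u"
    proof -
      have "u powr - (1 + 3 * \<delta>) = u powr (- \<delta> + - \<delta> + - \<delta> - 1)"
        by (rule arg_cong[of _ _ "(powr) u"]) simp
      also have "\<dots> = V * V * V / u" using u0 unfolding V_def powr_diff powr_add by simp
      finally show ?thesis .
    qed
    then have "24 * e * (V * V * V / u) \<le> 1" using eu by simp
    then show ?thesis using u0 by (simp add: r_def field_simps)
  qed
  have rV: "24 * r * V \<le> u" "24 * r \<le> u"
  proof -
    have "r * V * 1 \<le> r * V * V" using r0 V0 V1 by (intro mult_left_mono) auto
    then show 1: "24 * r * V \<le> u" using key by simp
    have "r * 1 \<le> r * V" using r0 V1 by (intro mult_left_mono) auto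
    then show "24 * r \<le> u" using 1 by simp
  qed
  \<comment> \<open>A bound on the number of growth steps: J \<le> u / (3 r) leaves each annulus of
    width w = u / J at least 3 r wide.\<close>
  let ?y = "u / (3 * r)"
  have y1: "?y \<ge> 1" using rV r0 by (simp add: field_simps)
  have "2 * ln (real N + 1) \<le> 2 * V" using lnN1 by simp
  also have "\<dots> \<le> ?y" using rV r0 by (simp add: field_simps)
  finally have y2: "2 * ln (real N + 1) \<le> ?y" .
  obtain J :: nat and \<kappa> where J: "J > 0" "real J \<le> ?y" and \<kappa>: "real (N + 1) \<le> (1 + \<kappa>) ^ J" "0 \<le> \<kappa>"
    "\<kappa> \<le> 4 * ln (real N + 1) / ?y"
    using growth_step_exists[OF y1 y2] by blast
  obtain c :: "nat \<Rightarrow> 'x" where c: "\<And>x. \<exists>i<N. dist (c i) x \<le> u"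
    using cover_num_centers[OF u0] unfolding N_def by blast
  have r_w: "2 * r < u / J"
  proof -
    have "3 * r * J \<le> u" using J r0 by (simp add: field_simps)
    then have "3 * r \<le> u / J" using J by (simp add: field_simps)
    then show ?thesis using r0 by simp
  qed
  \<comment> \<open>The covering radius u and the total growth J w = u together use 2 u = t / 8,
    which is \<epsilon> / 2 for \<epsilon> = t / 4.\<close>
  have aw: "u + J * (u / J) \<le> (t / 4) / 2" using J u by simp
  have t4: "t / 4 > 0" using t by simp
  obtain \<mu> where \<mu>: "\<mu> \<in> invariant_measures G \<phi>"
    and lb: "\<And>T p e. T \<subseteq> carrier G \<Longrightarrow> finite T \<Longrightarrow> T \<noteq> {} \<Longrightarrow> p > 0 \<Longrightarrow> e > 0 \<Longrightarrow>
      ereal (card T * (cover_entropy G \<phi> (4 * (t / 4)) - ln 2 - ln (real N) * (e powr p / r powr p + 2 * \<kappa>)))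
        \<le> rate_distortion \<phi> \<mu> p e T"
    using rate_distortion_lower_bound[OF F t4 c aw \<kappa>(1,2) r0 r_w] by blast
  have "ln (real N) * (e powr p / r powr p + 2 * \<kappa>) \<le> 2"
  proof -
    have "e powr p / r powr p = (1 / V) powr p"
      using e V0 r0 by (simp add: r_def powr_mult powr_divide)
    also have "\<dots> \<le> (1 / V) powr 1" using V0 V1 p by (intro powr_mono') auto
    also have "\<dots> = 1 / V" using V0 by simp
    finally have "ln (real N) * (e powr p / r powr p) \<le> V / 2 * (1 / V)"
      using lnN lnN0 V0 by (intro mult_mono) auto
    also have "\<dots> = 1 / 2" using V0 by simp
    finally have 1: "ln (real N) * (e powr p / r powr p) \<le> 1 / 2" .
    have "ln (real N) * (2 * \<kappa>) \<le> V / 2 * (2 * (4 * V / ?y))"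
    proof (rule mult_mono[OF lnN])
      have "4 * ln (real N + 1) / ?y \<le> 4 * V / ?y" using lnN1 y1 by (intro divide_right_mono) auto
      then show "2 * \<kappa> \<le> 2 * (4 * V / ?y)" using \<kappa>(3) by linarith
    qed (use V0 \<kappa>(2) in auto)
    also have "\<dots> = 12 * r * V * V / u" using r0 u0 by (simp add: field_simps)
    also have "\<dots> \<le> 1 / 2" using key u0 by (simp add: field_simps)
    finally show ?thesis using 1 unfolding distrib_left by linarith
  qed
  moreover have "ln 2 \<le> (1 :: real)" using ln_le_minus_one[of 2] by simp
  ultimately have C: "cover_entropy G \<phi> t - 3
      \<le> cover_entropy G \<phi> (4 * (t / 4)) - ln 2 - ln (real N) * (e powr p / r powr p + 2 * \<kappa>)"
    by simp
  have "ereal (cover_entropy G \<phi> t - 3) \<le> rate_lower \<phi> \<mu> p F e"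
    unfolding rate_lower_def
  proof (rule Liminf_bounded, rule always_eventually, rule allI)
    fix n
    have pos: "real (card (F n)) > 0" using Fn[of n] by (simp add: card_gt_0_iff)
    have "ereal (card (F n) * (cover_entropy G \<phi> t - 3)) \<le> ereal (card (F n) *
        (cover_entropy G \<phi> (4 * (t / 4)) - ln 2 - ln (real N) * (e powr p / r powr p + 2 * \<kappa>)))"
      using C by (simp add: mult_left_mono)
    also have "\<dots> \<le> rate_distortion \<phi> \<mu> p e (F n)"
      using p e by (intro lb Fn) auto
    finally have "ereal (card (F n) * (cover_entropy G \<phi> t - 3)) / ereal (card (F n))
        \<le> rate_distortion \<phi> \<mu> p e (F n) / ereal (card (F n))"
      using pos by (intro ereal_divide_right_mono) auto
    then show "ereal (cover_entropy G \<phi> t - 3) \<le> rate_distortion \<phi> \<mu> p e (F n) / ereal (card (F n))"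
      using pos by simp
  qed
  with \<mu> show thesis by (rule that)
qed

text \<open>\<open>rate_lower_ge\<close> with t = e powr \<theta>. The measure it provides varies
  with e, which the supremum absorbs.\<close>

lemma eventually_SUP_rate_lower_ge:
  assumes F: "folner_sequence G F" and p: "p \<ge> 1" and tame: "tame_growth TYPE('x)"
    and \<theta>: "0 < \<theta>" "\<theta> < 1"
  shows "\<forall>\<^sub>F e in at_right 0.
    ereal (cover_entropy G \<phi> (e powr \<theta>) - 3) \<le> (SUP \<mu>\<in>invariant_measures G \<phi>. rate_lower \<phi> \<mu> p F e)"
proof -
  \<comment> \<open>This makes 3 \<theta> \<delta> = (1 - \<theta>) / 2, so that \<beta> = (1 -
    \<theta>) / 2 is positive; the condition on e and u then reads: a constant times e powr \<beta>
    is at most 1.\<close>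
  define \<delta> where "\<delta> = (1 - \<theta>) / (6 * \<theta>)"
  define \<beta> where "\<beta> = 1 - \<theta> * (1 + 3 * \<delta>)"
  have \<delta>: "\<delta> > 0" using \<theta> by (simp add: \<delta>_def)
  have \<beta>: "\<beta> > 0" using \<theta> by (simp add: \<beta>_def \<delta>_def field_simps)
  let ?u = "\<lambda>e :: real. e powr \<theta> / 16"
  have pos: "\<forall>\<^sub>F e in at_right (0::real). e > 0" by (simp add: eventually_at_right_less)
  have u_lim: "filterlim ?u (at_right 0) (at_right 0)"
    unfolding filterlim_at
  proof
    have "((\<lambda>e. e powr \<theta>) \<longlongrightarrow> 0) (at_right (0::real))"
      using filterlim_powr_at_right_0[OF \<theta>(1)] by (simp add: filterlim_at)
    then show "(?u \<longlongrightarrow> 0) (at_right 0)" using tendsto_divide[OF _ tendsto_const, of "\<lambda>e. e powr \<theta>" 0 _ "16::real"] by simp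
    show "\<forall>\<^sub>F e in at_right 0. ?u e \<in> {0<..} \<and> ?u e \<noteq> 0" using pos by eventually_elim auto
  qed
  have "((\<lambda>u. u powr \<delta> * ln (real (cover_num (dist :: 'x \<Rightarrow> 'x \<Rightarrow> real) u))) \<longlongrightarrow> 0) (at_right 0)"
    using tame \<delta> by (simp add: tame_growth_def)
  then have 1: "\<forall>\<^sub>F e in at_right 0. ?u e powr \<delta> * ln (real (cover_num (dist :: 'x \<Rightarrow> 'x \<Rightarrow> real) (?u e))) < 1 / 2"
    using filterlim_compose[OF _ u_lim] by (intro order_tendstoD(2)) auto
  have "((\<lambda>u. u powr \<delta>) \<longlongrightarrow> 0) (at_right (0::real))"
    using filterlim_powr_at_right_0[OF \<delta>] by (simp add: filterlim_at)
  then have "((\<lambda>u. u powr \<delta> * ln 2) \<longlongrightarrow> 0 * ln 2) (at_right (0::real))" by (intro tendsto_mult tendsto_const)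
  then have "((\<lambda>e. ?u e powr \<delta> * ln 2) \<longlongrightarrow> 0) (at_right 0)"
    using filterlim_compose[OF _ u_lim] by fastforce
  then have 2: "\<forall>\<^sub>F e in at_right 0. ?u e powr \<delta> * ln 2 < 1 / 2" by (intro order_tendstoD(2)) auto
  have "((\<lambda>e. e powr \<beta>) \<longlongrightarrow> 0) (at_right (0::real))"
    using filterlim_powr_at_right_0[OF \<beta>] by (simp add: filterlim_at)
  then have "((\<lambda>e. 24 * 16 powr (1 + 3 * \<delta>) * e powr \<beta>) \<longlongrightarrow> 24 * 16 powr (1 + 3 * \<delta>) * 0) (at_right (0::real))"
    by (intro tendsto_mult tendsto_const)
  then have 3: "\<forall>\<^sub>F e in at_right (0::real). 24 * 16 powr (1 + 3 * \<delta>) * e powr \<beta> < 1"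
    by (intro order_tendstoD(2)) auto
  have "(?u \<longlongrightarrow> 0) (at_right 0)" using u_lim by (simp add: filterlim_at)
  then have 4: "\<forall>\<^sub>F e in at_right (0::real). ?u e < 1" by (rule order_tendstoD(2)) simp
  show ?thesis
    using 1 2 3 4 pos
  proof eventually_elim
    case (elim e)
    have eu: "24 * e * ?u e powr - (1 + 3 * \<delta>) \<le> 1"
    proof -
      have "?u e powr - (1 + 3 * \<delta>) = (e powr \<theta>) powr - (1 + 3 * \<delta>) / 16 powr - (1 + 3 * \<delta>)"
        by (rule powr_divide)
      also have "\<dots> = e powr (- (\<theta> * (1 + 3 * \<delta>))) * 16 powr (1 + 3 * \<delta>)"
        unfolding powr_powr mult_minus_right powr_minus divide_inverse inverse_inverse_eq ..
      finally have "e * ?u e powr - (1 + 3 * \<delta>) = 16 powr (1 + 3 * \<delta>) * (e powr 1 * e powr (- (\<theta> * (1 + 3 * \<delta>))))"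
        using elim(5) by simp
      also have "e powr 1 * e powr (- (\<theta> * (1 + 3 * \<delta>))) = e powr \<beta>"
        by (simp only: powr_add[symmetric] \<beta>_def diff_conv_add_uminus)
      finally show ?thesis using elim(3) by (simp add: mult.assoc)
    qed
    obtain \<mu> where "\<mu> \<in> invariant_measures G \<phi>" "ereal (cover_entropy G \<phi> (e powr \<theta>) - 3) \<le> rate_lower \<phi> \<mu> p F e"
      using rate_lower_ge[OF F p elim(5), of "e powr \<theta>" "?u e" \<delta>] elim eu \<delta> by auto
    then show ?case by (meson SUP_upper2)
  qed
qed

text \<open>An implication for each small e serves both limits: its contrapositive bounds the limsup
  and its direct form the liminf. Half of the gap y' - y pays for the factor \<theta>, the other
  half for 3 / |ln e|.\<close>

lemma rates_compare:
  fixes y y' :: real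
  assumes F: "folner_sequence G F" and p: "p \<ge> 1" and tame: "tame_growth TYPE('x)" and y: "y < y'"
  obtains \<theta> where "\<theta> > 0" "\<forall>\<^sub>F e in at_right 0.
    y' < cover_entropy G \<phi> (e powr \<theta>) / \<bar>ln (e powr \<theta>)\<bar> \<longrightarrow>
    ereal y < (SUP \<mu>\<in>invariant_measures G \<phi>. rate_lower \<phi> \<mu> p F e) / ereal \<bar>ln e\<bar>"
proof -
  define h where "h = (y' - y) / 2"
  have h: "h > 0" using y by (simp add: h_def)
  \<comment> \<open>Chosen so that (1 - \<theta>) |y'| < h; the absolute value covers negative y',
    and the minimum with 1 / 2 keeps \<theta> positive.\<close>
  define \<theta> where "\<theta> = 1 - min (1 / 2) (h / (\<bar>y'\<bar> + 1))"
  have \<theta>: "0 < \<theta>" "\<theta> < 1" using h by (auto simp: \<theta>_def min_def divide_le_eq)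
  have \<theta>y: "\<theta> * y' > y' - h"
  proof -
    have "(1 - \<theta>) * y' \<le> (1 - \<theta>) * \<bar>y'\<bar>" using \<theta> by (intro mult_left_mono) auto
    also have "\<dots> \<le> h / (\<bar>y'\<bar> + 1) * \<bar>y'\<bar>" by (intro mult_right_mono) (auto simp: \<theta>_def)
    also have "\<dots> < h" using h by (simp add: divide_less_eq field_simps)
    finally show ?thesis by (simp add: algebra_simps)
  qed
  have "filterlim (\<lambda>e :: real. ln e) at_bot (at_right 0)" by (rule ln_at_0)
  then have "\<forall>\<^sub>F e in at_right (0::real). ln e < - (3 / h)" by (simp add: filterlim_at_bot_dense)
  moreover have "\<forall>\<^sub>F e in at_right (0::real). e > 0" by (simp add: eventually_at_right_less)
  moreover note eventually_SUP_rate_lower_ge[OF F p tame \<theta>]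
  ultimately have "\<forall>\<^sub>F e in at_right 0.
    y' < cover_entropy G \<phi> (e powr \<theta>) / \<bar>ln (e powr \<theta>)\<bar> \<longrightarrow>
    ereal y < (SUP \<mu>\<in>invariant_measures G \<phi>. rate_lower \<phi> \<mu> p F e) / ereal \<bar>ln e\<bar>"
  proof eventually_elim
    case (elim e)
    show ?case
    proof
      assume *: "y' < cover_entropy G \<phi> (e powr \<theta>) / \<bar>ln (e powr \<theta>)\<bar>"
      let ?l = "\<bar>ln e\<bar>" and ?S = "cover_entropy G \<phi> (e powr \<theta>)"
      have "3 / h > 0" using h by simp
      then have l: "?l > 3 / h" "?l > 0" using elim(1) by linarith+
      have "\<bar>ln (e powr \<theta>)\<bar> = \<theta> * ?l" using elim(2) \<theta> by (simp add: ln_powr abs_mult)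
      then have "y' * (\<theta> * ?l) < ?S" using * l \<theta> by (simp add: less_divide_eq)
      moreover have "(y' - h) * ?l < \<theta> * y' * ?l" using \<theta>y l by (intro mult_strict_right_mono) auto
      moreover have "3 < h * ?l" using l(1) h by (simp add: divide_less_eq mult.commute)
      ultimately have "(y' - h - h) * ?l < ?S - 3" by (simp add: algebra_simps)
      then have "y * ?l < ?S - 3" by (simp add: h_def)
      then have "y < (?S - 3) / ?l" using l by (simp add: less_divide_eq)
      then have "ereal y < ereal (?S - 3) / ereal ?l" using l by simp
      also have "\<dots> \<le> (SUP \<mu>\<in>invariant_measures G \<phi>. rate_lower \<phi> \<mu> p F e) / ereal ?l"
        using elim(3) l by (intro ereal_divide_right_mono) auto
      finally show "ereal y < (SUP \<mu>\<in>invariant_measures G \<phi>. rate_lower \<phi> \<mu> p F e) / ereal ?l" .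
    qed
  qed
  with \<theta>(1) show thesis by (rule that)
qed

text \<open>Two reals y < y' are placed in a supposed gap. \<open>rates_compare\<close> links the
  rate quotient at e to the entropy quotient at e powr \<theta>, and e -> e powr \<theta> leaves the
  filter \<open>at_right 0\<close> unchanged, so the contradiction appears at scale e.\<close>

lemma mdim_le_rates:
  assumes F: "folner_sequence G F" and p: "p \<ge> 1" and tame: "tame_growth TYPE('x)"
  defines "A \<equiv> \<lambda>e. (SUP \<mu>\<in>invariant_measures G \<phi>. rate_lower \<phi> \<mu> p F e) / ereal \<bar>ln e\<bar>"
  shows "mdim_upper G \<phi> \<le> Limsup (at_right 0) A" and "mdim_lower G \<phi> \<le> Liminf (at_right 0) A"
proof -
  let ?B = "\<lambda>e. ereal (cover_entropy G \<phi> e / \<bar>ln e\<bar>)"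
  have transfer: "(\<forall>\<^sub>F e in at_right 0. Q (e powr \<theta>)) \<longleftrightarrow> (\<forall>\<^sub>F e in at_right 0. Q e)"
    if "\<theta> > 0" for Q and \<theta> :: real
    using filtermap_powr_at_right_0[OF that] by (metis eventually_filtermap)
  show "mdim_upper G \<phi> \<le> Limsup (at_right 0) A"
    unfolding mdim_upper_def
  proof (rule ccontr)
    assume "\<not> Limsup (at_right 0) ?B \<le> Limsup (at_right 0) A"
    then have "Limsup (at_right 0) A < Limsup (at_right 0) ?B" by simp
    then obtain y where y: "Limsup (at_right 0) A < ereal y" "ereal y < Limsup (at_right 0) ?B"
      using ereal_dense2 by blast
    then obtain y' where y': "ereal y < ereal y'" "ereal y' < Limsup (at_right 0) ?B"
      using ereal_dense2 by blast
    then have "y < y'" by simp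
    from rates_compare[OF F p tame this] obtain \<theta> where \<theta>: "\<theta> > 0" and ev: "\<forall>\<^sub>F e in at_right 0.
      y' < cover_entropy G \<phi> (e powr \<theta>) / \<bar>ln (e powr \<theta>)\<bar> \<longrightarrow> ereal y < A e"
      unfolding A_def by blast
    from Limsup_lessD[OF y(1)] ev have "\<forall>\<^sub>F e in at_right 0. ?B (e powr \<theta>) \<le> ereal y'"
      by eventually_elim (auto simp: not_less)
    then have "\<forall>\<^sub>F e in at_right 0. ?B e \<le> ereal y'"
      by (rule transfer[OF \<theta>, of "\<lambda>e. ?B e \<le> ereal y'", THEN iffD1])
    then have "Limsup (at_right 0) ?B \<le> ereal y'" by (rule Limsup_bounded)
    with y'(2) show False by simp
  qed
  show "mdim_lower G \<phi> \<le> Liminf (at_right 0) A"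
    unfolding mdim_lower_def
  proof (rule ccontr)
    assume "\<not> Liminf (at_right 0) ?B \<le> Liminf (at_right 0) A"
    then have "Liminf (at_right 0) A < Liminf (at_right 0) ?B" by simp
    then obtain y where y: "Liminf (at_right 0) A < ereal y" "ereal y < Liminf (at_right 0) ?B"
      using ereal_dense2 by blast
    then obtain y' where y': "ereal y < ereal y'" "ereal y' < Liminf (at_right 0) ?B"
      using ereal_dense2 by blast
    then have "y < y'" by simp
    from rates_compare[OF F p tame this] obtain \<theta> where \<theta>: "\<theta> > 0" and ev: "\<forall>\<^sub>F e in at_right 0.
      y' < cover_entropy G \<phi> (e powr \<theta>) / \<bar>ln (e powr \<theta>)\<bar> \<longrightarrow> ereal y < A e"
      unfolding A_def by blast
    have "\<forall>\<^sub>F e in at_right 0. ereal y' < ?B (e powr \<theta>)"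
      using less_LiminfD[OF y'(2)] by (rule transfer[OF \<theta>, of "\<lambda>e. ereal y' < ?B e", THEN iffD2])
    with ev have "\<forall>\<^sub>F e in at_right 0. ereal y \<le> A e"
      by eventually_elim (auto intro: less_imp_le)
    then have "ereal y \<le> Liminf (at_right 0) A" by (rule Liminf_bounded)
    with y(1) show False by simp
  qed
qed

lemma eventually_rates_le:
  assumes F: "folner_sequence G F" and p: "p > 0"
  defines "A \<equiv> \<lambda>e. (SUP \<mu>\<in>invariant_measures G \<phi>. rate_lower \<phi> \<mu> p F e) / ereal \<bar>ln e\<bar>"
    and "A' \<equiv> \<lambda>e. (SUP \<mu>\<in>invariant_measures G \<phi>. rate_upper \<phi> \<mu> p F e) / ereal \<bar>ln e\<bar>"
  shows "\<forall>\<^sub>F e in at_right 0. A e \<le> A' e"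
    and "\<forall>\<^sub>F e in at_right 0. A' e \<le> ereal (cover_entropy G \<phi> e / \<bar>ln e\<bar>)"
proof -
  have small: "\<forall>\<^sub>F e in at_right (0::real). 0 < e \<and> e < 1"
    by (auto simp: eventually_at_right_field intro!: exI[of _ 1])
  show "\<forall>\<^sub>F e in at_right 0. A e \<le> A' e"
    using small unfolding A_def A'_def
  proof eventually_elim
    case (elim e)
    have "rate_lower \<phi> \<mu> p F e \<le> rate_upper \<phi> \<mu> p F e" for \<mu>
      unfolding rate_lower_def rate_upper_def by (rule Liminf_le_Limsup) simp
    then have "(SUP \<mu>\<in>invariant_measures G \<phi>. rate_lower \<phi> \<mu> p F e)
        \<le> (SUP \<mu>\<in>invariant_measures G \<phi>. rate_upper \<phi> \<mu> p F e)" by (intro SUP_mono) auto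
    then show ?case using elim by (intro ereal_divide_right_mono) auto
  qed
  show "\<forall>\<^sub>F e in at_right 0. A' e \<le> ereal (cover_entropy G \<phi> e / \<bar>ln e\<bar>)"
    using small unfolding A'_def
  proof eventually_elim
    case (elim e)
    have "(SUP \<mu>\<in>invariant_measures G \<phi>. rate_upper \<phi> \<mu> p F e) \<le> ereal (cover_entropy G \<phi> e)"
      using elim p by (intro SUP_least rate_upper_le_cover_entropy F) auto
    then have "(SUP \<mu>\<in>invariant_measures G \<phi>. rate_upper \<phi> \<mu> p F e) / ereal \<bar>ln e\<bar>
        \<le> ereal (cover_entropy G \<phi> e) / ereal \<bar>ln e\<bar>"
      using elim by (intro ereal_divide_right_mono) auto
    then show ?case using elim by simp
  qed
qed

end

theorem theorem5p4:
  fixes G :: "('g, 'b) monoid_scheme"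
    and \<phi> :: "'g \<Rightarrow> 'x::metric_space \<Rightarrow> 'x"
    and p :: real
    and F :: "nat \<Rightarrow> 'g set"
  assumes "group G" and "countable (carrier G)" and "infinite (carrier G)" and "amenable G"
    and "G_system G \<phi>"
    and "tame_growth TYPE('x)"
    and "p \<ge> 1"
    and "folner_sequence G F"
  shows
    "(mdim_upper G \<phi> =
        Limsup (at_right 0) (\<lambda>\<epsilon>. (SUP \<mu>\<in>invariant_measures G \<phi>. rate_upper \<phi> \<mu> p F \<epsilon>) / ereal \<bar>ln \<epsilon>\<bar>) \<and>
      Limsup (at_right 0) (\<lambda>\<epsilon>. (SUP \<mu>\<in>invariant_measures G \<phi>. rate_upper \<phi> \<mu> p F \<epsilon>) / ereal \<bar>ln \<epsilon>\<bar>) =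
        Limsup (at_right 0) (\<lambda>\<epsilon>. (SUP \<mu>\<in>invariant_measures G \<phi>. rate_lower \<phi> \<mu> p F \<epsilon>) / ereal \<bar>ln \<epsilon>\<bar>)) \<and>
     (mdim_lower G \<phi> =
        Liminf (at_right 0) (\<lambda>\<epsilon>. (SUP \<mu>\<in>invariant_measures G \<phi>. rate_upper \<phi> \<mu> p F \<epsilon>) / ereal \<bar>ln \<epsilon>\<bar>) \<and>
      Liminf (at_right 0) (\<lambda>\<epsilon>. (SUP \<mu>\<in>invariant_measures G \<phi>. rate_upper \<phi> \<mu> p F \<epsilon>) / ereal \<bar>ln \<epsilon>\<bar>) =
        Liminf (at_right 0) (\<lambda>\<epsilon>. (SUP \<mu>\<in>invariant_measures G \<phi>. rate_lower \<phi> \<mu> p F \<epsilon>) / ereal \<bar>ln \<epsilon>\<bar>))"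
proof -
  interpret group G by fact
  interpret compact_system G \<phi> by unfold_locales fact
  have p: "p > 0" using \<open>p \<ge> 1\<close> by simp
  note ev = eventually_rates_le[OF \<open>folner_sequence G F\<close> p]
  note le = mdim_le_rates[OF \<open>folner_sequence G F\<close> \<open>p \<ge> 1\<close> \<open>tame_growth TYPE('x)\<close>]
  \<comment> \<open>The inequalities close up: mean dimension \<le> limit of the lower rates \<le>
    limit of the upper rates \<le> mean dimension, for limsup and liminf alike.\<close>
  show ?thesis
    using Limsup_mono[OF ev(1)] Limsup_mono[OF ev(2), folded mdim_upper_def] le(1)
      Liminf_mono[OF ev(1)] Liminf_mono[OF ev(2), folded mdim_lower_def] le(2)
    by (intro conjI antisym; (rule order_trans; assumption)?; assumption?) (auto intro: order_trans)
qed

end
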